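(* Let $\mathrm{W}^\sigma$ be a Brownian motion with $\mathbb{E}[(\mathrm{W}^\sigma_t)^2]=\sigma^2t$, and consider a random time $\tau$ such that $\mathbb{F}^{\mathrm{W}^\sigma}$ is immersed in the progressive enlargement $\mathbb{G}$ of $\mathbb{F}^{\mathrm{W}^\sigma}$ by $\tau$. Then the $\mathbb{G}$-predictable compensator $\Lambda^{\mathbb{G}}$ of $\tau$ is continuous if and only if $\tau$ avoids $\mathbb{F}^{\mathrm{W}^\sigma}$-stopping times.
   Context: $(\Omega,\mathscr{F},\mathbb{P})$ is a complete probability space; $\mathbb{F}:=\mathbb{F}^{\mathrm{W}^\sigma}$ is the completion of the filtration generated by $\mathrm{W}^\sigma$ (it satisfies the usual conditions). A random time $\tau$ is a $(0,+\infty]$-valued random variable. Put $H_t=1_{\{\tau\le t\}}$, $\mathscr{H}_t=\sigma(H_s,\ s\le t)$, $\mathscr{G}_t=\bigcap_{\varepsilon>0}(\mathscr{F}_{t+\varepsilon}\vee\mathscr{H}_{t+\varepsilon})$; $\mathbb{G}=(\mathscr{G}_t)_{t\ge0}$ is the progressive enlargement of $\mathbb{F}$ by $\tau$. $\mathbb{F}$ is immersed in $\mathbb{G}$ if every $\mathbb{F}$-martingale is a $\mathbb{G}$-martingale. $\tau$ avoids $\mathbb{F}$-stopping times if $\mathbb{P}[\tau=\eta<+\infty]=0$ for every $\mathbb{F}$-stopping time $\eta$. The $\mathbb{G}$-predictable compensator $\Lambda^{\mathbb{G}}$ of $\tau$ is the $\mathbb{G}$-predictable compensator of $H$, i.e.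 the unique $\mathbb{G}$-predictable increasing process, null at $0$, such that $H-\Lambda^{\mathbb{G}}$ is a $\mathbb{G}$-martingale; continuity is understood almost surely. *)

theory Defs
  imports "HOL-Probability.Probability"
begin

text \<open>
  Time is \<^typ>\<open>real\<close>, restricted to \<open>t \<ge> 0\<close>. As in the library's locale \<open>filtration\<close>, a filtration
  is a family of values of type \<open>'a measure\<close> of which only the spaces and the sets matter; the
  probability is always that of the ambient measure \<open>M\<close>.
\<close>

subsection \<open>Filtrations\<close>

definition natural_filtration :: "'a measure \<Rightarrow> (real \<Rightarrow> 'a \<Rightarrow> real) \<Rightarrow> real \<Rightarrow> 'a measure" where
  "natural_filtration M X t =
     sigma (space M) (\<Union>s\<in>{0..t}. {X s -` A \<inter> space M |A. A \<in> sets borel})"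

definition completed_natural_filtration ::
    "'a measure \<Rightarrow> (real \<Rightarrow> 'a \<Rightarrow> real) \<Rightarrow> real \<Rightarrow> 'a measure" where
  "completed_natural_filtration M X t =
     sigma (space M) (sets (natural_filtration M X t) \<union> null_sets M)"

definition indicator_process :: "('a \<Rightarrow> ennreal) \<Rightarrow> real \<Rightarrow> 'a \<Rightarrow> real" where
  "indicator_process \<tau> t = indicator {\<omega>. \<tau> \<omega> \<le> ennreal t}"

text \<open>
  The outer \<open>sigma\<close> only packages the intersection as a \<open>'a measure\<close>: see
  \<open>sets_progressive_enlargement\<close> below.
\<close>

definition progressive_enlargement ::
    "'a measure \<Rightarrow> (real \<Rightarrow> 'a measure) \<Rightarrow> ('a \<Rightarrow> ennreal) \<Rightarrow> real \<Rightarrow> 'a measure" where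
  "progressive_enlargement M F \<tau> t =
     sigma (space M)
       (\<Inter>\<epsilon>\<in>{0<..}. sigma_sets (space M)
          (sets (F (t + \<epsilon>)) \<union> sets (natural_filtration M (indicator_process \<tau>) (t + \<epsilon>))))"

subsection \<open>Random times and stopping times\<close>

definition random_time :: "'a measure \<Rightarrow> ('a \<Rightarrow> ennreal) \<Rightarrow> bool" where
  "random_time M \<tau> \<longleftrightarrow> \<tau> \<in> borel_measurable M \<and> (\<forall>\<omega>\<in>space M. 0 < \<tau> \<omega>)"

text \<open>
  The library's \<^const>\<open>stopping_time\<close> takes its values in the index type of the filtration; here
  the index is real and stopping times may be infinite. See \<open>extended_stopping_time_iff\<close>
  below for the relation between the two.
\<close>

definition extended_stopping_time :: "(real \<Rightarrow> 'a measure) \<Rightarrow> ('a \<Rightarrow> ennreal) \<Rightarrow> bool" where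
  "extended_stopping_time F \<eta> \<longleftrightarrow> (\<forall>t\<ge>0. Measurable.pred (F t) (\<lambda>\<omega>. \<eta> \<omega> \<le> ennreal t))"

definition avoids_stopping_times ::
    "'a measure \<Rightarrow> (real \<Rightarrow> 'a measure) \<Rightarrow> ('a \<Rightarrow> ennreal) \<Rightarrow> bool" where
  "avoids_stopping_times M F \<tau> \<longleftrightarrow>
     (\<forall>\<eta>. extended_stopping_time F \<eta> \<longrightarrow>
        measure M {\<omega> \<in> space M. \<tau> \<omega> = \<eta> \<omega> \<and> \<eta> \<omega> < \<infinity>} = 0)"

subsection \<open>Martingales and immersion\<close>

definition martingale :: "'a measure \<Rightarrow> (real \<Rightarrow> 'a measure) \<Rightarrow> (real \<Rightarrow> 'a \<Rightarrow> real) \<Rightarrow> bool" where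
  "martingale M F X \<longleftrightarrow>
     (\<forall>t\<ge>0. X t \<in> borel_measurable (F t) \<and> integrable M (X t)) \<and>
     (\<forall>s t. 0 \<le> s \<longrightarrow> s \<le> t \<longrightarrow> (AE \<omega> in M. real_cond_exp M (F s) (X t) \<omega> = X s \<omega>))"

definition immersed :: "'a measure \<Rightarrow> (real \<Rightarrow> 'a measure) \<Rightarrow> (real \<Rightarrow> 'a measure) \<Rightarrow> bool" where
  "immersed M F G \<longleftrightarrow> (\<forall>X. martingale M F X \<longrightarrow> martingale M G X)"

subsection \<open>Predictable processes and compensators\<close>

definition predictable_sigma :: "'a measure \<Rightarrow> (real \<Rightarrow> 'a measure) \<Rightarrow> ('a \<times> real) measure" where
  "predictable_sigma M F =
     sigma (space M \<times> {0..})
       ({A \<times> {0} |A. A \<in> sets (F 0)} \<union>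
        {A \<times> {s<..t} |A s t. 0 \<le> s \<and> s \<le> t \<and> A \<in> sets (F s)})"

definition predictable :: "'a measure \<Rightarrow> (real \<Rightarrow> 'a measure) \<Rightarrow> (real \<Rightarrow> 'a \<Rightarrow> real) \<Rightarrow> bool" where
  "predictable M F X \<longleftrightarrow> (\<lambda>(\<omega>, t). X t \<omega>) \<in> borel_measurable (predictable_sigma M F)"

text \<open>
  ``Increasing'' has the usual meaning of the general theory of processes: nondecreasing and
  right-continuous. Without right-continuity the compensator would not be unique.
\<close>

definition increasing_process :: "'a measure \<Rightarrow> (real \<Rightarrow> 'a \<Rightarrow> real) \<Rightarrow> bool" where
  "increasing_process M X \<longleftrightarrow>
     (AE \<omega> in M. mono_on {0..} (\<lambda>t. X t \<omega>) \<and> (\<forall>t\<ge>0. continuous (at_right t) (\<lambda>t. X t \<omega>)))"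

text \<open>
  The compensator is determined only up to indistinguishability, hence a predicate.
\<close>

definition predictable_compensator ::
    "'a measure \<Rightarrow> (real \<Rightarrow> 'a measure) \<Rightarrow> ('a \<Rightarrow> ennreal) \<Rightarrow> (real \<Rightarrow> 'a \<Rightarrow> real) \<Rightarrow> bool" where
  "predictable_compensator M G \<tau> \<Lambda> \<longleftrightarrow>
     predictable M G \<Lambda> \<and>
     increasing_process M \<Lambda> \<and>
     (AE \<omega> in M. \<Lambda> 0 \<omega> = 0) \<and>
     martingale M G (\<lambda>t \<omega>. indicator_process \<tau> t \<omega> - \<Lambda> t \<omega>)"

subsection \<open>Brownian motion\<close>

text \<open>
  \<^const>\<open>normal_density\<close> is parametrised by the standard deviation and needs it to be nonzero, so the
  point mass is a separate case; it covers increments over empty intervals and \<open>\<sigma> = 0\<close>.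
\<close>

definition centred_normal :: "real \<Rightarrow> real measure" where
  "centred_normal v =
     (if v = 0 then return borel 0 else density lborel (\<lambda>x. ennreal (normal_density 0 (sqrt v) x)))"

definition brownian_motion :: "'a measure \<Rightarrow> real \<Rightarrow> (real \<Rightarrow> 'a \<Rightarrow> real) \<Rightarrow> bool" where
  "brownian_motion M \<sigma> W \<longleftrightarrow>
     (\<forall>t\<ge>0. W t \<in> borel_measurable M) \<and>
     (AE \<omega> in M. W 0 \<omega> = 0) \<and>
     (\<forall>s t. 0 \<le> s \<longrightarrow> s \<le> t \<longrightarrow>
        distr M borel (\<lambda>\<omega>. W t \<omega> - W s \<omega>) = centred_normal (\<sigma>\<^sup>2 * (t - s))) \<and>
     (\<forall>(t :: nat \<Rightarrow> real) n. 0 \<le> t 0 \<longrightarrow> mono t \<longrightarrow>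
        prob_space.indep_vars M (\<lambda>_. borel) (\<lambda>i \<omega>. W (t (Suc i)) \<omega> - W (t i) \<omega>) {..<n}) \<and>
     (AE \<omega> in M. continuous_on {0..} (\<lambda>t. W t \<omega>))"

subsection \<open>Basic properties\<close>

lemma space_natural_filtration [simp]: "space (natural_filtration M X t) = space M"
  by (auto simp: natural_filtration_def intro!: space_measure_of)

lemma sets_natural_filtration_mono:
  assumes "s \<le> t"
  shows "sets (natural_filtration M X s) \<subseteq> sets (natural_filtration M X t)"
proof -
  have "(\<Union>r\<in>{0..s}. {X r -` A \<inter> space M |A. A \<in> sets borel})
      \<subseteq> (\<Union>r\<in>{0..t}. {X r -` A \<inter> space M |A. A \<in> sets borel})"
    using assms by force
  moreover have "(\<Union>r\<in>{0..t}. {X r -` A \<inter> space M |A. A \<in> sets borel}) \<subseteq> Pow (space M)" for t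
    by auto
  ultimately show ?thesis
    by (simp add: natural_filtration_def sigma_sets_mono')
qed

lemma subalgebra_natural_filtration:
  assumes "\<And>t. t \<ge> 0 \<Longrightarrow> X t \<in> borel_measurable M"
  shows "subalgebra M (natural_filtration M X t)"
proof -
  have "(\<Union>r\<in>{0..t}. {X r -` A \<inter> space M |A. A \<in> sets borel}) \<subseteq> sets M"
    using assms by (auto intro: measurable_sets)
  then have "sets (natural_filtration M X t) \<subseteq> sets M"
    by (simp add: natural_filtration_def sets.sigma_sets_subset sets_measure_of_conv)
  then show ?thesis by (simp add: subalgebra_def)
qed

lemma completed_natural_filtration_generators:
  "sets (natural_filtration M X t) \<union> null_sets M \<subseteq> Pow (space M)"
  using sets.space_closed[of "natural_filtration M X t"] sets.space_closed[of M] by auto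

lemma sets_completed_natural_filtration:
  "sets (completed_natural_filtration M X t) =
     sigma_sets (space M) (sets (natural_filtration M X t) \<union> null_sets M)"
  unfolding completed_natural_filtration_def
  by (intro sets_measure_of completed_natural_filtration_generators)

lemma space_completed_natural_filtration [simp]:
  "space (completed_natural_filtration M X t) = space M"
  unfolding completed_natural_filtration_def
  by (intro space_measure_of completed_natural_filtration_generators)

lemma filtration_completed_natural_filtration:
  "filtration (space M) (completed_natural_filtration M X)"
proof
  show "sets (completed_natural_filtration M X s) \<subseteq> sets (completed_natural_filtration M X t)"
    if "s \<le> t" for s t
    unfolding sets_completed_natural_filtration
    using sets_natural_filtration_mono[OF that, of M X] by (intro sigma_sets_mono') auto
qed simp

lemma subalgebra_completed_natural_filtration:
  assumes "\<And>t. t \<ge> 0 \<Longrightarrow> X t \<in> borel_measurable M"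
  shows "subalgebra M (completed_natural_filtration M X t)"
proof -
  have "sets (natural_filtration M X t) \<union> null_sets M \<subseteq> sets M"
    using subalgebra_natural_filtration[of X M t, OF assms] by (auto simp: subalgebra_def)
  from sets.sigma_sets_subset[OF this] show ?thesis
    by (simp add: subalgebra_def sets_completed_natural_filtration)
qed

lemma progressive_enlargement_generators:
  assumes "\<And>t. space (F t) = space M"
  shows "sets (F u) \<union> sets (natural_filtration M Y u) \<subseteq> Pow (space M)"
  using sets.space_closed[of "F u"] sets.space_closed[of "natural_filtration M Y u"]
  by (simp add: assms)

lemma progressive_enlargement_subset:
  "(\<Inter>\<epsilon>\<in>{0<..}. sigma_sets (space M)
      (sets (F (t + \<epsilon>)) \<union> sets (natural_filtration M Y (t + \<epsilon>)))) \<subseteq>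
    sigma_sets (space M) (sets (F (t + 1)) \<union> sets (natural_filtration M Y (t + 1)))"
  by (rule INT_lower) simp

lemma progressive_enlargement_into_space:
  assumes "\<And>t. space (F t) = space M"
  shows "(\<Inter>\<epsilon>\<in>{0<..}. sigma_sets (space M)
      (sets (F (t + \<epsilon>)) \<union> sets (natural_filtration M Y (t + \<epsilon>)))) \<subseteq> Pow (space M)"
  by (rule order_trans[OF progressive_enlargement_subset])
     (use sigma_sets_into_sp[OF progressive_enlargement_generators[of F, OF assms]] in blast)

lemma sets_progressive_enlargement:
  assumes "\<And>t. space (F t) = space M"
  shows "sets (progressive_enlargement M F \<tau> t) =
     (\<Inter>\<epsilon>\<in>{0<..}. sigma_sets (space M)
        (sets (F (t + \<epsilon>)) \<union> sets (natural_filtration M (indicator_process \<tau>) (t + \<epsilon>))))"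
    (is "_ = (\<Inter>\<epsilon>\<in>_. ?S \<epsilon>)")
proof -
  have "sigma_algebra (space M) (\<Inter>\<epsilon>\<in>{0<..}. ?S \<epsilon>)"
  proof (unfold sigma_algebra_iff2, intro conjI ballI allI impI)
    show "(\<Inter>\<epsilon>\<in>{0<..}. ?S \<epsilon>) \<subseteq> Pow (space M)"
      by (rule progressive_enlargement_into_space[of F, OF assms])
    show "{} \<in> (\<Inter>\<epsilon>\<in>{0<..}. ?S \<epsilon>)" by (auto intro: sigma_sets.Empty)
    show "space M - A \<in> (\<Inter>\<epsilon>\<in>{0<..}. ?S \<epsilon>)" if "A \<in> (\<Inter>\<epsilon>\<in>{0<..}. ?S \<epsilon>)" for A
      using that by (auto intro: sigma_sets.Compl)
    show "(\<Union>i::nat. A i) \<in> (\<Inter>\<epsilon>\<in>{0<..}. ?S \<epsilon>)"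
      if "range A \<subseteq> (\<Inter>\<epsilon>\<in>{0<..}. ?S \<epsilon>)" for A
      using that by (auto intro!: sigma_sets.Union)
  qed
  then show ?thesis
    unfolding progressive_enlargement_def by (rule sigma_algebra.sets_measure_of_eq)
qed

lemma space_progressive_enlargement [simp]:
  assumes "\<And>t. space (F t) = space M"
  shows "space (progressive_enlargement M F \<tau> t) = space M"
  unfolding progressive_enlargement_def
  by (rule space_measure_of) (rule progressive_enlargement_into_space[of F, OF assms])

lemma subalgebra_progressive_enlargement:
  assumes F: "\<And>t. subalgebra M (F t)" and \<tau>: "random_time M \<tau>"
  shows "subalgebra M (progressive_enlargement M F \<tau> t)"
proof -
  have [measurable]: "\<tau> \<in> borel_measurable M" using \<tau> by (simp add: random_time_def)
  have H: "indicator_process \<tau> t \<in> borel_measurable M" for t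
    unfolding indicator_process_def by measurable
  have sp: "\<And>t. space (F t) = space M" using F by (simp add: subalgebra_def)
  have "sigma_sets (space M)
      (sets (F (t + 1)) \<union> sets (natural_filtration M (indicator_process \<tau>) (t + 1))) \<subseteq> sets M"
    using F[of "t + 1"] subalgebra_natural_filtration[of "indicator_process \<tau>" M "t + 1", OF H]
    by (intro sets.sigma_sets_subset) (auto simp: subalgebra_def)
  then have "sets (progressive_enlargement M F \<tau> t) \<subseteq> sets M"
    unfolding sets_progressive_enlargement[of F, OF sp]
    by (rule order_trans[OF progressive_enlargement_subset])
  then show ?thesis using sp by (simp add: subalgebra_def)
qed

lemma extended_stopping_time_iff:
  "extended_stopping_time F \<eta> \<longleftrightarrow>
     stopping_time (\<lambda>t::ennreal. if t = \<infinity> then M else F (enn2real t)) \<eta>"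
proof -
  have "stopping_time (\<lambda>t::ennreal. if t = \<infinity> then M else F (enn2real t)) \<eta> \<longleftrightarrow>
      (\<forall>t. t \<noteq> \<infinity> \<longrightarrow> Measurable.pred (F (enn2real t)) (\<lambda>\<omega>. \<eta> \<omega> \<le> t))"
    by (auto simp: stopping_time_def)
  also have "\<dots> \<longleftrightarrow> extended_stopping_time F \<eta>"
    unfolding extended_stopping_time_def
  proof safe
    fix t :: real
    assume "\<forall>t. t \<noteq> \<infinity> \<longrightarrow> Measurable.pred (F (enn2real t)) (\<lambda>\<omega>. \<eta> \<omega> \<le> t)" "0 \<le> t"
    then show "Measurable.pred (F t) (\<lambda>\<omega>. \<eta> \<omega> \<le> ennreal t)"
      by (auto dest!: spec[of _ "ennreal t"])
  next
    fix t :: ennreal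
    assume "\<forall>t\<ge>0. Measurable.pred (F t) (\<lambda>\<omega>. \<eta> \<omega> \<le> ennreal t)" "t \<noteq> \<infinity>"
    then show "Measurable.pred (F (enn2real t)) (\<lambda>\<omega>. \<eta> \<omega> \<le> t)"
      by (auto dest!: spec[of _ "enn2real t"] simp: less_top)
  qed
  finally show ?thesis by simp
qed

lemma brownian_motion_second_moment:
  assumes "prob_space M" "brownian_motion M \<sigma> W" "0 \<le> t"
  shows "(\<integral>\<omega>. (W t \<omega>)\<^sup>2 \<partial>M) = \<sigma>\<^sup>2 * t"
proof -
  interpret prob_space M by fact
  have [measurable]: "W t \<in> borel_measurable M" "W 0 \<in> borel_measurable M"
    and W0: "AE \<omega> in M. W 0 \<omega> = 0"
    and D: "distr M borel (\<lambda>\<omega>. W t \<omega> - W 0 \<omega>) = centred_normal (\<sigma>\<^sup>2 * (t - 0))"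
    using assms(2,3) unfolding brownian_motion_def by blast+
  have "(\<integral>\<omega>. (W t \<omega>)\<^sup>2 \<partial>M) = (\<integral>\<omega>. (W t \<omega> - W 0 \<omega>)\<^sup>2 \<partial>M)"
    using W0 by (intro integral_cong_AE) (auto elim: eventually_mono)
  also have "\<dots> = (\<integral>x. x\<^sup>2 \<partial>distr M borel (\<lambda>\<omega>. W t \<omega> - W 0 \<omega>))"
    by (subst integral_distr) auto
  also have "\<dots> = (\<integral>x. x\<^sup>2 \<partial>centred_normal (\<sigma>\<^sup>2 * t))"
    by (simp only: D diff_zero)
  also have "\<dots> = \<sigma>\<^sup>2 * t"
  proof (cases "\<sigma>\<^sup>2 * t = 0")
    case True
    then show ?thesis
      by (simp add: centred_normal_def integral_return del: mult_eq_0_iff)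
  next
    case False
    then have pos: "0 < \<sigma>\<^sup>2 * t" using assms(3) by (simp add: zero_less_mult_iff)
    have "(\<integral>x. x\<^sup>2 \<partial>centred_normal (\<sigma>\<^sup>2 * t))
        = (\<integral>x. normal_density 0 (sqrt (\<sigma>\<^sup>2 * t)) x * (x - 0) ^ (2 * 1) \<partial>lborel)"
      using False unfolding centred_normal_def
      by (simp only: if_False) (subst integral_density; simp)
    also have "\<dots> = \<sigma>\<^sup>2 * t"
      using pos by (subst integral_normal_moment_even)
        (auto simp: real_sqrt_gt_0_iff divide_simps power_mult_distrib fact_numeral)
    finally show ?thesis .
  qed
  finally show ?thesis .
qed

end

theory Submission
  imports Defs "HOL-Real_Asymp.Real_Asymp"
begin

text \<open>
  Let \<open>H\<close> be the indicator process of \<open>\<tau>\<close>. Both directions compare \<open>H\<close> and \<open>\<Lambda>\<close> through the identity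
  \<open>E[1\<^sub>D (\<Lambda>\<^sub>t - \<Lambda>\<^sub>s)] = P(D \<inter> {s < \<tau> \<le> t})\<close> for \<open>D \<in> G\<^sub>s\<close> (definition \<open>compensates\<close>).

  Avoidance implies continuity. Let \<open>T\<^sub>u\<close> be the first time at which \<open>\<Lambda>\<close> reaches the level \<open>u\<close>. A jump of
  \<open>\<Lambda>\<close> at time \<open>t\<close> means that \<open>T\<close> sends a whole interval of levels to \<open>t\<close>. The identity above says that on
  predictable sets the law of \<open>(\<omega>, \<tau>)\<close> is the image of \<open>P \<otimes> Lebesgue\<close> under \<open>(\<omega>, u) \<mapsto> (\<omega>, T\<^sub>u)\<close>
  (\<open>emeasure_stopped_at_inverse\<close>). Hence \<open>\<Lambda>\<close> is continuous as soon as \<open>P(\<tau> = T\<^sub>q < \<infinity>) = 0\<close> for every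
  rational level \<open>q\<close>. Immersion provides the same representation with \<open>\<Lambda>\<close> replaced by
  \<open>a\<^sub>t = P(\<tau> \<le> t | F\<^sub>t)\<close> and \<open>G\<close> replaced by the constant filtration \<open>F\<^sub>\<infinity>\<close> (\<open>compensates_azema\<close>): given
  \<open>F\<^sub>\<infinity>\<close>, the law of \<open>\<tau>\<close> is the image of Lebesgue measure under the inverse of \<open>a\<close>. The passage times of
  \<open>a\<close> are stopping times of \<open>F\<close>, so avoidance makes this conditional law diffuse. Up to time \<open>\<tau>\<close> the graph
  of \<open>T\<^sub>q\<close> coincides with a set measurable with respect to \<open>F\<^sub>\<infinity>\<close> and time (\<open>predictable_trace_before\<close>),
  and that set has no point before \<open>\<tau>\<close> when it contains \<open>\<tau>\<close>; a diffuse law cannot charge such a set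
  (\<open>AE_not_in_if_avoids\<close>).

  Continuity implies avoidance. Let \<open>\<eta>\<close> be a stopping time of \<open>F\<close>, \<open>\<zeta> = min \<eta> c\<close> and
  \<open>X\<^sub>t = E[\<zeta> | F\<^sub>t]\<close>. The martingale \<open>X\<close> announces \<open>\<zeta>\<close>: it equals \<open>\<zeta>\<close> from \<open>\<zeta>\<close> on, and exceeds \<open>t\<close> at times \<open>t\<close> before.
  Martingales of a Brownian filtration do not jump, in particular not at \<open>\<tau>\<close> (\<open>no_jump_indicator\<close>). So on
  \<open>{\<tau> = \<eta> \<le> c}\<close> the value of \<open>X\<close> at the last grid point \<open>t\<close> before \<open>\<tau>\<close> is within \<open>\<delta>\<close> of \<open>t\<close>, up to a small
  probability. The first grid point where this happens precedes \<open>\<zeta>\<close> by at most \<open>\<delta>\<close> in the mean, because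
  \<open>X\<close> is a martingale. Thus \<open>P(\<tau> = \<eta> \<le> c)\<close> is bounded by the mean increase of \<open>\<Lambda>\<close> over a random interval
  of vanishing length (\<open>hit_probability_bound\<close>), which tends to \<open>0\<close> for a continuous \<open>\<Lambda>\<close>.
  The absence of jumps is a closed condition on the terminal value, since martingale increments are
  orthogonal (\<open>jump_energy_le\<close>); it is verified on products of functions of finitely many values of
  \<open>W\<close>, whose martingales have continuous versions by the Markov property.
\<close>

section \<open>Laws of random times on predictable sets\<close>

definition predictable_rectangles :: "'a measure \<Rightarrow> (real \<Rightarrow> 'a measure) \<Rightarrow> ('a \<times> real) set set" where
  "predictable_rectangles M K =
     {A \<times> {0} |A. A \<in> sets (K 0)} \<union> {A \<times> {s<..t} |A s t. 0 \<le> s \<and> s \<le> t \<and> A \<in> sets (K s)}"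

lemma predictable_rectangles_into_space:
  assumes "\<And>t. space (K t) = space M"
  shows "predictable_rectangles M K \<subseteq> Pow (space M \<times> {0..})"
  using sets.sets_into_space[of _ "K _"] assms
  by (fastforce simp: predictable_rectangles_def)

lemma sets_predictable_sigma:
  assumes "\<And>t. space (K t) = space M"
  shows "sets (predictable_sigma M K) = sigma_sets (space M \<times> {0..}) (predictable_rectangles M K)"
  using predictable_rectangles_into_space[of K, OF assms]
  unfolding predictable_sigma_def predictable_rectangles_def by (rule sets_measure_of)

lemma space_predictable_sigma:
  assumes "\<And>t. space (K t) = space M"
  shows "space (predictable_sigma M K) = space M \<times> {0..}"
  using predictable_rectangles_into_space[of K, OF assms]
  unfolding predictable_sigma_def predictable_rectangles_def by (rule space_measure_of)

lemma predictable_rectangleI: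
  assumes "\<And>t. space (K t) = space M" "0 \<le> s" "A \<in> sets (K s)"
  shows "A \<times> {s<..t} \<in> sets (predictable_sigma M K)"
proof (cases "s \<le> t")
  case True
  then show ?thesis
    using assms by (auto simp: sets_predictable_sigma predictable_rectangles_def intro!: sigma_sets.Basic)
qed simp

lemma Int_stable_predictable_rectangles:
  assumes mono: "\<And>s t. 0 \<le> s \<Longrightarrow> s \<le> t \<Longrightarrow> sets (K s) \<subseteq> sets (K t)"
  shows "Int_stable (predictable_rectangles M K)"
proof (rule Int_stableI)
  fix a b assume a: "a \<in> predictable_rectangles M K" and b: "b \<in> predictable_rectangles M K"
  have empty: "{} \<in> predictable_rectangles M K"
    unfolding predictable_rectangles_def by (auto intro!: exI[of _ "{}"])
  consider (zero) A B where "a = A \<times> {0}" "b = B \<times> {0}" "A \<in> sets (K 0)" "B \<in> sets (K 0)"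
    | (disj) "a \<inter> b = {}"
    | (ivl) A s t B s' t' where "a = A \<times> {s<..t}" "b = B \<times> {s'<..t'}"
        "0 \<le> s" "0 \<le> s'" "A \<in> sets (K s)" "B \<in> sets (K s')"
    using a b unfolding predictable_rectangles_def by fastforce
  then show "a \<inter> b \<in> predictable_rectangles M K"
  proof cases
    case zero
    then have "a \<inter> b = (A \<inter> B) \<times> {0}" "A \<inter> B \<in> sets (K 0)" by auto
    then show ?thesis unfolding predictable_rectangles_def by blast
  next
    case disj
    then show ?thesis using empty by simp
  next
    case ivl
    have *: "a \<inter> b = (A \<inter> B) \<times> {max s s'<..min t t'}" using ivl by auto
    have "A \<inter> B \<in> sets (K (max s s'))"
      using mono[of s "max s s'"] mono[of s' "max s s'"] ivl by auto
    moreover have "0 \<le> max s s'" using ivl by simp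
    ultimately show ?thesis
    proof (cases "max s s' \<le> min t t'")
      case True
      with \<open>0 \<le> max s s'\<close> \<open>A \<inter> B \<in> sets (K (max s s'))\<close> show ?thesis
        unfolding * predictable_rectangles_def by blast
    next
      case False
      then have "a \<inter> b = {}" unfolding * by auto
      then show ?thesis using empty by simp
    qed
  qed
qed

text \<open>
  The points \<open>x\<close> of a measure space \<open>N\<close> carry both a scenario \<open>p x\<close> and a random time \<open>R x\<close>. This
  generality lets \<open>\<tau>\<close>, living on \<open>M\<close>, be compared with a family of random times indexed by levels,
  living on a product of \<open>M\<close> with the real line.
\<close>

definition stopped_at :: "'b measure \<Rightarrow> ('b \<Rightarrow> 'a) \<Rightarrow> ('b \<Rightarrow> ennreal) \<Rightarrow> ('a \<times> real) set \<Rightarrow> 'b set" where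
  "stopped_at N p R C = {x \<in> space N. R x < \<infinity> \<and> (p x, enn2real (R x)) \<in> C}"

lemma stopped_at_rectangle:
  assumes "0 \<le> s"
  shows "stopped_at N p R (D \<times> {s<..t}) = {x \<in> space N. p x \<in> D \<and> ennreal s < R x \<and> R x \<le> ennreal t}"
proof -
  have eq: "(R x < \<infinity> \<and> s < enn2real (R x) \<and> enn2real (R x) \<le> t) \<longleftrightarrow>
        (ennreal s < R x \<and> R x \<le> ennreal t)" for x
  proof (cases "R x")
    case (real r)
    have 1: "ennreal s < ennreal r \<longleftrightarrow> s < r" using assms real by (simp add: ennreal_less_iff)
    have 2: "s < r \<Longrightarrow> ennreal r \<le> ennreal t \<longleftrightarrow> r \<le> t"
      using assms real by (simp add: ennreal_le_iff2) linarith
    show ?thesis using real 1 2 by auto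
  qed (simp add: top_unique)
  show ?thesis unfolding stopped_at_def by (rule Collect_cong) (use eq in \<open>simp add: conj_ac; metis\<close>)
qed

lemma stopped_at_measurable:
  assumes sp: "\<And>t. space (K t) = space M"
    and p: "\<And>x. x \<in> space N \<Longrightarrow> p x \<in> space M"
      "\<And>t D. 0 \<le> t \<Longrightarrow> D \<in> sets (K t) \<Longrightarrow> {x \<in> space N. p x \<in> D} \<in> sets N"
    and R [measurable]: "R \<in> borel_measurable N"
    and C: "C \<in> sets (predictable_sigma M K)"
  shows "(\<lambda>x. (p x, enn2real (R x))) \<in> measurable (restrict_space N {x. R x < \<infinity>}) (predictable_sigma M K)"
    and "stopped_at N p R C \<in> sets N"
proof -
  let ?N = "restrict_space N {x. R x < \<infinity>}"
  have spN: "space ?N = {x \<in> space N. R x < \<infinity>}" by (auto simp: space_restrict_space)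
  have in_N: "{x \<in> space N. R x < \<infinity>} \<in> sets N" by measurable
  have setN: "X \<in> sets ?N \<longleftrightarrow> X \<subseteq> {x. R x < \<infinity>} \<and> X \<in> sets N" for X
    using in_N by (subst sets_restrict_space_iff) (auto simp: Int_def conj_commute)
  show m: "(\<lambda>x. (p x, enn2real (R x))) \<in> measurable ?N (predictable_sigma M K)"
  proof (rule measurable_sigma_sets)
    show "sets (predictable_sigma M K) = sigma_sets (space M \<times> {0..}) (predictable_rectangles M K)"
      by (rule sets_predictable_sigma[OF sp])
    show "predictable_rectangles M K \<subseteq> Pow (space M \<times> {0..})"
      by (rule predictable_rectangles_into_space[OF sp])
    show "(\<lambda>x. (p x, enn2real (R x))) \<in> space ?N \<rightarrow> space M \<times> {0..}"
      unfolding spN using p by auto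
  next
    fix Y assume "Y \<in> predictable_rectangles M K"
    then consider A where "Y = A \<times> {0}" "A \<in> sets (K 0)"
      | A s t where "Y = A \<times> {s<..t}" "0 \<le> s" "A \<in> sets (K s)"
      by (auto simp: predictable_rectangles_def)
    then show "(\<lambda>x. (p x, enn2real (R x))) -` Y \<inter> space ?N \<in> sets ?N"
    proof cases
      case 1
      have [measurable]: "{x \<in> space N. p x \<in> A} \<in> sets N" using p 1 by blast
      have "(\<lambda>x. (p x, enn2real (R x))) -` Y \<inter> space ?N
          = {x \<in> space N. p x \<in> A} \<inter> {x \<in> space N. R x < \<infinity> \<and> enn2real (R x) = 0}"
        unfolding spN 1 by auto
      also have "\<dots> \<in> sets N" by measurable
      finally show ?thesis unfolding setN spN by auto
    next
      case 2
      have [measurable]: "{x \<in> space N. p x \<in> A} \<in> sets N" using p 2 by blast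
      have "(\<lambda>x. (p x, enn2real (R x))) -` Y \<inter> space ?N
          = {x \<in> space N. p x \<in> A} \<inter> {x \<in> space N. R x < \<infinity> \<and> s < enn2real (R x) \<and> enn2real (R x) \<le> t}"
        unfolding spN 2 by auto
      also have "\<dots> \<in> sets N" by measurable
      finally show ?thesis unfolding setN spN by auto
    qed
  qed
  have "stopped_at N p R C = (\<lambda>x. (p x, enn2real (R x))) -` C \<inter> space ?N"
    unfolding stopped_at_def spN by auto
  then show "stopped_at N p R C \<in> sets N" using measurable_sets[OF m C] setN by metis
qed

lemma emeasure_distr_stopped_at:
  assumes sp: "\<And>t. space (K t) = space M"
    and p: "\<And>x. x \<in> space N \<Longrightarrow> p x \<in> space M"
      "\<And>t D. 0 \<le> t \<Longrightarrow> D \<in> sets (K t) \<Longrightarrow> {x \<in> space N. p x \<in> D} \<in> sets N"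
    and R [measurable]: "R \<in> borel_measurable N"
    and C: "C \<in> sets (predictable_sigma M K)"
  shows "emeasure (distr (restrict_space N {x. R x < \<infinity>}) (predictable_sigma M K) (\<lambda>x. (p x, enn2real (R x)))) C
       = emeasure N (stopped_at N p R C)"
proof -
  let ?N = "restrict_space N {x. R x < \<infinity>}"
  note m = stopped_at_measurable(1)[where K=K, OF sp p R C]
  have *: "(\<lambda>x. (p x, enn2real (R x))) -` C \<inter> space ?N = stopped_at N p R C"
    by (auto simp: space_restrict_space stopped_at_def)
  have "emeasure (distr ?N (predictable_sigma M K) (\<lambda>x. (p x, enn2real (R x)))) C = emeasure ?N (stopped_at N p R C)"
    unfolding *[symmetric] by (rule emeasure_distr[OF m C])
  also have "\<dots> = emeasure N (stopped_at N p R C)"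
  proof (rule emeasure_restrict_space)
    have "{x \<in> space N. R x < \<infinity>} \<in> sets N" by measurable
    then show "{x. R x < \<infinity>} \<inter> space N \<in> sets N" by (simp add: Int_def conj_commute)
  qed (auto simp: stopped_at_def)
  finally show ?thesis .
qed

text \<open>
  Predictable rectangles form an intersection stable generator, so two random times whose joint laws
  with the scenario agree on rectangles agree on all predictable sets. Positivity disposes of the
  rectangles at time \<open>0\<close>.
\<close>

lemma emeasure_stopped_at_eqI:
  fixes M :: "'a measure" and N :: "'b measure" and N' :: "'c measure"
  assumes sp: "\<And>t. space (K t) = space M"
    and mono: "\<And>s t. 0 \<le> s \<Longrightarrow> s \<le> t \<Longrightarrow> sets (K s) \<subseteq> sets (K t)"
    and p: "\<And>x. x \<in> space N \<Longrightarrow> p x \<in> space M"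
      "\<And>t D. 0 \<le> t \<Longrightarrow> D \<in> sets (K t) \<Longrightarrow> {x \<in> space N. p x \<in> D} \<in> sets N"
    and p': "\<And>x. x \<in> space N' \<Longrightarrow> p' x \<in> space M"
      "\<And>t D. 0 \<le> t \<Longrightarrow> D \<in> sets (K t) \<Longrightarrow> {x \<in> space N'. p' x \<in> D} \<in> sets N'"
    and R [measurable]: "R \<in> borel_measurable N" and R' [measurable]: "R' \<in> borel_measurable N'"
    and pos: "AE x in N. 0 < R x" "AE x in N'. 0 < R' x"
    and eq: "\<And>s t D. 0 \<le> s \<Longrightarrow> s \<le> t \<Longrightarrow> D \<in> sets (K s) \<Longrightarrow>
        emeasure N {x \<in> space N. p x \<in> D \<and> ennreal s < R x \<and> R x \<le> ennreal t}
      = emeasure N' {x \<in> space N'. p' x \<in> D \<and> ennreal s < R' x \<and> R' x \<le> ennreal t}"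
    and fin: "finite_measure N"
    and C: "C \<in> sets (predictable_sigma M K)"
  shows "emeasure N (stopped_at N p R C) = emeasure N' (stopped_at N' p' R' C)"
proof -
  let ?S = "predictable_sigma M K"
  define \<nu> where "\<nu> = distr (restrict_space N {x. R x < \<infinity>}) ?S (\<lambda>x. (p x, enn2real (R x)))"
  define \<nu>' where "\<nu>' = distr (restrict_space N' {x. R' x < \<infinity>}) ?S (\<lambda>x. (p' x, enn2real (R' x)))"
  have e: "emeasure \<nu> B = emeasure N (stopped_at N p R B)" if "B \<in> sets ?S" for B
    unfolding \<nu>_def by (rule emeasure_distr_stopped_at[where K=K, OF sp p R that])
  have e': "emeasure \<nu>' B = emeasure N' (stopped_at N' p' R' B)" if "B \<in> sets ?S" for B
    unfolding \<nu>'_def by (rule emeasure_distr_stopped_at[where K=K, OF sp p' R' that])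
  have zero: "emeasure N (stopped_at N p R (A \<times> {0})) = 0" for A
    unfolding stopped_at_def
    by (rule emeasure_eq_0_AE, use pos(1) in eventually_elim) (auto simp: enn2real_eq_0_iff)
  have zero': "emeasure N' (stopped_at N' p' R' (A \<times> {0})) = 0" for A
    unfolding stopped_at_def
    by (rule emeasure_eq_0_AE, use pos(2) in eventually_elim) (auto simp: enn2real_eq_0_iff)
  have "\<nu> = \<nu>'"
  proof (rule measure_eqI_generator_eq_countable)
    show "Int_stable (predictable_rectangles M K)" by (rule Int_stable_predictable_rectangles[OF mono])
    show "predictable_rectangles M K \<subseteq> Pow (space M \<times> {0..})"
      by (rule predictable_rectangles_into_space[OF sp])
    show "sets \<nu> = sigma_sets (space M \<times> {0..}) (predictable_rectangles M K)"
      "sets \<nu>' = sigma_sets (space M \<times> {0..}) (predictable_rectangles M K)"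
      unfolding \<nu>_def \<nu>'_def by (simp_all add: sets_predictable_sigma[OF sp])
    let ?A = "insert (space M \<times> {0}) (range (\<lambda>n::nat. space M \<times> {0<..real n}))"
    show "?A \<subseteq> predictable_rectangles M K"
    proof -
      have "space M \<in> sets (K 0)" using sets.top[of "K 0"] sp[of 0] by simp
      then have "space M \<times> {0} \<in> predictable_rectangles M K"
        "space M \<times> {0<..real n} \<in> predictable_rectangles M K" for n
        unfolding predictable_rectangles_def using of_nat_0_le_iff[of n] by blast+
      then show ?thesis by auto
    qed
    show "\<Union>?A = space M \<times> {0..}"
    proof -
      have "(x, t) \<in> \<Union>?A" if "x \<in> space M" "0 \<le> t" for x and t :: real
        using that real_arch_simple[of t] by (cases "t = 0") auto
      moreover have "\<Union>?A \<subseteq> space M \<times> {0..}" by auto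
      ultimately show ?thesis by blast
    qed
    show "countable ?A" by simp
    fix a assume "a \<in> ?A"
    show "emeasure \<nu> a \<noteq> \<infinity>"
    proof (cases "a \<in> sets ?S")
      case True
      show ?thesis unfolding e[OF True]
        using finite_measure.emeasure_finite[OF fin] by simp
    next
      case False
      then show ?thesis by (simp add: \<nu>_def emeasure_notin_sets)
    qed
  next
    fix X assume X: "X \<in> predictable_rectangles M K"
    then have XS: "X \<in> sets ?S" by (auto simp: sets_predictable_sigma[OF sp])
    show "emeasure \<nu> X = emeasure \<nu>' X"
      unfolding e[OF XS] e'[OF XS]
      using X zero zero' eq by (auto simp: predictable_rectangles_def stopped_at_rectangle)
  qed
  then show ?thesis using e[OF C] e'[OF C] by simp
qed

section \<open>Compensation and inversion of increasing processes\<close>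

text \<open>
  The part of the compensator property that the argument uses. Monotonicity is required only almost
  surely for each pair of times, so that the definition also applies to a family of conditional
  probabilities, which has no distinguished paths.
\<close>

definition compensates ::
    "'a measure \<Rightarrow> (real \<Rightarrow> 'a measure) \<Rightarrow> ('a \<Rightarrow> ennreal) \<Rightarrow> (real \<Rightarrow> 'a \<Rightarrow> real) \<Rightarrow> bool" where
  "compensates M K \<tau> A \<longleftrightarrow>
     (\<forall>t\<ge>0. integrable M (A t)) \<and>
     (AE \<omega> in M. A 0 \<omega> = 0) \<and>
     (\<forall>s t. 0 \<le> s \<longrightarrow> s \<le> t \<longrightarrow> (AE \<omega> in M. A s \<omega> \<le> A t \<omega>)) \<and>
     (\<forall>s t. 0 \<le> s \<longrightarrow> s \<le> t \<longrightarrow> (\<forall>D\<in>sets (K s).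
        (\<integral>\<omega>. indicator D \<omega> * (A t \<omega> - A s \<omega>) \<partial>M) =
        measure M {\<omega> \<in> space M. \<omega> \<in> D \<and> ennreal s < \<tau> \<omega> \<and> \<tau> \<omega> \<le> ennreal t}))"

text \<open>
  The first passage time of \<open>A\<close> above the level \<open>u\<close>. The infimum runs over rational times, which keeps it
  measurable for an arbitrary family \<open>A\<close>; levels \<open>u \<le> 0\<close> are discarded by the value \<open>\<infinity>\<close>, so that
  integrating over all real levels only counts the positive ones.
\<close>

definition inverse_time :: "(real \<Rightarrow> 'a \<Rightarrow> real) \<Rightarrow> real \<Rightarrow> 'a \<Rightarrow> ennreal" where
  "inverse_time A u \<omega> = (INF r\<in>\<rat> \<inter> {0..}. if 0 < u \<and> u \<le> A r \<omega> then ennreal r else \<infinity>)"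

lemma inverse_time_less_iff:
  "inverse_time A u \<omega> < x \<longleftrightarrow> (\<exists>r\<in>\<rat>. 0 \<le> r \<and> 0 < u \<and> u \<le> A r \<omega> \<and> ennreal r < x)"
proof -
  have *: "(if P then ennreal r else \<infinity>) < x \<longleftrightarrow> P \<and> ennreal r < x" for P r
    by (cases P) simp_all
  show ?thesis unfolding inverse_time_def INF_less_iff * by blast
qed

lemma inverse_time_mono: "0 < u \<Longrightarrow> u \<le> v \<Longrightarrow> inverse_time A u \<omega> \<le> inverse_time A v \<omega>"
  unfolding inverse_time_def by (rule INF_mono) (force intro: order_trans)

lemma countable_rat_nonneg: "countable (\<rat> \<inter> {0::real..})"
  using countable_rat by auto

lemma borel_measurable_inverse_time [measurable (raw)]:
  assumes [measurable]: "\<And>r. r \<ge> 0 \<Longrightarrow> (\<lambda>x. A r (f x)) \<in> borel_measurable N" "g \<in> borel_measurable N"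
  shows "(\<lambda>x. inverse_time A (g x) (f x)) \<in> borel_measurable N"
  unfolding inverse_time_def by (rule borel_measurable_INF) (use countable_rat_nonneg in auto)

locale compensated_time = prob_space M for M :: "'a measure" +
  fixes K :: "real \<Rightarrow> 'a measure" and \<tau> :: "'a \<Rightarrow> ennreal" and A :: "real \<Rightarrow> 'a \<Rightarrow> real"
  assumes subalg: "\<And>t. subalgebra M (K t)"
    and mono_K: "\<And>s t. 0 \<le> s \<Longrightarrow> s \<le> t \<Longrightarrow> sets (K s) \<subseteq> sets (K t)"
    and random_time: "random_time M \<tau>"
    and compensates: "compensates M K \<tau> A"
begin

lemma space_K: "space (K t) = space M"
  using subalg by (simp add: subalgebra_def)

lemma tau_measurable [measurable]: "\<tau> \<in> borel_measurable M"
  using random_time by (simp add: random_time_def)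

lemma integrable_A: "0 \<le> t \<Longrightarrow> integrable M (A t)"
  using compensates by (simp add: compensates_def)

lemma A_measurable [measurable]: "0 \<le> t \<Longrightarrow> A t \<in> borel_measurable M"
  using integrable_A by blast

lemma AE_A_mono: "0 \<le> s \<Longrightarrow> s \<le> t \<Longrightarrow> AE \<omega> in M. A s \<omega> \<le> A t \<omega>"
  using compensates by (simp add: compensates_def)

lemma AE_A_0: "AE \<omega> in M. A 0 \<omega> = 0"
  using compensates by (simp add: compensates_def)

lemma integral_increment:
  assumes "0 \<le> s" "s \<le> t" "D \<in> sets (K s)"
  shows "(\<integral>\<omega>. indicator D \<omega> * (A t \<omega> - A s \<omega>) \<partial>M) =
         measure M {\<omega> \<in> space M. \<omega> \<in> D \<and> ennreal s < \<tau> \<omega> \<and> \<tau> \<omega> \<le> ennreal t}"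
  using compensates assms by (simp add: compensates_def)

text \<open>
  Right-continuity along a fixed sequence comes for free: the increments are nonnegative and decreasing,
  and their means are the probabilities \<open>P(t < \<tau> \<le> t + 1/n)\<close>, which tend to \<open>0\<close>.
\<close>

lemma AE_A_right_limit:
  assumes t: "0 \<le> t"
  shows "AE \<omega> in M. (\<lambda>n. A (t + inverse (real (Suc n))) \<omega>) \<longlonglongrightarrow> A t \<omega>"
proof -
  define e where "e n = inverse (real (Suc n))" for n
  have e: "0 < e n" "e (Suc n) \<le> e n" for n by (auto simp: e_def field_simps)
  have e0: "e \<longlonglongrightarrow> 0" unfolding e_def by (rule LIMSEQ_inverse_real_of_nat)
  define f where "f n \<omega> = A (t + e n) \<omega> - A t \<omega>" for n \<omega>
  have int_f: "integrable M (f n)" for n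
    unfolding f_def using e[of n] t by (intro Bochner_Integration.integrable_diff integrable_A) auto
  have nonneg: "AE \<omega> in M. 0 \<le> f n \<omega>" for n
    using AE_A_mono[of t "t + e n"] e[of n] t by (auto simp: f_def)
  have dec: "AE \<omega> in M. f (Suc n) \<omega> \<le> f n \<omega>" for n
    using AE_A_mono[of "t + e (Suc n)" "t + e n"] e(1)[of "Suc n"] e(2)[of n] t by (auto simp: f_def)
  define B where "B n = {\<omega> \<in> space M. ennreal t < \<tau> \<omega> \<and> \<tau> \<omega> \<le> ennreal (t + e n)}" for n
  have Bm: "B n \<in> sets M" for n unfolding B_def by measurable
  have "(\<integral>\<omega>. f n \<omega> \<partial>M) = measure M (B n)" for n
  proof -
    have "space M \<in> sets (K t)" using sets.top[of "K t"] space_K[of t] by simp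
    from integral_increment[of t "t + e n", OF t _ this] e[of n]
    have "(\<integral>\<omega>. indicator (space M) \<omega> * (A (t + e n) \<omega> - A t \<omega>) \<partial>M) = measure M (B n)"
      by (simp add: B_def conj_ac cong: conj_cong)
    then show ?thesis unfolding f_def
      by (subst (asm) Bochner_Integration.integral_cong[OF refl, where g="\<lambda>\<omega>. A (t + e n) \<omega> - A t \<omega>"]) auto
  qed
  moreover have "(\<lambda>n. measure M (B n)) \<longlonglongrightarrow> measure M (\<Inter>n. B n)"
  proof (rule finite_Lim_measure_decseq)
    show "range B \<subseteq> sets M" using Bm by auto
    show "decseq B"
    proof (rule decseq_SucI, rule subsetI)
      fix n \<omega> assume "\<omega> \<in> B (Suc n)"
      moreover have "ennreal (t + e (Suc n)) \<le> ennreal (t + e n)" using e(2)[of n] by (intro ennreal_leI) simp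
      ultimately show "\<omega> \<in> B n" by (auto simp: B_def)
    qed
  qed
  moreover have "(\<Inter>n. B n) = {}"
  proof safe
    fix \<omega> assume "\<omega> \<in> (\<Inter>n. B n)"
    then have *: "ennreal t < \<tau> \<omega>" "\<And>n. \<tau> \<omega> \<le> ennreal (t + e n)" by (auto simp: B_def)
    have "(\<lambda>n. ennreal (t + e n)) \<longlonglongrightarrow> ennreal (t + 0)"
      by (intro tendsto_intros e0)
    then have "\<tau> \<omega> \<le> ennreal (t + 0)" using *(2) by (intro LIMSEQ_le_const) auto
    then show "\<omega> \<in> {}" using *(1) by simp
  qed
  ultimately have lim: "(\<lambda>n. \<integral>\<omega>. f n \<omega> \<partial>M) \<longlonglongrightarrow> 0" by simp
  have "(\<integral>\<omega>. norm (f n \<omega>) \<partial>M) = (\<integral>\<omega>. f n \<omega> \<partial>M)" for n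
    by (rule integral_cong_AE) (use int_f nonneg[of n] in auto)
  with lim have "(\<lambda>n. \<integral>\<omega>. norm (f n \<omega>) \<partial>M) \<longlonglongrightarrow> 0" by simp
  from tendsto_L1_AE_subseq[OF int_f this] obtain r where r: "strict_mono r"
    and AE_r: "AE \<omega> in M. (\<lambda>n. f (r n) \<omega>) \<longlonglongrightarrow> 0" by blast
  have "AE \<omega> in M. \<forall>n. 0 \<le> f n \<omega> \<and> f (Suc n) \<omega> \<le> f n \<omega>"
    using nonneg dec by (auto simp: AE_all_countable)
  with AE_r show ?thesis
  proof eventually_elim
    case (elim \<omega>)
    have "decseq (\<lambda>n. f n \<omega>)" using elim by (intro decseq_SucI) auto
    moreover have "\<forall>n. 0 \<le> f n \<omega>" using elim by auto
    ultimately obtain L where L: "(\<lambda>n. f n \<omega>) \<longlonglongrightarrow> L"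
      using decseq_convergent[of "\<lambda>n. f n \<omega>" 0] by blast
    then have "(\<lambda>n. f (r n) \<omega>) \<longlonglongrightarrow> L" using r by (auto dest: LIMSEQ_subseq_LIMSEQ simp: o_def)
    with elim have "L = 0" by (auto dest: LIMSEQ_unique)
    with L have "(\<lambda>n. f n \<omega> + A t \<omega>) \<longlonglongrightarrow> 0 + A t \<omega>" by (intro tendsto_add) auto
    then show ?case by (simp add: f_def e_def)
  qed
qed

text \<open>
  The defining duality between a process and its inverse. The exceptional null set does not depend on
  the level, which is what Fubini's theorem needs below.
\<close>

lemma AE_inverse_time_le_iff:
  assumes t: "0 \<le> t"
  shows "AE \<omega> in M. \<forall>u>0. inverse_time A u \<omega> \<le> ennreal t \<longleftrightarrow> u \<le> A t \<omega>"
proof -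
  define e where "e n = inverse (real (Suc n))" for n
  have e: "0 < e n" for n by (auto simp: e_def)
  have e0: "e \<longlonglongrightarrow> 0" unfolding e_def by (rule LIMSEQ_inverse_real_of_nat)
  have "AE \<omega> in M. \<forall>r\<in>\<rat> \<inter> {0..}. t \<le> r \<longrightarrow> A t \<omega> \<le> A r \<omega>"
    using AE_A_mono t countable_rat_nonneg by (auto intro!: AE_ball_countable')
  moreover have "AE \<omega> in M. \<forall>r\<in>\<rat> \<inter> {0..}. \<forall>n. r \<le> t + e n \<longrightarrow> A r \<omega> \<le> A (t + e n) \<omega>"
    using AE_A_mono countable_rat_nonneg by (auto intro!: AE_ball_countable' simp: AE_all_countable)
  ultimately show ?thesis using AE_A_right_limit[OF t]
  proof eventually_elim
    case (elim \<omega>)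
    show ?case
    proof (intro allI impI iffI)
      fix u :: real assume u: "0 < u" and le: "inverse_time A u \<omega> \<le> ennreal t"
      have "u \<le> A (t + e n) \<omega>" for n
      proof -
        have "inverse_time A u \<omega> < ennreal (t + e n)"
          using le t e[of n] by (rule_tac le_less_trans) (auto simp: ennreal_less_iff)
        then obtain r where r: "r \<in> \<rat>" "0 \<le> r" "u \<le> A r \<omega>" "ennreal r < ennreal (t + e n)"
          unfolding inverse_time_less_iff by blast
        then have "r \<le> t + e n" using t e[of n] by (simp add: ennreal_less_iff del: ennreal_plus)
        then show ?thesis using r elim by force
      qed
      then show "u \<le> A t \<omega>"
        using elim by (intro LIMSEQ_le_const[of "\<lambda>n. A (t + e n) \<omega>"]) (auto simp: e_def)
    next
      fix u :: real assume u: "0 < u" "u \<le> A t \<omega>"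
      show "inverse_time A u \<omega> \<le> ennreal t"
      proof (rule ccontr)
        assume "\<not> ?thesis"
        then have "ennreal t < inverse_time A u \<omega>" by simp
        obtain x where x: "t < x" "ennreal x < inverse_time A u \<omega>"
        proof -
          obtain z where z: "ennreal t < z" "z < inverse_time A u \<omega>"
            using dense[OF \<open>ennreal t < inverse_time A u \<omega>\<close>] by blast
          then have "z = ennreal (enn2real z)" by (auto simp: less_top dest: less_le_trans[of z _ top])
          then show ?thesis using z t that[of "enn2real z"] by (metis ennreal_less_iff)
        qed
        obtain r where r: "r \<in> \<rat>" "t < r" "r < x" using Rats_dense_in_real[OF x(1)] by blast
        then have "A t \<omega> \<le> A r \<omega>" using elim(1) t by auto
        then have "u \<le> A r \<omega>" using u by simp
        then have "inverse_time A u \<omega> < ennreal x"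
          unfolding inverse_time_less_iff using u r t by (intro bexI[of _ r]) (auto simp: ennreal_less_iff)
        with x show False by simp
      qed
    qed
  qed
qed

sublocale levels: pair_sigma_finite M "lborel :: real measure" ..

definition levels where "levels = M \<Otimes>\<^sub>M (lborel :: real measure)"

text \<open>
  The passage times at all levels, gathered into one random time on the product of \<open>M\<close> with Lebesgue
  measure.
\<close>

definition passage where "passage = (\<lambda>(\<omega>, u). inverse_time A u \<omega>)"

lemma passage_measurable [measurable]: "passage \<in> borel_measurable levels"
  unfolding passage_def levels_def by measurable

lemma space_levels: "space levels = space M \<times> UNIV"
  by (simp add: levels_def space_pair_measure)

lemma fst_measurable_sets: "D \<in> sets (K t) \<Longrightarrow> {x \<in> space levels. fst x \<in> D} \<in> sets levels"
proof -
  assume "D \<in> sets (K t)"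
  then have [measurable]: "D \<in> sets M" using subalg[of t] by (auto simp: subalgebra_def)
  show ?thesis unfolding levels_def by measurable
qed

lemma id_measurable_sets: "D \<in> sets (K t) \<Longrightarrow> {\<omega> \<in> space M. \<omega> \<in> D} \<in> sets M"
proof -
  assume "D \<in> sets (K t)"
  then have [measurable]: "D \<in> sets M" using subalg[of t] by (auto simp: subalgebra_def)
  show ?thesis by measurable
qed

lemma fst_space: "x \<in> space levels \<Longrightarrow> fst x \<in> space M"
  by (auto simp: space_levels)

lemma AE_inverse_time_pos: "AE \<omega> in M. \<forall>u. 0 < inverse_time A u \<omega>"
  using AE_inverse_time_le_iff[of 0, simplified] AE_A_0
proof eventually_elim
  case (elim \<omega>)
  show ?case
  proof (rule allI, rule ccontr)
    fix u assume "\<not> 0 < inverse_time A u \<omega>"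
    then have *: "inverse_time A u \<omega> = 0" by simp
    then have "0 < u" using inverse_time_less_iff[of A u \<omega> 1] by auto
    then show False using elim * by auto
  qed
qed

lemma AE_passage_pos: "AE x in levels. 0 < passage x"
proof -
  have "AE \<omega> in M. AE u in lborel. 0 < inverse_time A u \<omega>"
    using AE_inverse_time_pos by eventually_elim simp
  then show ?thesis unfolding levels_def
    by (intro levels.AE_pair_measure) (auto simp: passage_def space_pair_measure)
qed

text \<open>
  For a fixed scenario the levels with \<open>s < T\<^sub>u \<le> t\<close> form the interval from \<open>A s\<close> to \<open>A t\<close>, of length
  \<open>A t - A s\<close>; integrating over scenarios gives the compensation identity.
\<close>

lemma emeasure_passage_rectangle:
  assumes st: "0 \<le> s" "s \<le> t" and D: "D \<in> sets (K s)"
  shows "emeasure levels {x \<in> space levels. fst x \<in> D \<and> ennreal s < passage x \<and> passage x \<le> ennreal t}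
       = emeasure M {\<omega> \<in> space M. \<omega> \<in> D \<and> ennreal s < \<tau> \<omega> \<and> \<tau> \<omega> \<le> ennreal t}"
proof -
  have DM [measurable]: "D \<in> sets M" using D subalg[of s] by (auto simp: subalgebra_def)
  let ?X = "{x \<in> space levels. fst x \<in> D \<and> ennreal s < passage x \<and> passage x \<le> ennreal t}"
  have "{x \<in> space levels. ennreal s < passage x \<and> passage x \<le> ennreal t} \<in> sets levels" by measurable
  from sets.Int[OF fst_measurable_sets[OF D] this]
  have "?X \<in> sets levels" by (simp add: Int_def conj_ac cong: conj_cong)
  then have X: "?X \<in> sets (M \<Otimes>\<^sub>M lborel)" unfolding levels_def .
  have "emeasure levels ?X = (\<integral>\<^sup>+\<omega>. emeasure lborel (Pair \<omega> -` ?X) \<partial>M)"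
    using X unfolding levels_def by (rule lborel.emeasure_pair_measure_alt)
  also have "\<dots> = (\<integral>\<^sup>+\<omega>. ennreal (indicator D \<omega> * (A t \<omega> - A s \<omega>)) \<partial>M)"
  proof (rule nn_integral_cong_AE)
    have "AE \<omega> in M. \<omega> \<in> space M" by simp
    then show "AE \<omega> in M. emeasure lborel (Pair \<omega> -` ?X) = ennreal (indicator D \<omega> * (A t \<omega> - A s \<omega>))"
      using AE_A_mono[OF order_refl st(1)] AE_A_0 AE_A_mono[OF st]
        AE_inverse_time_le_iff[OF st(1)] AE_inverse_time_le_iff[OF order_trans[OF st]]
    proof eventually_elim
      case (elim \<omega>)
      have pos: "0 < u" if "inverse_time A u \<omega> \<le> ennreal t" for u
      proof -
        have "inverse_time A u \<omega> < \<infinity>" using that by (auto simp: le_less_trans)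
        then show ?thesis unfolding inverse_time_less_iff by auto
      qed
      have "Pair \<omega> -` ?X = (if \<omega> \<in> D then {A s \<omega><..A t \<omega>} else {})"
        using elim pos by (auto simp: space_levels passage_def not_le[symmetric])
      then show ?case using elim by simp
    qed
  qed
  also have "\<dots> = ennreal (\<integral>\<omega>. indicator D \<omega> * (A t \<omega> - A s \<omega>) \<partial>M)"
  proof (rule nn_integral_eq_integral)
    show "integrable M (\<lambda>\<omega>. indicator D \<omega> * (A t \<omega> - A s \<omega>))"
      unfolding mult.commute[of "indicator D _"]
      using st by (intro integrable_real_mult_indicator Bochner_Integration.integrable_diff integrable_A) auto
    show "AE \<omega> in M. 0 \<le> indicator D \<omega> * (A t \<omega> - A s \<omega>)"
      using AE_A_mono[of s t] st by (auto split: split_indicator)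
  qed
  also have "\<dots> = emeasure M {\<omega> \<in> space M. \<omega> \<in> D \<and> ennreal s < \<tau> \<omega> \<and> \<tau> \<omega> \<le> ennreal t}"
    by (simp add: integral_increment[OF st D] emeasure_eq_measure)
  finally show ?thesis .
qed

text \<open>
  Compensation determines the law of \<open>\<tau>\<close> on predictable sets, and the passage times realise it. So statements
  about \<open>\<tau>\<close> and statements about almost every level can be exchanged, as the next two lemmas do.
\<close>

lemma emeasure_stopped_at_inverse:
  assumes C: "C \<in> sets (predictable_sigma M K)"
  shows "emeasure M (stopped_at M (\<lambda>\<omega>. \<omega>) \<tau> C) = emeasure levels (stopped_at levels fst passage C)"
proof (rule emeasure_stopped_at_eqI[OF space_K mono_K _ _ _ _ tau_measurable passage_measurable _ AE_passage_pos _ _ C])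
  show "AE \<omega> in M. 0 < \<tau> \<omega>" using random_time by (simp add: random_time_def)
  show "{x \<in> space M. x \<in> D} \<in> sets M" if "D \<in> sets (K t)" for t D
    using that by (rule id_measurable_sets)
  show "finite_measure M" by unfold_locales
qed (simp_all add: emeasure_passage_rectangle fst_measurable_sets fst_space)

lemma AE_null_slices:
  assumes C: "C \<in> sets (predictable_sigma M K)"
    and null: "AE \<omega> in M. \<tau> \<omega> < \<infinity> \<longrightarrow> (\<omega>, enn2real (\<tau> \<omega>)) \<notin> C"
  shows "AE \<omega> in M. AE u in lborel. inverse_time A u \<omega> < \<infinity> \<longrightarrow> (\<omega>, enn2real (inverse_time A u \<omega>)) \<notin> C"
proof -
  have m: "stopped_at levels fst passage C \<in> sets levels"
    by (rule stopped_at_measurable(2)[OF space_K fst_space fst_measurable_sets passage_measurable C])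
  have "emeasure M (stopped_at M (\<lambda>\<omega>. \<omega>) \<tau> C) = 0"
    unfolding stopped_at_def by (rule emeasure_eq_0_AE) (use null in auto)
  then have "emeasure levels (stopped_at levels fst passage C) = 0"
    by (simp add: emeasure_stopped_at_inverse[OF C])
  then have "AE x in levels. x \<notin> stopped_at levels fst passage C" using m by (rule AE_not_in[OF null_setsI])
  then have "AE \<omega> in M. AE u in lborel. (\<omega>, u) \<notin> stopped_at levels fst passage C"
    unfolding levels_def by (rule levels.AE_pair)
  then show ?thesis
    using AE_space
  proof eventually_elim
    case (elim \<omega>)
    from elim(1) show ?case
      by eventually_elim (use elim(2) in \<open>auto simp: stopped_at_def space_levels passage_def\<close>)
  qed
qed

lemma AE_stopped_at_null:
  assumes C: "C \<in> sets (predictable_sigma M K)"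
    and null: "AE \<omega> in M. AE u in lborel. inverse_time A u \<omega> < \<infinity> \<longrightarrow> (\<omega>, enn2real (inverse_time A u \<omega>)) \<notin> C"
  shows "AE \<omega> in M. \<tau> \<omega> < \<infinity> \<longrightarrow> (\<omega>, enn2real (\<tau> \<omega>)) \<notin> C"
proof -
  have m: "stopped_at levels fst passage C \<in> sets levels"
    by (rule stopped_at_measurable(2)[OF space_K fst_space fst_measurable_sets passage_measurable C])
  have m': "stopped_at M (\<lambda>\<omega>. \<omega>) \<tau> C \<in> sets M"
    by (rule stopped_at_measurable(2)[OF space_K _ id_measurable_sets tau_measurable C])
  have "AE \<omega> in M. AE u in lborel. (\<omega>, u) \<notin> stopped_at levels fst passage C"
    using null by eventually_elim (auto simp: stopped_at_def passage_def elim: eventually_mono)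
  then have "AE x in levels. x \<notin> stopped_at levels fst passage C"
    using sets.compl_sets[OF m] unfolding levels_def set_diff_eq by (intro levels.AE_pair_measure)
  then have "emeasure levels (stopped_at levels fst passage C) = 0" using m by (simp add: AE_iff_null_sets null_setsD1)
  then have "AE \<omega> in M. \<omega> \<notin> stopped_at M (\<lambda>\<omega>. \<omega>) \<tau> C"
    using m' unfolding emeasure_stopped_at_inverse[OF C, symmetric] by (intro AE_not_in null_setsI)
  then show ?thesis using AE_space by eventually_elim (auto simp: stopped_at_def)
qed

end

section \<open>Immersion and the conditional law of the random time\<close>

lemma set_lebesgue_integral_eq_sigma_sets:
  fixes f g :: "'a \<Rightarrow> real"
  assumes E: "Int_stable E" "E \<subseteq> sets M"
    and int: "integrable M f" "integrable M g"
    and eq: "\<And>D. D \<in> E \<Longrightarrow> (LINT x:D|M. f x) = (LINT x:D|M. g x)"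
    and total: "(LINT x|M. f x) = (LINT x|M. g x)"
    and D: "D \<in> sigma_sets (space M) E"
  shows "(LINT x:D|M. f x) = (LINT x:D|M. g x)"
proof -
  have sM: "sigma_sets (space M) E \<subseteq> sets M" using E(2) by (rule sets.sigma_sets_subset)
  have si: "set_integrable M X f" "set_integrable M X g" if "X \<in> sets M" for X
    unfolding set_integrable_def using int that by (blast intro: integrable_mult_indicator)+
  have sp: "E \<subseteq> Pow (space M)" using E(2) sets.sets_into_space by auto
  show ?thesis
    using E(1) sp D
  proof (induction rule: sigma_sets_induct_disjoint)
    case (basic A)
    then show ?case by (rule eq)
  next
    case empty
    show ?case by (simp add: set_lebesgue_integral_def)
  next
    case (compl A)
    then have A: "A \<in> sets M" using sM by auto
    have *: "(LINT x:space M - A|M. h x) = (LINT x|M. h x) - (LINT x:A|M. h x)"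
      if "integrable M h" for h :: "'a \<Rightarrow> real"
    proof -
      have "(LINT x:(space M - A) \<union> A|M. h x) = (LINT x:space M - A|M. h x) + (LINT x:A|M. h x)"
        using A that unfolding set_integrable_def[symmetric]
        by (intro set_integral_Un) (auto simp: set_integrable_def intro!: integrable_mult_indicator simp del: real_scaleR_def)
      moreover have "(space M - A) \<union> A = space M" using sets.sets_into_space[OF A] by auto
      ultimately show ?thesis using that by (simp add: set_integral_space)
    qed
    show ?case using *[OF int(1)] *[OF int(2)] compl total by simp
  next
    case (union A)
    then have A: "\<And>i. A i \<in> sets M" using sM by auto
    have dis: "\<And>i j. i \<noteq> j \<Longrightarrow> A i \<inter> A j = {}" using union(1) by (auto simp: disjoint_family_on_def)
    have "(LINT x:(\<Union>i. A i)|M. h x) = (\<Sum>i. (LINT x:A i|M. h x))" if "set_integrable M (\<Union>i. A i) h" for h :: "'a \<Rightarrow> real"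
      by (rule lebesgue_integral_countable_add[OF A dis that])
    then show ?case using si[of "\<Union>i. A i"] A union(3) by auto
  qed
qed

lemma (in prob_space) sigma_finite_subalgebraI:
  assumes "subalgebra M F" shows "sigma_finite_subalgebra M F"
  by (rule finite_measure_subalgebra_is_sigma_finite) (unfold_locales, rule assms)

definition terminal_sigma :: "'a measure \<Rightarrow> (real \<Rightarrow> 'a measure) \<Rightarrow> 'a measure" where
  "terminal_sigma M F = sigma (space M) (\<Union>t\<in>{0..}. sets (F t))"

locale prob_filtration = prob_space M for M :: "'a measure" +
  fixes F :: "real \<Rightarrow> 'a measure"
  assumes sub_F: "\<And>t. subalgebra M (F t)"
    and mono_F: "\<And>s t. s \<le> t \<Longrightarrow> sets (F s) \<subseteq> sets (F t)"
begin

lemma sigma_finite_subalg: "sigma_finite_subalgebra M (F t)"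
  using sub_F by (rule sigma_finite_subalgebraI)

lemma space_F: "space (F t) = space M"
  using sub_F by (simp add: subalgebra_def)

lemma sets_F_subset: "sets (F t) \<subseteq> sets M"
  using sub_F by (simp add: subalgebra_def)

lemma sets_terminal_sigma:
  "sets (terminal_sigma M F) = sigma_sets (space M) (\<Union>t\<in>{0..}. sets (F t))"
  unfolding terminal_sigma_def
  by (rule sets_measure_of) (use sets_F_subset sets.sets_into_space in blast)

lemma space_terminal_sigma: "space (terminal_sigma M F) = space M"
  unfolding terminal_sigma_def
  by (rule space_measure_of) (use sets_F_subset sets.sets_into_space in blast)

lemma sets_F_subset_terminal: "0 \<le> t \<Longrightarrow> sets (F t) \<subseteq> sets (terminal_sigma M F)"
  unfolding sets_terminal_sigma by auto

lemma subalgebra_terminal: "subalgebra M (terminal_sigma M F)"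
proof -
  have "(\<Union>t\<in>{0..}. sets (F t)) \<subseteq> sets M" using sets_F_subset by auto
  from sets.sigma_sets_subset[OF this] show ?thesis
    by (simp add: subalgebra_def space_terminal_sigma sets_terminal_sigma)
qed

lemma Int_stable_Union_F: "Int_stable (\<Union>t\<in>{0..}. sets (F t))"
proof (rule Int_stableI)
  fix a b assume "a \<in> (\<Union>t\<in>{0..}. sets (F t))" "b \<in> (\<Union>t\<in>{0..}. sets (F t))"
  then obtain s t where "0 \<le> s" "0 \<le> t" "a \<in> sets (F s)" "b \<in> sets (F t)" by auto
  then have "a \<inter> b \<in> sets (F (max s t))" "0 \<le> max s t"
    using mono_F[of s "max s t"] mono_F[of t "max s t"] by auto
  then show "a \<inter> b \<in> (\<Union>t\<in>{0..}. sets (F t))" by auto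
qed

lemma martingale_closed:
  assumes f: "integrable M f"
  shows "martingale M F (\<lambda>t. real_cond_exp M (F t) f)"
  unfolding martingale_def
proof (intro conjI allI impI)
  fix t
  interpret sigma_finite_subalgebra M "F t" by (rule sigma_finite_subalg)
  show "real_cond_exp M (F t) f \<in> borel_measurable (F t)" by simp
  show "integrable M (real_cond_exp M (F t) f)" by (rule real_cond_exp_int(1)[OF f])
next
  fix s t :: real assume "0 \<le> s" "s \<le> t"
  interpret sigma_finite_subalgebra M "F s" by (rule sigma_finite_subalg)
  have "subalgebra (F t) (F s)" using mono_F[OF \<open>s \<le> t\<close>] by (simp add: subalgebra_def space_F)
  from real_cond_exp_nested_subalg[OF sub_F this f]
  show "AE \<omega> in M. real_cond_exp M (F s) (real_cond_exp M (F t) f) \<omega> = real_cond_exp M (F s) f \<omega>"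
    by simp
qed

text \<open>
  Immersion means that conditioning on \<open>G\<^sub>t\<close> tells no more about events of \<open>F\<close> than conditioning on
  \<open>F\<^sub>t\<close>. By duality, for a quantity \<open>h\<close> known at time \<open>t\<close> in \<open>G\<close>, conditioning on the whole future of \<open>F\<close>
  amounts to conditioning on \<open>F\<^sub>t\<close>. The proof moves the conditional expectation back and forth between
  \<open>h\<close> and the indicator of \<open>D\<close>.
\<close>

lemma integral_cond_exp_immersed:
  assumes imm: "immersed M F G" and G: "subalgebra M (G t)" "sets (F t) \<subseteq> sets (G t)" and t: "0 \<le> t"
    and h: "h \<in> borel_measurable (G t)" "\<And>x. 0 \<le> h x \<and> h x \<le> 1"
    and D: "D \<in> sets (terminal_sigma M F)"
  shows "(LINT x:D|M. h x) = (LINT x:D|M. real_cond_exp M (F t) h x)"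
proof -
  interpret Ft: sigma_finite_subalgebra M "F t" by (rule sigma_finite_subalg)
  interpret Gt: sigma_finite_subalgebra M "G t"
    using G(1) by (rule sigma_finite_subalgebraI)
  have hM [measurable]: "h \<in> borel_measurable M" using measurable_from_subalg[OF G(1) h(1)] .
  have int_h: "integrable M h" by (rule integrable_const_bound[where B=1]) (use h in auto)
  have base: "(LINT x:D|M. h x) = (LINT x:D|M. real_cond_exp M (F t) h x)"
    if D: "D \<in> sets (F r)" for r D
  proof -
    have DM [measurable]: "D \<in> sets M" using D sets_F_subset by auto
    define m where "m = max r t"
    interpret Fm: sigma_finite_subalgebra M "F m" by (rule sigma_finite_subalg)
    have Dm: "D \<in> sets (F m)" using mono_F[of r m] D by (auto simp: m_def)
    define X where "X = (\<lambda>s. real_cond_exp M (F s) (indicator D))"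
    have int_D: "integrable M (indicator D :: 'a \<Rightarrow> real)"
      by (rule integrable_const_bound[where B=1]) auto
    have "martingale M G X"
      using imm martingale_closed[OF int_D] by (auto simp: immersed_def X_def)
    then have mart: "AE x in M. real_cond_exp M (G t) (X m) x = X t x"
      using t by (simp add: martingale_def m_def)
    have Xm: "AE x in M. X m x = indicator D x"
      unfolding X_def by (rule Fm.real_cond_exp_F_meas[OF int_D]) (use Dm in measurable)
    have "AE x in M. real_cond_exp M (G t) (X m) x = real_cond_exp M (G t) (indicator D) x"
      by (rule Gt.real_cond_exp_cong[OF Xm]) (auto simp: X_def)
    with mart have GX: "AE x in M. real_cond_exp M (G t) (indicator D) x = X t x" by auto
    have prod_int: "integrable M (\<lambda>x. h x * indicator D x)"
      by (rule integrable_const_bound[where B=1]) (use h in \<open>auto split: split_indicator\<close>)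
    have "(LINT x:D|M. h x) = (LINT x|M. h x * indicator D x)"
      by (simp add: set_lebesgue_integral_def mult.commute)
    also have "\<dots> = (LINT x|M. h x * real_cond_exp M (G t) (indicator D) x)"
      by (rule Gt.real_cond_exp_intg(2)[symmetric, OF prod_int h(1)]) simp
    also have "\<dots> = (LINT x|M. X t x * h x)"
      by (rule integral_cong_AE) (use GX in \<open>auto simp: X_def\<close>)
    also have "\<dots> = (LINT x|M. X t x * real_cond_exp M (F t) h x)"
    proof (rule Ft.real_cond_exp_intg(2)[symmetric])
      have "integrable M (\<lambda>x. h x * real_cond_exp M (G t) (indicator D) x)"
        by (rule Gt.real_cond_exp_intg(1)[OF prod_int h(1)]) simp
      then show "integrable M (\<lambda>x. X t x * h x)"
        by (rule integrable_cong_AE_imp) (use GX in \<open>auto simp: X_def\<close>)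
    qed (auto simp: X_def)
    also have "\<dots> = (LINT x|M. real_cond_exp M (F t) h x * X t x)" by (simp add: mult.commute)
    also have "\<dots> = (LINT x|M. real_cond_exp M (F t) h x * indicator D x)"
      unfolding X_def
    proof (rule Ft.real_cond_exp_intg(2))
      show "integrable M (\<lambda>x. real_cond_exp M (F t) h x * indicator D x)"
        using Ft.real_cond_exp_int(1)[OF int_h] by (intro integrable_real_mult_indicator) auto
    qed auto
    finally show ?thesis by (simp add: set_lebesgue_integral_def mult.commute)
  qed
  show ?thesis
  proof (rule set_lebesgue_integral_eq_sigma_sets[OF Int_stable_Union_F])
    show "(LINT x|M. h x) = (LINT x|M. real_cond_exp M (F t) h x)"
      using Ft.real_cond_exp_int(2)[OF int_h] by simp
    show "integrable M (real_cond_exp M (F t) h)" by (rule Ft.real_cond_exp_int(1)[OF int_h])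
    show "D \<in> sigma_sets (space M) (\<Union>t\<in>{0..}. sets (F t))" using D by (simp add: sets_terminal_sigma)
    show "(\<Union>t\<in>{0..}. sets (F t)) \<subseteq> sets M" using sets_F_subset by auto
  qed (use base int_h in auto)
qed

end

lemma set_integral_indicator_process:
  "(LINT \<omega>:D|M. indicator_process \<tau> t \<omega>) = measure M {\<omega> \<in> space M. \<omega> \<in> D \<and> \<tau> \<omega> \<le> ennreal t}"
proof -
  have "(LINT \<omega>:D|M. indicator_process \<tau> t \<omega>)
      = (\<integral>\<omega>. indicator {\<omega> \<in> space M. \<omega> \<in> D \<and> \<tau> \<omega> \<le> ennreal t} \<omega> \<partial>M)"
    unfolding set_lebesgue_integral_def indicator_process_def
    by (rule Bochner_Integration.integral_cong) (auto split: split_indicator)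
  then show ?thesis by (simp add: Int_def cong: conj_cong)
qed

locale prob_filtration_time = prob_filtration M F for M :: "'a measure" and F +
  fixes \<tau> :: "'a \<Rightarrow> ennreal"
  assumes random_time: "random_time M \<tau>"
begin

abbreviation "G \<equiv> progressive_enlargement M F \<tau>"
abbreviation "Finf \<equiv> terminal_sigma M F"

lemma tau_measurable [measurable]: "\<tau> \<in> borel_measurable M"
  using random_time by (simp add: random_time_def)

lemma space_G: "space (G t) = space M"
  by (simp add: space_F)

lemma sub_G: "subalgebra M (G t)"
  by (rule subalgebra_progressive_enlargement[OF sub_F random_time])

lemma sets_G: "sets (G t) = (\<Inter>\<epsilon>\<in>{0<..}. sigma_sets (space M)
        (sets (F (t + \<epsilon>)) \<union> sets (natural_filtration M (indicator_process \<tau>) (t + \<epsilon>))))"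
  by (rule sets_progressive_enlargement[of F, OF space_F])

lemma mono_G:
  assumes "s \<le> t" shows "sets (G s) \<subseteq> sets (G t)"
  unfolding sets_G
proof (rule INF_mono)
  fix \<epsilon> :: real assume \<epsilon>: "\<epsilon> \<in> {0<..}"
  show "\<exists>\<epsilon>'\<in>{0<..}. sigma_sets (space M)
       (sets (F (s + \<epsilon>')) \<union> sets (natural_filtration M (indicator_process \<tau>) (s + \<epsilon>')))
    \<subseteq> sigma_sets (space M) (sets (F (t + \<epsilon>)) \<union> sets (natural_filtration M (indicator_process \<tau>) (t + \<epsilon>)))"
    using \<epsilon> assms mono_F[of "s + \<epsilon>" "t + \<epsilon>"]
      sets_natural_filtration_mono[of "s + \<epsilon>" "t + \<epsilon>" M "indicator_process \<tau>"]
    by (intro bexI[of _ \<epsilon>] sigma_sets_mono') auto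
qed

lemma F_subset_G: "sets (F t) \<subseteq> sets (G t)"
proof
  fix A assume "A \<in> sets (F t)"
  then have "A \<in> sets (F (t + \<epsilon>))" if "0 < \<epsilon>" for \<epsilon> using mono_F[of t "t + \<epsilon>"] that by auto
  then show "A \<in> sets (G t)" unfolding sets_G by (auto intro: sigma_sets.Basic)
qed

lemma indicator_process_G: "0 \<le> t \<Longrightarrow> indicator_process \<tau> t \<in> borel_measurable (G t)"
proof -
  assume t: "0 \<le> t"
  have "indicator_process \<tau> t -` B \<inter> space M \<in> sets (G t)" if "B \<in> sets borel" for B
    unfolding sets_G natural_filtration_def
  proof (intro INT_I sigma_sets.Basic UnI2)
    fix \<epsilon> :: real assume "\<epsilon> \<in> {0<..}"
    then have "indicator_process \<tau> t -` B \<inter> space M \<in>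
      (\<Union>s\<in>{0..t + \<epsilon>}. {indicator_process \<tau> s -` A \<inter> space M |A. A \<in> sets borel})"
      using that t by (intro UN_I[of t]) auto
    then show "indicator_process \<tau> t -` B \<inter> space M \<in>
       sets (sigma (space M) (\<Union>s\<in>{0..t + \<epsilon>}. {indicator_process \<tau> s -` A \<inter> space M |A. A \<in> sets borel}))"
      by (rule in_measure_of[rotated]) auto
  qed
  then show ?thesis by (intro measurableI) (auto simp: space_F)
qed

lemma measure_increment:
  assumes D: "D \<in> sets M" and st: "s \<le> t"
  shows "measure M {\<omega> \<in> space M. \<omega> \<in> D \<and> ennreal s < \<tau> \<omega> \<and> \<tau> \<omega> \<le> ennreal t} =
    (LINT \<omega>:D|M. indicator_process \<tau> t \<omega>) - (LINT \<omega>:D|M. indicator_process \<tau> s \<omega>)"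
proof -
  have [measurable]: "D \<in> sets M" by fact
  have "{\<omega> \<in> space M. \<omega> \<in> D \<and> ennreal s < \<tau> \<omega> \<and> \<tau> \<omega> \<le> ennreal t} =
      {\<omega> \<in> space M. \<omega> \<in> D \<and> \<tau> \<omega> \<le> ennreal t} - {\<omega> \<in> space M. \<omega> \<in> D \<and> \<tau> \<omega> \<le> ennreal s}" by auto
  also have "measure M \<dots> = measure M {\<omega> \<in> space M. \<omega> \<in> D \<and> \<tau> \<omega> \<le> ennreal t} - measure M {\<omega> \<in> space M. \<omega> \<in> D \<and> \<tau> \<omega> \<le> ennreal s}"
    by (rule finite_measure_Diff) (use ennreal_leI[OF st] in \<open>auto intro: order_trans\<close>)
  finally show ?thesis by (simp add: set_integral_indicator_process)
qed

text \<open>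
  One minus the Azema supermartingale of \<open>\<tau>\<close>.
\<close>

definition azema :: "real \<Rightarrow> 'a \<Rightarrow> real" where
  "azema t = real_cond_exp M (F t) (indicator_process \<tau> t)"

lemma azema_measurable: "azema t \<in> borel_measurable (F t)"
  unfolding azema_def by simp

lemma measurable_F_terminal:
  "0 \<le> t \<Longrightarrow> f \<in> borel_measurable (F t) \<Longrightarrow> f \<in> borel_measurable Finf"
  using sets_F_subset_terminal[of t]
  by (intro measurable_from_subalg[of Finf "F t" f]) (simp_all add: subalgebra_def space_F space_terminal_sigma)

lemma azema_measurable_terminal: "0 \<le> t \<Longrightarrow> azema t \<in> borel_measurable Finf"
  by (rule measurable_F_terminal[OF _ azema_measurable])

lemma indicator_process_integrable: "integrable M (indicator_process \<tau> t)"
  by (rule integrable_const_bound[where B=1]) (auto simp: indicator_process_def)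

lemma azema_integrable: "integrable M (azema t)"
proof -
  interpret sigma_finite_subalgebra M "F t" by (rule sigma_finite_subalg)
  show ?thesis unfolding azema_def by (rule real_cond_exp_int(1)[OF indicator_process_integrable])
qed

text \<open>
  Under immersion \<open>azema t\<close> is also the conditional probability of \<open>\<tau> \<le> t\<close> given the terminal
  \<open>\<sigma>\<close>-algebra. It is therefore almost surely increasing in \<open>t\<close> and compensates \<open>\<tau>\<close> even for
  the constant filtration.
\<close>

lemma compensates_azema:
  assumes imm: "immersed M F G"
  shows "compensates M (\<lambda>_. Finf) \<tau> azema"
  unfolding compensates_def
proof (intro conjI allI impI ballI)
  have eq: "(LINT x:D|M. azema t x) = (LINT x:D|M. indicator_process \<tau> t x)"
    if "0 \<le> t" "D \<in> sets Finf" for t D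
    unfolding azema_def
    by (rule integral_cond_exp_immersed[where G=G, OF imm sub_G F_subset_G that(1) indicator_process_G[OF that(1)] _ that(2), symmetric])
      (auto simp: indicator_process_def split: split_indicator)
  show "integrable M (azema t)" for t by (rule azema_integrable)
  interpret T: sigma_finite_subalgebra M Finf by (rule sigma_finite_subalgebraI[OF subalgebra_terminal])
  have rce: "AE x in M. real_cond_exp M Finf (indicator_process \<tau> t) x = azema t x" if "0 \<le> t" for t
    by (rule T.real_cond_exp_charact)
      (simp_all add: eq that indicator_process_integrable azema_integrable azema_measurable_terminal)
  show "AE x in M. azema 0 x = 0"
  proof -
    interpret F0: sigma_finite_subalgebra M "F 0" by (rule sigma_finite_subalg)
    have "AE x in M. real_cond_exp M (F 0) (indicator_process \<tau> 0) x = real_cond_exp M (F 0) (\<lambda>_. 0) x"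
    proof (rule F0.real_cond_exp_cong)
      show "AE x in M. indicator_process \<tau> 0 x = 0"
        using random_time by (intro AE_I2) (auto simp: indicator_process_def random_time_def)
    qed (use indicator_process_integrable[of 0] in auto)
    moreover have "AE x in M. real_cond_exp M (F 0) (\<lambda>_. 0 :: real) x = 0"
      by (rule F0.real_cond_exp_F_meas) auto
    ultimately show ?thesis unfolding azema_def by eventually_elim simp
  qed
  fix s t :: real assume st: "0 \<le> s" "s \<le> t"
  have "AE x in M. real_cond_exp M Finf (indicator_process \<tau> s) x \<le> real_cond_exp M Finf (indicator_process \<tau> t) x"
  proof (rule T.real_cond_exp_mono[OF _ indicator_process_integrable indicator_process_integrable])
    show "AE x in M. indicator_process \<tau> s x \<le> indicator_process \<tau> t x"
      using ennreal_leI[OF st(2)]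
      by (intro AE_I2) (auto simp: indicator_process_def split: split_indicator intro: order_trans)
  qed
  then show "AE x in M. azema s x \<le> azema t x"
    using rce[of s] rce[of t] st by auto
  fix D assume D: "D \<in> sets Finf"
  then have DM [measurable]: "D \<in> sets M" using subalgebra_terminal by (auto simp: subalgebra_def)
  have si: "set_integrable M D (azema r)" for r
    unfolding set_integrable_def by (rule integrable_mult_indicator[OF DM azema_integrable])
  have "(\<integral>\<omega>. indicator D \<omega> * (azema t \<omega> - azema s \<omega>) \<partial>M) = (LINT x:D|M. azema t x - azema s x)"
    by (simp add: set_lebesgue_integral_def)
  also have "\<dots> = (LINT x:D|M. azema t x) - (LINT x:D|M. azema s x)"
    by (rule set_integral_diff(2)[OF si si])
  also have "\<dots> = measure M {\<omega> \<in> space M. \<omega> \<in> D \<and> ennreal s < \<tau> \<omega> \<and> \<tau> \<omega> \<le> ennreal t}"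
    using eq[OF _ D] st by (simp add: measure_increment[OF DM])
  finally show "(\<integral>\<omega>. indicator D \<omega> * (azema t \<omega> - azema s \<omega>) \<partial>M) =
      measure M {\<omega> \<in> space M. \<omega> \<in> D \<and> ennreal s < \<tau> \<omega> \<and> \<tau> \<omega> \<le> ennreal t}" .
qed

section \<open>Predictable sets before the random time\<close>

text \<open>
  On \<open>{s < \<tau>}\<close> the indicator process has not moved yet and carries no information. Because
  \<open>G\<^sub>s\<close> is a right limit, the event is approximated through the times \<open>s + 1/n\<close> and the traces are
  combined by a lower limit.
\<close>

lemma G_trace_before:
  assumes A: "A \<in> sets (G s)" and s: "0 \<le> s"
  shows "\<exists>B\<in>sets Finf. \<forall>\<omega>\<in>space M. ennreal s < \<tau> \<omega> \<longrightarrow> (\<omega> \<in> A \<longleftrightarrow> \<omega> \<in> B)"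
proof -
  have trace: "\<exists>B\<in>sets (F r). \<forall>\<omega>\<in>space M. ennreal r < \<tau> \<omega> \<longrightarrow> (\<omega> \<in> X \<longleftrightarrow> \<omega> \<in> B)"
    if "X \<in> sigma_sets (space M) (sets (F r) \<union> sets (natural_filtration M (indicator_process \<tau>) r))" for r X
    using that
  proof induction
    case (Basic a)
    then show ?case
    proof
      assume "a \<in> sets (natural_filtration M (indicator_process \<tau>) r)"
      moreover have "(\<Union>s\<in>{0..r}. {indicator_process \<tau> s -` A \<inter> space M |A. A \<in> sets borel}) \<subseteq> Pow (space M)" by auto
      ultimately have "a \<in> sigma_sets (space M) (\<Union>s\<in>{0..r}. {indicator_process \<tau> s -` A \<inter> space M |A. A \<in> sets borel})"
        by (simp add: natural_filtration_def sets_measure_of)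
      then have "(\<forall>\<omega>\<in>space M. ennreal r < \<tau> \<omega> \<longrightarrow> \<omega> \<in> a) \<or> (\<forall>\<omega>\<in>space M. ennreal r < \<tau> \<omega> \<longrightarrow> \<omega> \<notin> a)"
      proof induction
        case (Basic a)
        then obtain u C where u: "0 \<le> u" "u \<le> r" and a: "a = indicator_process \<tau> u -` C \<inter> space M" by auto
        have "indicator_process \<tau> u \<omega> = 0" if "ennreal r < \<tau> \<omega>" for \<omega>
          using that ennreal_leI[OF u(2)] by (auto simp: indicator_process_def not_le intro: le_less_trans)
        then show ?case unfolding a by (cases "0 \<in> C") auto
      qed auto
      then show ?thesis
      proof
        assume "\<forall>\<omega>\<in>space M. ennreal r < \<tau> \<omega> \<longrightarrow> \<omega> \<in> a"
        then show ?thesis using sets.top[of "F r"] by (intro bexI[of _ "space (F r)"]) (auto simp: space_F)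
      qed (auto intro!: bexI[of _ "{}"])
    qed auto
  next
    case Empty
    show ?case by (intro bexI[of _ "{}"]) auto
  next
    case (Compl a)
    then obtain B where B: "B \<in> sets (F r)" "\<forall>\<omega>\<in>space M. ennreal r < \<tau> \<omega> \<longrightarrow> (\<omega> \<in> a \<longleftrightarrow> \<omega> \<in> B)" by blast
    then show ?case using sets.compl_sets[OF B(1)]
      by (intro bexI[of _ "space (F r) - B"]) (auto simp: space_F)
  next
    case (Union a)
    then obtain B where B: "\<And>i. B i \<in> sets (F r)"
      "\<And>i. \<forall>\<omega>\<in>space M. ennreal r < \<tau> \<omega> \<longrightarrow> (\<omega> \<in> a i \<longleftrightarrow> \<omega> \<in> B i)" by metis
    then show ?case by (intro bexI[of _ "\<Union>i. B i"]) auto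
  qed
  define e where "e n = inverse (real (Suc n))" for n
  have e: "0 < e n" for n by (simp add: e_def)
  have e0: "e \<longlonglongrightarrow> 0" unfolding e_def by (rule LIMSEQ_inverse_real_of_nat)
  have "\<forall>n. \<exists>B\<in>sets (F (s + e n)). \<forall>\<omega>\<in>space M. ennreal (s + e n) < \<tau> \<omega> \<longrightarrow> (\<omega> \<in> A \<longleftrightarrow> \<omega> \<in> B)"
    using A e unfolding sets_G by (auto intro!: trace)
  then obtain B where B: "\<And>n. B n \<in> sets (F (s + e n))"
    "\<And>n \<omega>. \<omega> \<in> space M \<Longrightarrow> ennreal (s + e n) < \<tau> \<omega> \<Longrightarrow> \<omega> \<in> A \<longleftrightarrow> \<omega> \<in> B n" by metis
  show ?thesis
  proof (intro bexI[of _ "\<Union>n. \<Inter>m\<in>{n..}. B m"] ballI impI)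
    have "B n \<in> sets Finf" for n using B(1)[of n] sets_F_subset_terminal[of "s + e n"] s e[of n] by auto
    then show "(\<Union>n. \<Inter>m\<in>{n..}. B m) \<in> sets Finf" by auto
    fix \<omega> assume \<omega>: "\<omega> \<in> space M" "ennreal s < \<tau> \<omega>"
    have "(\<lambda>n. ennreal (s + e n)) \<longlonglongrightarrow> ennreal (s + 0)"
      by (intro tendsto_intros e0)
    then have "eventually (\<lambda>n. ennreal (s + e n) < \<tau> \<omega>) sequentially"
      using \<omega>(2) by (intro order_tendstoD) auto
    then obtain n0 where n0: "\<And>n. n0 \<le> n \<Longrightarrow> ennreal (s + e n) < \<tau> \<omega>" by (auto simp: eventually_sequentially)
    then have n0': "\<omega> \<in> A \<longleftrightarrow> \<omega> \<in> B n" if "n0 \<le> n" for n using that \<omega>(1) B(2) by blast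
    show "\<omega> \<in> A \<longleftrightarrow> \<omega> \<in> (\<Union>n. \<Inter>m\<in>{n..}. B m)"
    proof
      assume "\<omega> \<in> (\<Union>n. \<Inter>m\<in>{n..}. B m)"
      then obtain n where "\<And>m. n \<le> m \<Longrightarrow> \<omega> \<in> B m" by auto
      then show "\<omega> \<in> A" using n0'[of "max n n0"] by auto
    qed (use n0' in auto)
  qed
qed

text \<open>
  Predictability matters here: a rectangle over \<open>{s<..t}\<close> with basis in \<open>G\<^sub>s\<close> meets the times up to \<open>\<tau>\<close>
  only on \<open>{s < \<tau>}\<close>, so the trace can be taken up to and including \<open>\<tau>\<close> itself.
\<close>

lemma predictable_trace_before:
  assumes "B \<in> sets (predictable_sigma M G)"
  shows "\<exists>C\<in>sets (predictable_sigma M (\<lambda>_. Finf)).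
     \<forall>\<omega>\<in>space M. \<forall>t>0. ennreal t \<le> \<tau> \<omega> \<longrightarrow> ((\<omega>, t) \<in> B \<longleftrightarrow> (\<omega>, t) \<in> C)"
  using assms unfolding sets_predictable_sigma[of G, OF space_G]
proof induction
  case (Basic a)
  then consider (zero) D where "a = D \<times> {0}" | (ivl) D s t where "a = D \<times> {s<..t}" "0 \<le> s" "D \<in> sets (G s)"
    unfolding predictable_rectangles_def by auto
  then show ?case
  proof cases
    case zero
    then show ?thesis by (intro bexI[of _ "{}"]) auto
  next
    case ivl
    obtain D' where D': "D' \<in> sets Finf"
      "\<And>\<omega>. \<omega> \<in> space M \<Longrightarrow> ennreal s < \<tau> \<omega> \<Longrightarrow> (\<omega> \<in> D \<longleftrightarrow> \<omega> \<in> D')"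
      using G_trace_before[OF ivl(3,2)] by blast
    have "ennreal s < \<tau> \<omega>" if "ennreal u \<le> \<tau> \<omega>" "s < u" for u \<omega>
    proof -
      have "ennreal s < ennreal u" using that(2) ivl(2) by (simp add: ennreal_less_iff)
      then show ?thesis using that(1) by (rule less_le_trans)
    qed
    then show ?thesis
      using predictable_rectangleI[of "\<lambda>_. Finf" M s D' t] space_terminal_sigma ivl D'
      by (intro bexI[of _ "D' \<times> {s<..t}"]) auto
  qed
next
  case Empty
  show ?case by (intro bexI[of _ "{}"]) auto
next
  case (Compl a)
  then obtain C where C: "C \<in> sets (predictable_sigma M (\<lambda>_. Finf))"
    "\<forall>\<omega>\<in>space M. \<forall>t>0. ennreal t \<le> \<tau> \<omega> \<longrightarrow> ((\<omega>, t) \<in> a \<longleftrightarrow> (\<omega>, t) \<in> C)" by blast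
  then show ?case using sets.compl_sets[OF C(1)] space_predictable_sigma[of "\<lambda>_. Finf" M] space_terminal_sigma
    by (intro bexI[of _ "space (predictable_sigma M (\<lambda>_. Finf)) - C"]) auto
next
  case (Union a)
  then have "\<forall>i. \<exists>C. C \<in> sets (predictable_sigma M (\<lambda>_. Finf)) \<and>
    (\<forall>\<omega>\<in>space M. \<forall>t>0. ennreal t \<le> \<tau> \<omega> \<longrightarrow> ((\<omega>, t) \<in> a i \<longleftrightarrow> (\<omega>, t) \<in> C))"
    by (simp add: Bex_def)
  from choice[OF this] obtain C where C: "\<And>i. C i \<in> sets (predictable_sigma M (\<lambda>_. Finf))"
    "\<And>i \<omega> t. \<omega> \<in> space M \<Longrightarrow> 0 < t \<Longrightarrow> ennreal t \<le> \<tau> \<omega> \<Longrightarrow> (\<omega>, t) \<in> a i \<longleftrightarrow> (\<omega>, t) \<in> C i"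
    by auto
  then show ?case by (intro bexI[of _ "\<Union>i. C i"]) auto
qed

end

section \<open>Random sets not charged by the random time\<close>

text \<open>
  For a constant filtration predictability amounts to joint measurability in scenario and time.
\<close>

lemma predictable_sigma_const_measurable:
  assumes sp: "space F = space M"
  shows "fst \<in> measurable (predictable_sigma M (\<lambda>_. F)) F"
    and "snd \<in> borel_measurable (predictable_sigma M (\<lambda>_. F))"
proof -
  let ?S = "predictable_sigma M (\<lambda>_. F)"
  have spS: "space ?S = space M \<times> {0..}" by (rule space_predictable_sigma) (rule sp)
  have rect: "D \<times> {0} \<in> sets ?S" "D \<times> {0<..t} \<in> sets ?S" if "D \<in> sets F" for D t
  proof -
    show "D \<times> {0} \<in> sets ?S"
      unfolding sets_predictable_sigma[of "\<lambda>_. F", OF sp] predictable_rectangles_def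
      using that by (intro sigma_sets.Basic) blast
    show "D \<times> {0<..t} \<in> sets ?S"
      by (rule predictable_rectangleI) (use sp that in auto)
  qed
  show "fst \<in> measurable ?S F"
  proof (rule measurableI)
    show "fst x \<in> space F" if "x \<in> space ?S" for x using that by (auto simp: spS sp)
    fix D assume D: "D \<in> sets F"
    have "fst -` D \<inter> space ?S = D \<times> {0} \<union> (\<Union>n::nat. D \<times> {0<..real n})"
    proof -
      have "D \<subseteq> space M" using sets.sets_into_space[OF D] sp by simp
      moreover have "t = 0 \<or> 0 < t \<and> (\<exists>n::nat. t \<le> real n)" if "0 \<le> t" for t :: real
        using that real_arch_simple[of t] by auto
      ultimately show ?thesis unfolding spS by fastforce
    qed
    also have "\<dots> \<in> sets ?S" using rect[OF D] by auto
    finally show "fst -` D \<inter> space ?S \<in> sets ?S" .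
  qed
  have top: "space M \<in> sets F" using sets.top[of F] sp by simp
  show "snd \<in> borel_measurable ?S"
  proof (rule borel_measurableI_le)
    fix a :: real
    have "{x \<in> space ?S. snd x \<le> a} = (if 0 \<le> a then space M \<times> {0} \<union> space M \<times> {0<..a} else {})"
      unfolding spS by (auto simp: less_eq_real_def)
    also have "\<dots> \<in> sets ?S" using rect[OF top] by auto
    finally show "{x \<in> space ?S. snd x \<le> a} \<in> sets ?S" .
  qed
qed

text \<open>
  The rationals that have no mass of \<open>S\<close> below them and those that have none above them form a cut of the
  line; up to null sets \<open>S\<close> lies in the cut, which is at most one point.
\<close>

lemma AE_lborel_not_in_if_halves_null:
  fixes S :: "real set"
  assumes "\<And>v. v \<in> \<rat> \<Longrightarrow> (AE u in lborel. u \<in> S \<longrightarrow> v < u) \<or> (AE u in lborel. u \<in> S \<longrightarrow> u \<le> v)"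
  shows "AE u in lborel. u \<notin> S"
proof -
  define L where "L = {v\<in>\<rat>. AE u in lborel. u \<in> S \<longrightarrow> v < u}"
  define U where "U = {v\<in>\<rat>. AE u in lborel. u \<in> S \<longrightarrow> u \<le> v}"
  have LU: "L \<union> U = \<rat>" using assms by (auto simp: L_def U_def)
  have cnt: "countable L" "countable U" unfolding L_def U_def
    by (rule countable_subset[OF _ countable_rat], auto)+
  define P where "P = {u\<in>S. (\<forall>v\<in>L. v < u) \<and> (\<forall>v\<in>U. u \<le> v)}"
  have "x = y" if "x \<in> P" "y \<in> P" for x y
  proof (rule ccontr)
    assume "x \<noteq> y"
    have *: False if xy: "x \<in> P" "y \<in> P" "x < y" for x y
    proof -
      obtain q where q: "q \<in> \<rat>" "x < q" "q < y" using Rats_dense_in_real[OF xy(3)] by blast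
      then consider "q \<in> L" | "q \<in> U" using LU by blast
      then show False using q xy by cases (auto simp: P_def)
    qed
    show False using *[of x y] *[of y x] that \<open>x \<noteq> y\<close> by linarith
  qed
  then have "\<exists>p. P \<subseteq> {p}" by (metis insertI1 subsetI singletonI)
  then obtain p where p: "P \<subseteq> {p}" by blast
  have "AE u in lborel. \<forall>v\<in>L. u \<in> S \<longrightarrow> v < u" by (rule AE_ball_countable'[OF _ cnt(1)]) (auto simp: L_def)
  moreover have "AE u in lborel. \<forall>v\<in>U. u \<in> S \<longrightarrow> u \<le> v" by (rule AE_ball_countable'[OF _ cnt(2)]) (auto simp: U_def)
  moreover have "AE u in lborel. u \<noteq> p" by (rule AE_lborel_singleton)
  ultimately show ?thesis
    by eventually_elim (use p in \<open>auto simp: P_def\<close>)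
qed

lemma (in prob_filtration) sets_F_AE_cong:
  assumes complete: "complete_measure M" and null: "null_sets M \<subseteq> sets (F t)"
    and X: "X \<in> sets (F t)" and Y: "Y \<subseteq> space M" and eq: "AE \<omega> in M. \<omega> \<in> X \<longleftrightarrow> \<omega> \<in> Y"
  shows "Y \<in> sets (F t)"
proof -
  interpret complete_measure M by fact
  obtain Z where Z: "{\<omega> \<in> space M. \<not> (\<omega> \<in> X \<longleftrightarrow> \<omega> \<in> Y)} \<subseteq> Z" "Z \<in> null_sets M"
    using eq unfolding eventually_ae_filter by blast
  have XM: "X \<subseteq> space M" using sets.sets_into_space[OF X] by (simp add: space_F)
  have "X - Y \<in> null_sets M" "Y - X \<in> null_sets M"
    using Z XM Y by (auto intro!: null_sets_subset[OF Z(2)] complete[OF _ Z(2)])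
  then have "X - Y \<in> sets (F t)" "Y - X \<in> sets (F t)" using null by auto
  then have "(X - (X - Y)) \<union> (Y - X) \<in> sets (F t)" using X by blast
  moreover have "(X - (X - Y)) \<union> (Y - X) = Y" by auto
  ultimately show ?thesis by simp
qed

locale immersed_time = prob_filtration_time M F \<tau> for M :: "'a measure" and F \<tau> +
  assumes complete: "complete_measure M"
    and null_F: "\<And>t. null_sets M \<subseteq> sets (F t)"
    and imm: "immersed M F (progressive_enlargement M F \<tau>)"
begin

sublocale Z: compensated_time M "\<lambda>_. terminal_sigma M F" \<tau> azema
  by unfold_locales (use subalgebra_terminal compensates_azema[OF imm] random_time in auto)

abbreviation "Sinf \<equiv> predictable_sigma M (\<lambda>_. terminal_sigma M F)"

text \<open>
  The event that the passage time is at most \<open>t\<close> agrees with \<open>{v \<le> azema t}\<close> only almost surely;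
  completeness turns this into measurability at time \<open>t\<close>, not merely at later times.
\<close>

lemma inverse_azema_stopping_time:
  assumes "0 < v"
  shows "extended_stopping_time F (inverse_time azema v)"
  unfolding extended_stopping_time_def
proof (intro allI impI)
  fix t :: real assume t: "0 \<le> t"
  have X: "{\<omega> \<in> space M. v \<le> azema t \<omega>} \<in> sets (F t)"
    using azema_measurable[of t] by (simp add: space_F[of t, symmetric])
  have eq: "AE \<omega> in M. \<omega> \<in> {\<omega> \<in> space M. v \<le> azema t \<omega>} \<longleftrightarrow> \<omega> \<in> {\<omega> \<in> space M. inverse_time azema v \<omega> \<le> ennreal t}"
    using Z.AE_inverse_time_le_iff[OF t] by eventually_elim (use assms in auto)
  have "{\<omega> \<in> space M. inverse_time azema v \<omega> \<le> ennreal t} \<in> sets (F t)"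
    by (rule sets_F_AE_cong[OF complete null_F X _ eq]) blast
  then show "Measurable.pred (F t) (\<lambda>\<omega>. inverse_time azema v \<omega> \<le> ennreal t)"
    by (simp add: pred_def space_F)
qed

lemma inverse_azema_measurable: "inverse_time azema v \<in> borel_measurable Finf"
  by (rule borel_measurable_inverse_time) (simp_all add: azema_measurable_terminal)

lemma space_Sinf: "space Sinf = space M \<times> {0..}"
  by (rule space_predictable_sigma) (rule space_terminal_sigma)

text \<open>
  Write \<open>R\<^sub>u\<close> for the passage times of \<open>azema\<close> and \<open>S\<close> for the random set of levels \<open>u\<close> with
  \<open>(\<omega>, R\<^sub>u) \<in> C\<close>. If \<open>S\<close> has mass below the level \<open>v\<close>, then a point of \<open>C\<close> lies at or before \<open>R\<^sub>v\<close>, so \<open>\<tau>\<close>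
  cannot be a point of \<open>C\<close> after \<open>R\<^sub>v\<close>. Translated back to levels, almost no \<open>u \<in> S\<close> satisfies
  \<open>R\<^sub>v < R\<^sub>u\<close>; and almost no \<open>u\<close> satisfies \<open>R\<^sub>u = R\<^sub>v < \<infinity>\<close>, since \<open>\<tau>\<close> avoids the stopping time
  \<open>R\<^sub>v\<close>. So for each rational \<open>v\<close> the mass of \<open>S\<close> lies on one side of \<open>v\<close>, and \<open>S\<close> is null.
\<close>

lemma AE_not_in_if_avoids:
  assumes avoid: "avoids_stopping_times M F \<tau>"
    and C: "C \<in> sets Sinf"
    and first: "AE \<omega> in M. \<tau> \<omega> < \<infinity> \<longrightarrow> (\<omega>, enn2real (\<tau> \<omega>)) \<in> C \<longrightarrow>
                  (\<forall>t>0. ennreal t < \<tau> \<omega> \<longrightarrow> (\<omega>, t) \<notin> C)"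
  shows "AE \<omega> in M. \<tau> \<omega> < \<infinity> \<longrightarrow> (\<omega>, enn2real (\<tau> \<omega>)) \<notin> C"
proof (rule Z.AE_stopped_at_null[OF C])
  note [measurable] = predictable_sigma_const_measurable[OF space_terminal_sigma]
  define S where "S \<omega> = {u. inverse_time azema u \<omega> < \<infinity> \<and> (\<omega>, enn2real (inverse_time azema u \<omega>)) \<in> C}" for \<omega>
  let ?P = "Finf \<Otimes>\<^sub>M (lborel :: real measure)"
  have R_meas [measurable]: "(\<lambda>x. inverse_time azema (snd x) (fst x)) \<in> borel_measurable ?P"
  proof (rule borel_measurable_inverse_time)
    fix r :: real assume "0 \<le> r"
    note [measurable] = azema_measurable_terminal[OF this]
    show "(\<lambda>x. azema r (fst x)) \<in> borel_measurable ?P" by measurable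
  qed measurable
  have "stopped_at ?P fst (\<lambda>x. inverse_time azema (snd x) (fst x)) C \<in> sets ?P"
  proof (rule stopped_at_measurable(2)[OF space_terminal_sigma _ _ R_meas C])
    show "fst x \<in> space M" if "x \<in> space ?P" for x
      using that by (auto simp: space_pair_measure space_terminal_sigma)
    show "{x \<in> space ?P. fst x \<in> D} \<in> sets ?P" if [measurable]: "D \<in> sets Finf" for D by measurable
  qed
  then have S_meas: "{x \<in> space ?P. snd x \<in> S (fst x)} \<in> sets ?P"
    unfolding stopped_at_def S_def by simp
  define Q where "Q v = {x \<in> space ?P. snd x \<in> S (fst x)} \<inter> {x \<in> space ?P. snd x \<le> v}" for v
  have Q: "Q v \<in> sets ?P" for v unfolding Q_def by (rule sets.Int[OF S_meas]) measurable
  define q where "q v \<omega> = emeasure lborel (Pair \<omega> -` Q v)" for v \<omega>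
  have q_meas [measurable]: "q v \<in> borel_measurable Finf" for v
    unfolding q_def by (rule lborel.measurable_emeasure_Pair[OF Q])
  have Q_slice: "Pair \<omega> -` Q v = {u \<in> S \<omega>. u \<le> v}" if "\<omega> \<in> space M" for v \<omega>
    using that by (auto simp: Q_def space_pair_measure space_terminal_sigma)
  have S_pos: "0 < u" if "u \<in> S \<omega>" for u \<omega>
    using that inverse_time_less_iff[of azema u \<omega> \<infinity>] by (auto simp: S_def)
  have half: "AE \<omega> in M. (AE u in lborel. u \<in> S \<omega> \<longrightarrow> v < u) \<or> (AE u in lborel. u \<in> S \<omega> \<longrightarrow> u \<le> v)"
    if v: "0 < v" for v
  proof -
    note [measurable] = inverse_azema_measurable[of v]
    (* never charged by tau: mass of S below v puts a point of C at or before the passage of v *)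
    define C' where "C' = C \<inter> {x \<in> space Sinf. inverse_time azema v (fst x) < ennreal (snd x) \<and> 0 < q v (fst x)}"
    have C': "C' \<in> sets Sinf" unfolding C'_def by (rule sets.Int[OF C]) measurable
    have "AE \<omega> in M. \<tau> \<omega> < \<infinity> \<longrightarrow> (\<omega>, enn2real (\<tau> \<omega>)) \<notin> C'"
      using first Z.AE_inverse_time_pos AE_space
    proof eventually_elim
      case (elim \<omega>)
      show ?case
      proof (intro impI notI)
        assume fin: "\<tau> \<omega> < \<infinity>" and "(\<omega>, enn2real (\<tau> \<omega>)) \<in> C'"
        then have *: "(\<omega>, enn2real (\<tau> \<omega>)) \<in> C" "inverse_time azema v \<omega> < \<tau> \<omega>" "0 < q v \<omega>"
          by (auto simp: C'_def less_top)
        have "{u \<in> S \<omega>. u \<le> v} \<noteq> {}"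
        proof
          assume "{u \<in> S \<omega>. u \<le> v} = {}"
          then have "q v \<omega> = 0" unfolding q_def Q_slice[OF elim(3)] by (simp only: emeasure_empty)
          then show False using *(3) by simp
        qed
        then obtain u where u: "u \<in> S \<omega>" "u \<le> v" by auto
        define t where "t = enn2real (inverse_time azema u \<omega>)"
        have t: "ennreal t = inverse_time azema u \<omega>" using u(1) by (simp add: t_def S_def less_top)
        have "inverse_time azema u \<omega> < \<tau> \<omega>"
          using inverse_time_mono[OF S_pos[OF u(1)] u(2), of azema \<omega>] *(2) by (rule le_less_trans)
        moreover have "0 < t" using elim(2) t by (metis ennreal_less_zero_iff)
        moreover have "(\<omega>, t) \<in> C" using u(1) by (simp add: S_def t_def)
        ultimately show False using elim(1) fin *(1) t by auto
      qed
    qed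
    from Z.AE_null_slices[OF C' this]
    have 1: "AE \<omega> in M. AE u in lborel. inverse_time azema u \<omega> < \<infinity> \<longrightarrow> (\<omega>, enn2real (inverse_time azema u \<omega>)) \<notin> C'" .
    define D where "D = {x \<in> space Sinf. inverse_time azema v (fst x) = ennreal (snd x)}"
    have D: "D \<in> sets Sinf" unfolding D_def by measurable
    have "measure M {\<omega> \<in> space M. \<tau> \<omega> = inverse_time azema v \<omega> \<and> inverse_time azema v \<omega> < \<infinity>} = 0"
      using avoid inverse_azema_stopping_time[OF v] by (simp add: avoids_stopping_times_def)
    moreover have [measurable]: "inverse_time azema v \<in> borel_measurable M"
      using measurable_from_subalg[OF subalgebra_terminal inverse_azema_measurable] .
    ultimately have "AE \<omega> in M. \<not> (\<tau> \<omega> = inverse_time azema v \<omega> \<and> inverse_time azema v \<omega> < \<infinity>)"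
      by (subst AE_iff_measurable[OF _ refl]) (auto simp: emeasure_eq_measure)
    then have "AE \<omega> in M. \<tau> \<omega> < \<infinity> \<longrightarrow> (\<omega>, enn2real (\<tau> \<omega>)) \<notin> D"
      by eventually_elim (auto simp: D_def less_top)
    from Z.AE_null_slices[OF D this]
    have 2: "AE \<omega> in M. AE u in lborel. inverse_time azema u \<omega> < \<infinity> \<longrightarrow> (\<omega>, enn2real (inverse_time azema u \<omega>)) \<notin> D" .
    from 1 2 AE_space show ?thesis
    proof eventually_elim
      case (elim \<omega>)
      show ?case
      proof (cases "q v \<omega> = 0")
        case True
        have "{u \<in> S \<omega>. u \<le> v} \<in> sets lborel"
          using sets_Pair1[OF Q[of v], of \<omega>] Q_slice[OF elim(3)] by simp
        then have "{u \<in> S \<omega>. u \<le> v} \<in> null_sets lborel"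
          using True Q_slice[OF elim(3)] by (auto simp: q_def intro!: null_setsI)
        then have "AE u in lborel. u \<notin> {u \<in> S \<omega>. u \<le> v}" by (rule AE_not_in)
        then have "AE u in lborel. u \<in> S \<omega> \<longrightarrow> v < u" by eventually_elim auto
        then show ?thesis ..
      next
        case False
        from elim(1,2) have "AE u in lborel. u \<in> S \<omega> \<longrightarrow> u \<le> v"
        proof eventually_elim
          case (elim u)
          show ?case
          proof (rule impI, rule ccontr)
            assume u: "u \<in> S \<omega>" "\<not> u \<le> v"
            then have fin: "inverse_time azema u \<omega> < \<infinity>" and inC: "(\<omega>, enn2real (inverse_time azema u \<omega>)) \<in> C"
              by (auto simp: S_def)
            have *: "(\<omega>, enn2real (inverse_time azema u \<omega>)) \<in> space Sinf"
              using \<open>\<omega> \<in> space M\<close> by (simp add: space_Sinf)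
            have "inverse_time azema v \<omega> \<le> inverse_time azema u \<omega>"
              using u(2) v by (intro inverse_time_mono) auto
            moreover have "inverse_time azema v \<omega> \<noteq> inverse_time azema u \<omega>"
              using elim(2) fin * by (auto simp: D_def less_top)
            moreover have "\<not> inverse_time azema v \<omega> < inverse_time azema u \<omega>"
              using elim(1) fin inC * False by (auto simp: C'_def less_top zero_less_iff_neq_zero)
            ultimately show False by auto
          qed
        qed
        then show ?thesis ..
      qed
    qed
  qed
  have "AE \<omega> in M. \<forall>v\<in>\<rat> \<inter> {0<..}. (AE u in lborel. u \<in> S \<omega> \<longrightarrow> v < u) \<or> (AE u in lborel. u \<in> S \<omega> \<longrightarrow> u \<le> v)"
    using countable_rat by (intro AE_ball_countable' half) auto
  then show "AE \<omega> in M. AE u in lborel. inverse_time azema u \<omega> < \<infinity> \<longrightarrow> (\<omega>, enn2real (inverse_time azema u \<omega>)) \<notin> C"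
  proof eventually_elim
    case (elim \<omega>)
    have "AE u in lborel. u \<notin> S \<omega>"
    proof (rule AE_lborel_not_in_if_halves_null)
      fix v :: real assume "v \<in> \<rat>"
      then show "(AE u in lborel. u \<in> S \<omega> \<longrightarrow> v < u) \<or> (AE u in lborel. u \<in> S \<omega> \<longrightarrow> u \<le> v)"
      proof (cases "0 < v")
        case False
        then have "AE u in lborel. u \<in> S \<omega> \<longrightarrow> v < u" using S_pos by (intro AE_I2) force
        then show ?thesis ..
      qed (use elim \<open>v \<in> \<rat>\<close> in auto)
    qed
    then show ?case by eventually_elim (auto simp: S_def)
  qed
qed

end

section \<open>Avoidance implies a continuous compensator\<close>

lemma inverse_time_eqI:
  assumes t: "0 \<le> t" and u: "0 < u" "u \<le> A t \<omega>"
    and below: "\<And>s. 0 \<le> s \<Longrightarrow> s < t \<Longrightarrow> A s \<omega> < u"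
    and mono: "\<And>s. t \<le> s \<Longrightarrow> A t \<omega> \<le> A s \<omega>"
  shows "inverse_time A u \<omega> = ennreal t"
proof (rule antisym)
  show "ennreal t \<le> inverse_time A u \<omega>"
  proof (rule ccontr)
    assume "\<not> ?thesis"
    then obtain r where "r \<in> \<rat>" "0 \<le> r" "u \<le> A r \<omega>" "ennreal r < ennreal t"
      unfolding not_le inverse_time_less_iff by blast
    then show False using below[of r] t by (simp add: ennreal_less_iff)
  qed
  show "inverse_time A u \<omega> \<le> ennreal t"
  proof (rule ccontr)
    assume "\<not> ?thesis"
    then have "ennreal t < inverse_time A u \<omega>" by simp
    then obtain z where z: "ennreal t < z" "z < inverse_time A u \<omega>" using dense by blast
    define x where "x = enn2real z"
    have x: "ennreal x = z" using z(2) by (auto simp: x_def less_top dest: less_le_trans[of z _ top])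
    then have "t < x" using z(1) t by (metis ennreal_less_iff)
    then obtain r where r: "r \<in> \<rat>" "t < r" "r < x" using Rats_dense_in_real by blast
    then have "u \<le> A r \<omega>" using mono[of r] u by simp
    then have "inverse_time A u \<omega> < ennreal x"
      unfolding inverse_time_less_iff using u r t by (intro bexI[of _ r]) (auto simp: ennreal_less_iff)
    with x z(2) show False by simp
  qed
qed

context prob_filtration_time
begin

lemma compensates_predictable_compensator:
  assumes \<Lambda>: "predictable_compensator M G \<tau> \<Lambda>"
  shows "compensates M G \<tau> \<Lambda>" and "0 \<le> t \<Longrightarrow> \<Lambda> t \<in> borel_measurable (G t)"
proof -
  let ?X = "\<lambda>t \<omega>. indicator_process \<tau> t \<omega> - \<Lambda> t \<omega>"
  have mart: "\<And>t. 0 \<le> t \<Longrightarrow> ?X t \<in> borel_measurable (G t)" "\<And>t. 0 \<le> t \<Longrightarrow> integrable M (?X t)"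
    "\<And>s t. 0 \<le> s \<Longrightarrow> s \<le> t \<Longrightarrow> AE \<omega> in M. real_cond_exp M (G s) (?X t) \<omega> = ?X s \<omega>"
    using \<Lambda> by (auto simp: predictable_compensator_def martingale_def)
  have eq: "\<Lambda> t = (\<lambda>\<omega>. indicator_process \<tau> t \<omega> - ?X t \<omega>)" for t by auto
  show "\<Lambda> t \<in> borel_measurable (G t)" if "0 \<le> t" for t
    by (subst eq) (intro borel_measurable_diff indicator_process_G mart that)
  have int: "integrable M (\<Lambda> t)" if "0 \<le> t" for t
    by (subst eq) (intro Bochner_Integration.integrable_diff indicator_process_integrable mart that)
  show "compensates M G \<tau> \<Lambda>"
    unfolding compensates_def
  proof (intro conjI allI impI ballI)
    show "integrable M (\<Lambda> t)" if "0 \<le> t" for t by (rule int[OF that])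
    show "AE \<omega> in M. \<Lambda> 0 \<omega> = 0" using \<Lambda> by (simp add: predictable_compensator_def)
    fix s t :: real assume st: "0 \<le> s" "s \<le> t"
    have "increasing_process M \<Lambda>" using \<Lambda> by (simp add: predictable_compensator_def)
    then show "AE \<omega> in M. \<Lambda> s \<omega> \<le> \<Lambda> t \<omega>"
      unfolding increasing_process_def by eventually_elim (use st in \<open>auto simp: mono_on_def\<close>)
    fix D assume D: "D \<in> sets (G s)"
    have DM [measurable]: "D \<in> sets M" using D sub_G by (auto simp: subalgebra_def)
    interpret sigma_finite_subalgebra M "G s" by (rule sigma_finite_subalgebraI[OF sub_G])
    have si: "set_integrable M D f" if "integrable M f" for f :: "'a \<Rightarrow> real"
      unfolding set_integrable_def by (rule integrable_mult_indicator[OF DM that])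
    have tt: "0 \<le> t" using st by simp
    note i = si[OF int[OF tt]] si[OF int[OF st(1)]] si[OF indicator_process_integrable]
    have "(LINT x:D|M. ?X t x) = (LINT x:D|M. real_cond_exp M (G s) (?X t) x)"
      using real_cond_exp_intA[OF mart(2)[OF tt] D] by simp
    also have "\<dots> = (LINT x:D|M. ?X s x)"
      unfolding set_lebesgue_integral_def
    proof (rule integral_cong_AE)
      show "AE x in M. indicat_real D x *\<^sub>R real_cond_exp M (G s) (?X t) x = indicat_real D x *\<^sub>R ?X s x"
        using mart(3)[OF st] by eventually_elim simp
    qed (use mart(2)[OF st(1)] in auto)
    finally have "(LINT x:D|M. \<Lambda> t x) - (LINT x:D|M. \<Lambda> s x)
        = (LINT x:D|M. indicator_process \<tau> t x) - (LINT x:D|M. indicator_process \<tau> s x)"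
      using i by (simp add: set_integral_diff)
    also have "\<dots> = measure M {\<omega> \<in> space M. \<omega> \<in> D \<and> ennreal s < \<tau> \<omega> \<and> \<tau> \<omega> \<le> ennreal t}"
      by (rule measure_increment[OF DM st(2), symmetric])
    also have "(LINT x:D|M. \<Lambda> t x) - (LINT x:D|M. \<Lambda> s x) = (LINT x:D|M. \<Lambda> t x - \<Lambda> s x)"
      using i by (simp add: set_integral_diff)
    finally show "(\<integral>\<omega>. indicator D \<omega> * (\<Lambda> t \<omega> - \<Lambda> s \<omega>) \<partial>M) =
        measure M {\<omega> \<in> space M. \<omega> \<in> D \<and> ennreal s < \<tau> \<omega> \<and> \<tau> \<omega> \<le> ennreal t}"
      by (simp add: set_lebesgue_integral_def)
  qed
qed

text \<open>
  For a nondecreasing right-continuous path this is the graph of the first passage time to the level \<open>q\<close>.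
  Comparing with rational earlier times only makes it visibly predictable.
\<close>

lemma first_passage_predictable:
  assumes \<Lambda>: "predictable_compensator M G \<tau> \<Lambda>"
  shows "{x \<in> space M \<times> {0..}. q \<le> \<Lambda> (snd x) (fst x) \<and> (\<forall>r\<in>\<rat> \<inter> {0..}. r < snd x \<longrightarrow> \<Lambda> r (fst x) < q)}
     \<in> sets (predictable_sigma M G)"
proof -
  let ?S = "predictable_sigma M G"
  have spS: "space ?S = space M \<times> {0..}" by (rule space_predictable_sigma[of G, OF space_G])
  have [measurable]: "(\<lambda>x. \<Lambda> (snd x) (fst x)) \<in> borel_measurable ?S"
    using \<Lambda> by (simp add: predictable_compensator_def predictable_def case_prod_unfold)
  have X: "{x \<in> space ?S. q \<le> \<Lambda> (snd x) (fst x)} \<in> sets ?S" by measurable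
  have Y: "{\<omega> \<in> space M. q \<le> \<Lambda> r \<omega>} \<times> {r<..} \<in> sets ?S" if r: "0 \<le> r" for r
  proof -
    have "{\<omega> \<in> space M. q \<le> \<Lambda> r \<omega>} \<in> sets (G r)"
      using compensates_predictable_compensator(2)[OF \<Lambda> r] unfolding space_G[of r, symmetric] by measurable
    then have "(\<Union>n::nat. {\<omega> \<in> space M. q \<le> \<Lambda> r \<omega>} \<times> {r<..real n}) \<in> sets ?S"
      using predictable_rectangleI[of G, OF space_G r] by blast
    also have "(\<Union>n::nat. {\<omega> \<in> space M. q \<le> \<Lambda> r \<omega>} \<times> {r<..real n}) = {\<omega> \<in> space M. q \<le> \<Lambda> r \<omega>} \<times> {r<..}"
      using real_arch_simple by auto
    finally show ?thesis .
  qed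
  have "{x \<in> space ?S. q \<le> \<Lambda> (snd x) (fst x)} - (\<Union>r\<in>\<rat> \<inter> {0..}. {\<omega> \<in> space M. q \<le> \<Lambda> r \<omega>} \<times> {r<..}) \<in> sets ?S"
    using X Y countable_rat_nonneg by (intro sets.Diff sets.countable_UN'') auto
  also have "{x \<in> space ?S. q \<le> \<Lambda> (snd x) (fst x)} - (\<Union>r\<in>\<rat> \<inter> {0..}. {\<omega> \<in> space M. q \<le> \<Lambda> r \<omega>} \<times> {r<..})
    = {x \<in> space M \<times> {0..}. q \<le> \<Lambda> (snd x) (fst x) \<and> (\<forall>r\<in>\<rat> \<inter> {0..}. r < snd x \<longrightarrow> \<Lambda> r (fst x) < q)}"
    unfolding spS by (auto simp: not_le)
  finally show ?thesis .
qed

end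

lemma mono_on_continuous_on_Ici:
  fixes f :: "real \<Rightarrow> real"
  assumes mono: "mono_on {0..} f" and right: "\<And>t. 0 \<le> t \<Longrightarrow> continuous (at_right t) f"
    and left: "\<And>t e. 0 < t \<Longrightarrow> 0 < e \<Longrightarrow> \<exists>s\<ge>0. s < t \<and> f t - e < f s"
  shows "continuous_on {0..} f"
  unfolding continuous_on_eq_continuous_within
proof
  fix t :: real assume "t \<in> {0..}"
  then consider "t = 0" | "0 < t" by force
  then show "continuous (at t within {0..}) f"
  proof cases
    case 1
    then show ?thesis using right[of 0] by (simp add: at_within_Ici_at_right)
  next
    case 2
    have "continuous (at_left t) f"
      unfolding continuous_within
    proof (rule tendstoI)
      fix e :: real assume "0 < e"
      from left[OF 2 this] obtain s where s: "0 \<le> s" "s < t" "f t - e < f s" by blast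
      have "dist (f y) (f t) < e" if "s < y" "y < t" for y
        using mono_onD[OF mono, of s y] mono_onD[OF mono, of y t] that s by (auto simp: dist_real_def)
      then show "eventually (\<lambda>y. dist (f y) (f t) < e) (at_left t)"
        unfolding eventually_at_left[OF 2] using s by blast
    qed
    then have "isCont f t" using right[of t] 2 by (simp add: continuous_at_split)
    then show ?thesis by (rule continuous_at_imp_continuous_at_within)
  qed
qed

context immersed_time
begin

text \<open>
  The set \<open>B q\<close> contains at most one time per path, so its \<open>F\<^sub>\<infinity>\<close>-trace satisfies the hypothesis of
  the previous section and \<open>\<tau>\<close> does not charge it. By the law of \<open>\<tau>\<close>, almost no level \<open>u\<close> has its
  passage time in \<open>B q\<close>; a jump of \<open>\<Lambda>\<close> across a rational \<open>q\<close> would produce an interval of such levels.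
\<close>

lemma avoids_imp_compensator_continuous:
  assumes avoid: "avoids_stopping_times M F \<tau>"
    and \<Lambda>: "predictable_compensator M G \<tau> \<Lambda>"
  shows "AE \<omega> in M. continuous_on {0..} (\<lambda>t. \<Lambda> t \<omega>)"
proof -
  interpret L: compensated_time M G \<tau> \<Lambda>
    by unfold_locales (use sub_G mono_G random_time compensates_predictable_compensator(1)[OF \<Lambda>] in auto)
  have inc: "AE \<omega> in M. mono_on {0..} (\<lambda>t. \<Lambda> t \<omega>) \<and> (\<forall>t\<ge>0. continuous (at_right t) (\<lambda>t. \<Lambda> t \<omega>))"
    using \<Lambda> by (simp add: predictable_compensator_def increasing_process_def)
  define B where "B q = {x \<in> space M \<times> {0..}. q \<le> \<Lambda> (snd x) (fst x) \<and> (\<forall>r\<in>\<rat> \<inter> {0..}. r < snd x \<longrightarrow> \<Lambda> r (fst x) < q)}" for q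
  have B: "B q \<in> sets (predictable_sigma M G)" for q
    unfolding B_def by (rule first_passage_predictable[OF \<Lambda>])
  have "AE \<omega> in M. AE u in lborel. inverse_time \<Lambda> u \<omega> < \<infinity> \<longrightarrow> (\<omega>, enn2real (inverse_time \<Lambda> u \<omega>)) \<notin> B q" for q
  proof (rule L.AE_null_slices[OF B])
    obtain C where C: "C \<in> sets Sinf"
      and BC: "\<And>\<omega> t. \<omega> \<in> space M \<Longrightarrow> 0 < t \<Longrightarrow> ennreal t \<le> \<tau> \<omega> \<Longrightarrow> (\<omega>, t) \<in> B q \<longleftrightarrow> (\<omega>, t) \<in> C"
      using predictable_trace_before[OF B[of q]] by blast
    have tau_pos: "0 < enn2real (\<tau> \<omega>)" "ennreal (enn2real (\<tau> \<omega>)) = \<tau> \<omega>" if "\<omega> \<in> space M" "\<tau> \<omega> < \<infinity>" for \<omega>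
      using that random_time by (auto simp: random_time_def enn2real_positive_iff less_top)
    have "AE \<omega> in M. \<tau> \<omega> < \<infinity> \<longrightarrow> (\<omega>, enn2real (\<tau> \<omega>)) \<notin> C"
    proof (rule AE_not_in_if_avoids[OF avoid C])
      show "AE \<omega> in M. \<tau> \<omega> < \<infinity> \<longrightarrow> (\<omega>, enn2real (\<tau> \<omega>)) \<in> C \<longrightarrow> (\<forall>t>0. ennreal t < \<tau> \<omega> \<longrightarrow> (\<omega>, t) \<notin> C)"
        using inc AE_space
      proof eventually_elim
        case (elim \<omega>)
        show ?case
        proof (intro impI allI notI)
          fix t :: real assume fin: "\<tau> \<omega> < \<infinity>" and C1: "(\<omega>, enn2real (\<tau> \<omega>)) \<in> C" and t: "0 < t" "ennreal t < \<tau> \<omega>"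
            and C2: "(\<omega>, t) \<in> C"
          note p = tau_pos[OF elim(2) fin]
          have B1: "(\<omega>, enn2real (\<tau> \<omega>)) \<in> B q" using BC[OF elim(2) p(1)] p(2) C1 by simp
          have B2: "(\<omega>, t) \<in> B q" using BC[OF elim(2) t(1)] t(2) C2 by simp
          have "t < enn2real (\<tau> \<omega>)" using t p by (metis ennreal_less_iff less_imp_le)
          then obtain r where r: "r \<in> \<rat>" "t < r" "r < enn2real (\<tau> \<omega>)" using Rats_dense_in_real by blast
          have "q \<le> \<Lambda> t \<omega>" using B2 by (simp add: B_def)
          also have "\<dots> \<le> \<Lambda> r \<omega>" using elim(1) r t by (auto simp: mono_on_def)
          also have "\<dots> < q" using B1 r t by (auto simp: B_def)
          finally show False by simp
        qed
      qed
    qed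
    then show "AE \<omega> in M. \<tau> \<omega> < \<infinity> \<longrightarrow> (\<omega>, enn2real (\<tau> \<omega>)) \<notin> B q"
      using AE_space
    proof eventually_elim
      case (elim \<omega>)
      then show ?case using BC[OF elim(2) tau_pos(1)] tau_pos(2) by auto
    qed
  qed
  then have "AE \<omega> in M. \<forall>q\<in>\<rat>. AE u in lborel. inverse_time \<Lambda> u \<omega> < \<infinity> \<longrightarrow> (\<omega>, enn2real (inverse_time \<Lambda> u \<omega>)) \<notin> B q"
    using countable_rat by (intro AE_ball_countable') auto
  then show ?thesis
    using inc L.AE_A_0 AE_space
  proof eventually_elim
    case (elim \<omega>)
    have mono: "\<Lambda> s \<omega> \<le> \<Lambda> t \<omega>" if "0 \<le> s" "s \<le> t" for s t using elim(2) that by (auto simp: mono_on_def)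
    show ?case
    proof (rule mono_on_continuous_on_Ici)
      fix t e :: real assume t: "0 < t" and e: "0 < e"
      show "\<exists>s\<ge>0. s < t \<and> \<Lambda> t \<omega> - e < \<Lambda> s \<omega>"
      proof (rule ccontr)
        assume neg: "\<not> ?thesis"
        define x where "x = \<Lambda> t \<omega> - e"
        have below: "\<Lambda> s \<omega> \<le> x" if "0 \<le> s" "s < t" for s using neg that by (force simp: x_def)
        have x: "0 \<le> x" using below[of 0] t elim(3) by simp
        have xt: "x < \<Lambda> t \<omega>" using e by (simp add: x_def)
        obtain q where q: "q \<in> \<rat>" "x < q" "q < \<Lambda> t \<omega>" using Rats_dense_in_real[OF xt] by blast
        have inB: "(\<omega>, t) \<in> B q"
          using q t elim(4) by (auto simp: B_def intro: le_less_trans[OF below])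
        have "AE u in lborel. u \<notin> {x<..\<Lambda> t \<omega>}"
          using elim(1)[rule_format, OF q(1)]
        proof eventually_elim
          case (elim u)
          show ?case
          proof
            assume "u \<in> {x<..\<Lambda> t \<omega>}"
            then have "inverse_time \<Lambda> u \<omega> = ennreal t"
              using t x by (intro inverse_time_eqI mono) (auto intro: le_less_trans[OF below])
            then show False using elim inB t by simp
          qed
        qed
        then have "{x<..\<Lambda> t \<omega>} \<in> null_sets lborel" by (subst (asm) AE_iff_null_sets[symmetric]) auto
        then show False using xt by (simp add: null_sets_def)
      qed
    qed (use elim(2) in auto)
  qed
qed

end

section \<open>Jumps of martingales at the random time\<close>

context prob_space
begin

text \<open>
  Boundedness is only required almost surely because conditional expectations are determined only up to
  null sets.
\<close>

definition essentially_bounded :: "('a \<Rightarrow> real) \<Rightarrow> bool" where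
  "essentially_bounded f \<longleftrightarrow> f \<in> borel_measurable M \<and> (\<exists>K. AE \<omega> in M. \<bar>f \<omega>\<bar> \<le> K)"

lemma essentially_bounded_measurable: "essentially_bounded f \<Longrightarrow> f \<in> borel_measurable M"
  by (simp add: essentially_bounded_def)

lemma essentially_boundedI:
  "f \<in> borel_measurable M \<Longrightarrow> (\<And>\<omega>. \<omega> \<in> space M \<Longrightarrow> \<bar>f \<omega>\<bar> \<le> K) \<Longrightarrow> essentially_bounded f"
  unfolding essentially_bounded_def by auto

lemma essentially_bounded_integrable: "essentially_bounded f \<Longrightarrow> integrable M f"
  unfolding essentially_bounded_def by (auto intro: integrable_const_bound simp: real_norm_def[symmetric] simp del: real_norm_def)

lemma essentially_bounded_add:
  assumes "essentially_bounded f" "essentially_bounded g"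
  shows "essentially_bounded (\<lambda>\<omega>. f \<omega> + g \<omega>)"
proof -
  obtain K L where "AE \<omega> in M. \<bar>f \<omega>\<bar> \<le> K" "AE \<omega> in M. \<bar>g \<omega>\<bar> \<le> L"
    using assms by (auto simp: essentially_bounded_def)
  then have "AE \<omega> in M. \<bar>f \<omega> + g \<omega>\<bar> \<le> K + L" by eventually_elim linarith
  then show ?thesis using assms by (auto simp: essentially_bounded_def)
qed

lemma essentially_bounded_mult:
  assumes "essentially_bounded f" "essentially_bounded g"
  shows "essentially_bounded (\<lambda>\<omega>. f \<omega> * g \<omega>)"
proof -
  obtain K L where "AE \<omega> in M. \<bar>f \<omega>\<bar> \<le> K" "AE \<omega> in M. \<bar>g \<omega>\<bar> \<le> L"
    using assms by (auto simp: essentially_bounded_def)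
  then have "AE \<omega> in M. \<bar>f \<omega> * g \<omega>\<bar> \<le> K * L"
    by eventually_elim (auto simp: abs_mult intro!: mult_mono)
  then show ?thesis using assms by (auto simp: essentially_bounded_def)
qed

lemma essentially_bounded_const: "essentially_bounded (\<lambda>_. a)"
  by (rule essentially_boundedI[where K="\<bar>a\<bar>"]) auto

lemma essentially_bounded_indicator: "A \<in> sets M \<Longrightarrow> essentially_bounded (indicator A)"
  by (rule essentially_boundedI[where K=1]) (auto split: split_indicator)

lemma essentially_bounded_diff:
  assumes "essentially_bounded f" "essentially_bounded g"
  shows "essentially_bounded (\<lambda>\<omega>. f \<omega> - g \<omega>)"
  using essentially_bounded_add[OF assms(1) essentially_bounded_mult[OF essentially_bounded_const[of "-1"] assms(2)]]
  by simp

lemma essentially_bounded_power2: "essentially_bounded f \<Longrightarrow> essentially_bounded (\<lambda>\<omega>. (f \<omega>)\<^sup>2)"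
  unfolding power2_eq_square by (rule essentially_bounded_mult)

lemma essentially_bounded_cond_exp:
  assumes F: "subalgebra M F" and f: "essentially_bounded f"
  shows "essentially_bounded (real_cond_exp M F f)"
proof -
  interpret sigma_finite_subalgebra M F by (rule sigma_finite_subalgebraI[OF F])
  obtain K where K: "AE \<omega> in M. \<bar>f \<omega>\<bar> \<le> K" using f by (auto simp: essentially_bounded_def)
  note i = essentially_bounded_integrable[OF f]
  have "AE \<omega> in M. real_cond_exp M F f \<omega> \<le> K"
    by (rule real_cond_exp_le_c[OF i]) (use K in eventually_elim, auto)
  moreover have "AE \<omega> in M. real_cond_exp M F f \<omega> \<ge> - K"
    by (rule real_cond_exp_ge_c[OF i]) (use K in eventually_elim, auto)
  ultimately have "AE \<omega> in M. \<bar>real_cond_exp M F f \<omega>\<bar> \<le> K" by eventually_elim auto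
  then show ?thesis by (auto simp: essentially_bounded_def)
qed

lemma integral_square_cond_exp_diff:
  assumes F: "subalgebra M F" and f: "essentially_bounded f"
  shows "(\<integral>\<omega>. (f \<omega> - real_cond_exp M F f \<omega>)\<^sup>2 \<partial>M) = (\<integral>\<omega>. (f \<omega>)\<^sup>2 \<partial>M) - (\<integral>\<omega>. (real_cond_exp M F f \<omega>)\<^sup>2 \<partial>M)"
proof -
  interpret sigma_finite_subalgebra M F by (rule sigma_finite_subalgebraI[OF F])
  let ?X = "real_cond_exp M F f"
  have X: "essentially_bounded ?X" by (rule essentially_bounded_cond_exp[OF F f])
  note i = essentially_bounded_integrable
  have "(\<integral>\<omega>. ?X \<omega> * f \<omega> \<partial>M) = (\<integral>\<omega>. ?X \<omega> * ?X \<omega> \<partial>M)"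
    by (rule real_cond_exp_intg(2)[symmetric])
      (auto intro!: i essentially_bounded_mult X f essentially_bounded_measurable[OF f])
  moreover have "(\<integral>\<omega>. (f \<omega> - ?X \<omega>)\<^sup>2 \<partial>M) = (\<integral>\<omega>. (f \<omega>)\<^sup>2 - 2 * (?X \<omega> * f \<omega>) + (?X \<omega>)\<^sup>2 \<partial>M)"
    by (rule Bochner_Integration.integral_cong) (auto simp: power2_eq_square algebra_simps)
  moreover have "\<dots> = (\<integral>\<omega>. (f \<omega>)\<^sup>2 \<partial>M) - 2 * (\<integral>\<omega>. ?X \<omega> * f \<omega> \<partial>M) + (\<integral>\<omega>. (?X \<omega>)\<^sup>2 \<partial>M)"
    using i[OF essentially_bounded_power2[OF f]] i[OF essentially_bounded_mult[OF X f]] i[OF essentially_bounded_power2[OF X]]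
    by simp
  ultimately show ?thesis by (simp add: power2_eq_square)
qed

end

definition grid :: "real \<Rightarrow> nat \<Rightarrow> nat \<Rightarrow> real" where
  "grid c n k = c * real k / real (Suc n)"

lemma grid_nonneg: "0 \<le> c \<Longrightarrow> 0 \<le> grid c n k"
  by (simp add: grid_def)

lemma grid_Suc: "grid c n (Suc k) = grid c n k + c / real (Suc n)"
  by (simp add: grid_def add_divide_distrib[symmetric] distrib_left add.commute)

lemma grid_mono: "0 \<le> c \<Longrightarrow> j \<le> k \<Longrightarrow> grid c n j \<le> grid c n k"
  by (simp add: grid_def divide_right_mono mult_left_mono)

lemma grid_0 [simp]: "grid c n 0 = 0"
  by (simp add: grid_def)

lemma grid_last [simp]: "grid c n (Suc n) = c"
  by (simp add: grid_def)

lemma grid_le: "0 \<le> c \<Longrightarrow> k \<le> Suc n \<Longrightarrow> grid c n k \<le> c"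
  using grid_mono[of c k "Suc n" n] by simp

lemma mesh_tendsto_0: "(\<lambda>n. c / real (Suc n)) \<longlonglongrightarrow> 0"
  by real_asymp

context prob_filtration_time
begin

definition slot :: "real \<Rightarrow> nat \<Rightarrow> nat \<Rightarrow> 'a set" where
  "slot c n k = {\<omega> \<in> space M. ennreal (grid c n k) < \<tau> \<omega> \<and> \<tau> \<omega> \<le> ennreal (grid c n (Suc k))}"

lemma slot_sets [measurable]: "slot c n k \<in> sets M"
  unfolding slot_def by measurable

lemma slot_disjoint:
  assumes "0 \<le> c" "\<omega> \<in> slot c n j" "\<omega> \<in> slot c n k" shows "j = k"
proof -
  have *: False if "\<omega> \<in> slot c n j" "\<omega> \<in> slot c n k" "j < k" for j k
  proof -
    have "ennreal (grid c n (Suc j)) \<le> ennreal (grid c n k)"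
      using that(3) assms(1) by (intro ennreal_leI grid_mono) auto
    then show False using that by (auto simp: slot_def)
  qed
  show ?thesis using *[of j k] *[of k j] assms(2,3) by (cases j k rule: linorder_cases) auto
qed

definition jump :: "real \<Rightarrow> nat \<Rightarrow> nat \<Rightarrow> ('a \<Rightarrow> real) \<Rightarrow> 'a \<Rightarrow> real" where
  "jump c n k \<xi> \<omega> =
     real_cond_exp M (F (grid c n (Suc k))) \<xi> \<omega> - real_cond_exp M (F (grid c n k)) \<xi> \<omega>"

text \<open>
  The second moment of the increment of the martingale closed by \<open>\<xi>\<close> over the grid interval that contains
  \<open>\<tau>\<close>. It tests for a jump at \<open>\<tau>\<close> without any choice of paths.
\<close>

definition jump_energy :: "real \<Rightarrow> nat \<Rightarrow> ('a \<Rightarrow> real) \<Rightarrow> real" where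
  "jump_energy c n \<xi> = (\<Sum>k\<le>n. \<integral>\<omega>. indicator (slot c n k) \<omega> * (jump c n k \<xi> \<omega>)\<^sup>2 \<partial>M)"

lemma essentially_bounded_cond_F: "essentially_bounded \<xi> \<Longrightarrow> essentially_bounded (real_cond_exp M (F t) \<xi>)"
  by (rule essentially_bounded_cond_exp[OF sub_F])

lemma essentially_bounded_jump: "essentially_bounded \<xi> \<Longrightarrow> essentially_bounded (jump c n k \<xi>)"
  unfolding jump_def by (intro essentially_bounded_diff essentially_bounded_cond_F)

lemma integrable_jump_energy:
  "essentially_bounded \<xi> \<Longrightarrow> integrable M (\<lambda>\<omega>. indicator (slot c n k) \<omega> * (jump c n k \<xi> \<omega>)\<^sup>2)"
  by (intro essentially_bounded_integrable essentially_bounded_mult essentially_bounded_indicator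
      essentially_bounded_power2 essentially_bounded_jump slot_sets)

lemma jump_energy_nonneg: "0 \<le> jump_energy c n \<xi>"
  unfolding jump_energy_def by (intro sum_nonneg Bochner_Integration.integral_nonneg) auto

lemma cond_F_tower:
  assumes "s \<le> t" "integrable M \<xi>"
  shows "AE \<omega> in M. real_cond_exp M (F s) (real_cond_exp M (F t) \<xi>) \<omega> = real_cond_exp M (F s) \<xi> \<omega>"
proof -
  interpret sigma_finite_subalgebra M "F s" by (rule sigma_finite_subalg)
  have "subalgebra (F t) (F s)" using mono_F[OF assms(1)] by (simp add: subalgebra_def space_F)
  from real_cond_exp_nested_subalg[OF sub_F this assms(2)] show ?thesis .
qed

text \<open>
  Discarding the indicators leaves the sum of the squared increments of a martingale, which telescopes by
  orthogonality. This uniform bound is what makes the absence of jumps stable under limits.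
\<close>

lemma jump_energy_le:
  assumes c: "0 \<le> c" and \<xi>: "essentially_bounded \<xi>"
  shows "jump_energy c n \<xi> \<le> (\<integral>\<omega>. (\<xi> \<omega>)\<^sup>2 \<partial>M)"
proof -
  define X where "X k = real_cond_exp M (F (grid c n k)) \<xi>" for k
  define q where "q k = (\<integral>\<omega>. (X k \<omega>)\<^sup>2 \<partial>M)" for k
  have X: "essentially_bounded (X k)" for k unfolding X_def by (rule essentially_bounded_cond_F[OF \<xi>])
  have q0: "0 \<le> q k" for k unfolding q_def by simp
  have step: "(\<integral>\<omega>. indicator (slot c n k) \<omega> * (jump c n k \<xi> \<omega>)\<^sup>2 \<partial>M) \<le> q (Suc k) - q k" for k
  proof -
    have tower: "AE \<omega> in M. real_cond_exp M (F (grid c n k)) (X (Suc k)) \<omega> = X k \<omega>"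
      unfolding X_def
      by (rule cond_F_tower) (use c \<xi> in \<open>auto simp: grid_mono intro: essentially_bounded_integrable\<close>)
    have "(\<integral>\<omega>. indicator (slot c n k) \<omega> * (jump c n k \<xi> \<omega>)\<^sup>2 \<partial>M) \<le> (\<integral>\<omega>. (jump c n k \<xi> \<omega>)\<^sup>2 \<partial>M)"
      by (rule integral_mono[OF integrable_jump_energy[OF \<xi>]
            essentially_bounded_integrable[OF essentially_bounded_power2[OF essentially_bounded_jump[OF \<xi>]]]])
        (auto split: split_indicator)
    also have "\<dots> = (\<integral>\<omega>. (X (Suc k) \<omega> - real_cond_exp M (F (grid c n k)) (X (Suc k)) \<omega>)\<^sup>2 \<partial>M)"
    proof (rule integral_cong_AE)
      show "AE \<omega> in M. (jump c n k \<xi> \<omega>)\<^sup>2 = (X (Suc k) \<omega> - real_cond_exp M (F (grid c n k)) (X (Suc k)) \<omega>)\<^sup>2"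
        using tower by eventually_elim (simp add: jump_def X_def)
    qed (auto simp: jump_def X_def)
    also have "\<dots> = q (Suc k) - (\<integral>\<omega>. (real_cond_exp M (F (grid c n k)) (X (Suc k)) \<omega>)\<^sup>2 \<partial>M)"
      unfolding q_def by (rule integral_square_cond_exp_diff[OF sub_F X])
    also have "(\<integral>\<omega>. (real_cond_exp M (F (grid c n k)) (X (Suc k)) \<omega>)\<^sup>2 \<partial>M) = q k"
      unfolding q_def
    proof (rule integral_cong_AE)
      show "AE \<omega> in M. (real_cond_exp M (F (grid c n k)) (X (Suc k)) \<omega>)\<^sup>2 = (X k \<omega>)\<^sup>2"
        using tower by eventually_elim simp
    qed (auto simp: X_def)
    finally show ?thesis .
  qed
  have "jump_energy c n \<xi> \<le> (\<Sum>k\<le>n. q (Suc k) - q k)"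
    unfolding jump_energy_def by (rule sum_mono) (rule step)
  also have "\<dots> = q (Suc n) - q 0" using sum_telescope[of "\<lambda>k. - q k" n] by (simp add: algebra_simps)
  also have "\<dots> \<le> q (Suc n)" using q0 by simp
  also have "\<dots> \<le> (\<integral>\<omega>. (\<xi> \<omega>)\<^sup>2 \<partial>M)"
  proof -
    have "0 \<le> (\<integral>\<omega>. (\<xi> \<omega> - X (Suc n) \<omega>)\<^sup>2 \<partial>M)" by simp
    then show ?thesis using integral_square_cond_exp_diff[OF sub_F \<xi>] unfolding q_def X_def by simp
  qed
  finally show ?thesis .
qed

lemma jump_lincomb:
  assumes "essentially_bounded \<xi>" "essentially_bounded \<zeta>"
  shows "AE \<omega> in M. jump c n k (\<lambda>\<omega>. a * \<xi> \<omega> + b * \<zeta> \<omega>) \<omega> = a * jump c n k \<xi> \<omega> + b * jump c n k \<zeta> \<omega>"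
proof -
  have *: "AE \<omega> in M. real_cond_exp M (F t) (\<lambda>\<omega>. a * \<xi> \<omega> + b * \<zeta> \<omega>) \<omega>
     = a * real_cond_exp M (F t) \<xi> \<omega> + b * real_cond_exp M (F t) \<zeta> \<omega>" for t
  proof -
    interpret sigma_finite_subalgebra M "F t" by (rule sigma_finite_subalg)
    have i: "integrable M \<xi>" "integrable M \<zeta>" using assms by (auto intro: essentially_bounded_integrable)
    have "AE \<omega> in M. real_cond_exp M (F t) (\<lambda>\<omega>. a * \<xi> \<omega> + b * \<zeta> \<omega>) \<omega>
      = real_cond_exp M (F t) (\<lambda>\<omega>. a * \<xi> \<omega>) \<omega> + real_cond_exp M (F t) (\<lambda>\<omega>. b * \<zeta> \<omega>) \<omega>"
      using i by (intro real_cond_exp_add) auto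
    with real_cond_exp_cmult[OF i(1), of a] real_cond_exp_cmult[OF i(2), of b]
    show ?thesis by eventually_elim simp
  qed
  show ?thesis
    using *[of "grid c n k"] *[of "grid c n (Suc k)"]
    by eventually_elim (simp add: jump_def algebra_simps)
qed

lemma jump_energy_lincomb_le:
  assumes \<xi>: "essentially_bounded \<xi>" and \<zeta>: "essentially_bounded \<zeta>"
  shows "jump_energy c n (\<lambda>\<omega>. a * \<xi> \<omega> + b * \<zeta> \<omega>) \<le> 2 * a\<^sup>2 * jump_energy c n \<xi> + 2 * b\<^sup>2 * jump_energy c n \<zeta>"
proof -
  let ?w = "\<lambda>k \<xi> \<omega>. indicator (slot c n k) \<omega> * (jump c n k \<xi> \<omega>)\<^sup>2"
  have lin: "essentially_bounded (\<lambda>\<omega>. a * \<xi> \<omega> + b * \<zeta> \<omega>)"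
    by (intro essentially_bounded_add essentially_bounded_mult essentially_bounded_const \<xi> \<zeta>)
  have "(\<integral>\<omega>. ?w k (\<lambda>\<omega>. a * \<xi> \<omega> + b * \<zeta> \<omega>) \<omega> \<partial>M)
     \<le> 2 * a\<^sup>2 * (\<integral>\<omega>. ?w k \<xi> \<omega> \<partial>M) + 2 * b\<^sup>2 * (\<integral>\<omega>. ?w k \<zeta> \<omega> \<partial>M)" for k
  proof -
    note i = integrable_jump_energy[OF \<xi>, of c n k] integrable_jump_energy[OF \<zeta>, of c n k]
    have "(\<integral>\<omega>. ?w k (\<lambda>\<omega>. a * \<xi> \<omega> + b * \<zeta> \<omega>) \<omega> \<partial>M) \<le> (\<integral>\<omega>. 2 * a\<^sup>2 * ?w k \<xi> \<omega> + 2 * b\<^sup>2 * ?w k \<zeta> \<omega> \<partial>M)"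
    proof (rule integral_mono_AE[OF integrable_jump_energy[OF lin]])
      show "integrable M (\<lambda>\<omega>. 2 * a\<^sup>2 * ?w k \<xi> \<omega> + 2 * b\<^sup>2 * ?w k \<zeta> \<omega>)" using i by auto
      show "AE \<omega> in M. ?w k (\<lambda>\<omega>. a * \<xi> \<omega> + b * \<zeta> \<omega>) \<omega> \<le> 2 * a\<^sup>2 * ?w k \<xi> \<omega> + 2 * b\<^sup>2 * ?w k \<zeta> \<omega>"
        using jump_lincomb[OF \<xi> \<zeta>, of c n k a b]
      proof eventually_elim
        case (elim \<omega>)
        have "(x + y)\<^sup>2 \<le> 2 * x\<^sup>2 + 2 * y\<^sup>2" for x y :: real
          using sum_squares_bound[of x y] by (simp add: power2_sum)
        from this[of "a * jump c n k \<xi> \<omega>" "b * jump c n k \<zeta> \<omega>"] show ?case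
          unfolding elim by (auto split: split_indicator simp: power_mult_distrib)
      qed
    qed
    also have "\<dots> = 2 * a\<^sup>2 * (\<integral>\<omega>. ?w k \<xi> \<omega> \<partial>M) + 2 * b\<^sup>2 * (\<integral>\<omega>. ?w k \<zeta> \<omega> \<partial>M)"
      using i by simp
    finally show ?thesis .
  qed
  then have "jump_energy c n (\<lambda>\<omega>. a * \<xi> \<omega> + b * \<zeta> \<omega>) \<le>
    (\<Sum>k\<le>n. 2 * a\<^sup>2 * (\<integral>\<omega>. ?w k \<xi> \<omega> \<partial>M) + 2 * b\<^sup>2 * (\<integral>\<omega>. ?w k \<zeta> \<omega> \<partial>M))"
    unfolding jump_energy_def by (rule sum_mono)
  also have "\<dots> = 2 * a\<^sup>2 * jump_energy c n \<xi> + 2 * b\<^sup>2 * jump_energy c n \<zeta>"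
    by (simp add: jump_energy_def sum.distrib sum_distrib_left)
  finally show ?thesis .
qed

definition no_jump :: "real \<Rightarrow> ('a \<Rightarrow> real) \<Rightarrow> bool" where
  "no_jump c \<xi> \<longleftrightarrow> essentially_bounded \<xi> \<and> (\<lambda>n. jump_energy c n \<xi>) \<longlonglongrightarrow> 0"

lemma no_jump_lincomb:
  assumes "no_jump c \<xi>" "no_jump c \<zeta>"
  shows "no_jump c (\<lambda>\<omega>. a * \<xi> \<omega> + b * \<zeta> \<omega>)"
  unfolding no_jump_def
proof
  note eb = assms[unfolded no_jump_def, THEN conjunct1]
  show "essentially_bounded (\<lambda>\<omega>. a * \<xi> \<omega> + b * \<zeta> \<omega>)"
    by (intro essentially_bounded_add essentially_bounded_mult essentially_bounded_const eb)
  have "(\<lambda>n. 2 * a\<^sup>2 * jump_energy c n \<xi> + 2 * b\<^sup>2 * jump_energy c n \<zeta>) \<longlonglongrightarrow> 2 * a\<^sup>2 * 0 + 2 * b\<^sup>2 * 0"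
    using assms by (intro tendsto_intros) (auto simp: no_jump_def)
  then show "(\<lambda>n. jump_energy c n (\<lambda>\<omega>. a * \<xi> \<omega> + b * \<zeta> \<omega>)) \<longlonglongrightarrow> 0"
    by (rule_tac tendsto_sandwich[of "\<lambda>_. 0", rotated 3])
      (auto simp: jump_energy_nonneg jump_energy_lincomb_le[OF eb])
qed

lemma no_jump_L2_limit:
  assumes c: "0 \<le> c" and \<xi>: "essentially_bounded \<xi>" and \<zeta>: "\<And>m. no_jump c (\<zeta> m)"
    and lim: "(\<lambda>m. \<integral>\<omega>. (\<xi> \<omega> - \<zeta> m \<omega>)\<^sup>2 \<partial>M) \<longlonglongrightarrow> 0"
  shows "no_jump c \<xi>"
  unfolding no_jump_def
proof (rule conjI[OF \<xi>], rule LIMSEQ_I)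
  fix e :: real assume e: "0 < e"
  have eb: "essentially_bounded (\<zeta> m)" for m using \<zeta> by (simp add: no_jump_def)
  obtain m where m: "(\<integral>\<omega>. (\<xi> \<omega> - \<zeta> m \<omega>)\<^sup>2 \<partial>M) < e / 4"
    using order_tendstoD(2)[OF lim, of "e / 4"] e by (auto simp: eventually_sequentially)
  have "(\<lambda>n. jump_energy c n (\<zeta> m)) \<longlonglongrightarrow> 0" using \<zeta> by (simp add: no_jump_def)
  then obtain n0 where n0: "\<And>n. n0 \<le> n \<Longrightarrow> jump_energy c n (\<zeta> m) < e / 4"
    using order_tendstoD(2)[of "\<lambda>n. jump_energy c n (\<zeta> m)" 0 sequentially "e / 4"] e by (auto simp: eventually_sequentially)
  have "norm (jump_energy c n \<xi> - 0) < e" if "n0 \<le> n" for n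
  proof -
    let ?d = "\<lambda>\<omega>. \<xi> \<omega> - \<zeta> m \<omega>"
    have d: "essentially_bounded ?d" by (intro essentially_bounded_diff \<xi> eb)
    have "jump_energy c n \<xi> \<le> 2 * jump_energy c n ?d + 2 * jump_energy c n (\<zeta> m)"
      using jump_energy_lincomb_le[OF d eb[of m], of c n 1 1] by simp
    also have "jump_energy c n ?d \<le> (\<integral>\<omega>. (?d \<omega>)\<^sup>2 \<partial>M)" by (rule jump_energy_le[OF c d])
    finally show ?thesis using m n0[OF that] jump_energy_nonneg[of c n \<xi>] by simp
  qed
  then show "\<exists>n0. \<forall>n\<ge>n0. norm (jump_energy c n \<xi> - 0) < e" by blast
qed

text \<open>
  At most one grid interval contains \<open>\<tau>\<close>, so the energy is the mean of a single squared increment, bounded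
  and tending to \<open>0\<close> by uniform continuity of the path.
\<close>

lemma no_jump_continuous_version:
  assumes c: "0 \<le> c" and \<xi>: "essentially_bounded \<xi>"
    and Y: "\<And>t. 0 \<le> t \<Longrightarrow> AE \<omega> in M. real_cond_exp M (F t) \<xi> \<omega> = Y t \<omega>"
    and Ym [measurable]: "\<And>t. 0 \<le> t \<Longrightarrow> Y t \<in> borel_measurable M"
    and bound: "\<And>t \<omega>. 0 \<le> t \<Longrightarrow> \<omega> \<in> space M \<Longrightarrow> \<bar>Y t \<omega>\<bar> \<le> K"
    and cont: "AE \<omega> in M. continuous_on {0..c} (\<lambda>t. Y t \<omega>)"
  shows "no_jump c \<xi>"
  unfolding no_jump_def
proof (rule conjI[OF \<xi>])
  define g where "g n \<omega> = (\<Sum>k\<le>n. indicator (slot c n k) \<omega> * (Y (grid c n (Suc k)) \<omega> - Y (grid c n k) \<omega>)\<^sup>2)" for n \<omega>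
  have gn: "0 \<le> grid c n k" for n k by (rule grid_nonneg[OF c])
  have Yg [measurable]: "Y (grid c n k) \<in> borel_measurable M" for n k by (rule Ym[OF gn])
  have i: "integrable M (\<lambda>\<omega>. indicator (slot c n k) \<omega> * (Y (grid c n (Suc k)) \<omega> - Y (grid c n k) \<omega>)\<^sup>2)" for n k
    by (intro essentially_bounded_integrable essentially_bounded_mult essentially_bounded_indicator
      essentially_bounded_power2 essentially_bounded_diff slot_sets essentially_boundedI[where K=K] Yg bound gn)
  have eq: "jump_energy c n \<xi> = (\<integral>\<omega>. g n \<omega> \<partial>M)" for n
  proof -
    have "jump_energy c n \<xi> = (\<Sum>k\<le>n. \<integral>\<omega>. indicator (slot c n k) \<omega> * (Y (grid c n (Suc k)) \<omega> - Y (grid c n k) \<omega>)\<^sup>2 \<partial>M)"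
      unfolding jump_energy_def
    proof (intro sum.cong refl integral_cong_AE)
      fix k
      show "AE \<omega> in M. indicator (slot c n k) \<omega> * (jump c n k \<xi> \<omega>)\<^sup>2 =
        indicator (slot c n k) \<omega> * (Y (grid c n (Suc k)) \<omega> - Y (grid c n k) \<omega>)\<^sup>2"
        using Y[OF gn, of n k] Y[OF gn, of n "Suc k"] by eventually_elim (simp add: jump_def)
    qed (auto simp: jump_def)
    also have "\<dots> = (\<integral>\<omega>. g n \<omega> \<partial>M)"
      unfolding g_def by (rule Bochner_Integration.integral_sum[symmetric]) (rule i)
    finally show ?thesis .
  qed
  have g_single: "g n \<omega> = 0 \<or> (\<exists>k\<le>n. g n \<omega> = (Y (grid c n (Suc k)) \<omega> - Y (grid c n k) \<omega>)\<^sup>2)" for n \<omega>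
  proof (cases "\<exists>k\<le>n. \<omega> \<in> slot c n k")
    case True
    then obtain k where k: "k \<le> n" "\<omega> \<in> slot c n k" by blast
    have "g n \<omega> = (\<Sum>j\<in>{k}. indicator (slot c n j) \<omega> * (Y (grid c n (Suc j)) \<omega> - Y (grid c n j) \<omega>)\<^sup>2)"
      unfolding g_def
    proof (rule sum.mono_neutral_right)
      show "\<forall>j\<in>{..n} - {k}. indicator (slot c n j) \<omega> * (Y (grid c n (Suc j)) \<omega> - Y (grid c n j) \<omega>)\<^sup>2 = 0"
      proof
        fix j assume "j \<in> {..n} - {k}"
        then have "\<omega> \<notin> slot c n j" using slot_disjoint[OF c k(2), of j] by auto
        then show "indicator (slot c n j) \<omega> * (Y (grid c n (Suc j)) \<omega> - Y (grid c n j) \<omega>)\<^sup>2 = 0" by simp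
      qed
    qed (use k in auto)
    also have "\<dots> = (Y (grid c n (Suc k)) \<omega> - Y (grid c n k) \<omega>)\<^sup>2" using k by simp
    finally have "g n \<omega> = (Y (grid c n (Suc k)) \<omega> - Y (grid c n k) \<omega>)\<^sup>2" .
    then show ?thesis using k by auto
  next
    case False
    then have "g n \<omega> = 0" unfolding g_def by (intro sum.neutral) auto
    then show ?thesis ..
  qed
  have "(\<lambda>n. \<integral>\<omega>. g n \<omega> \<partial>M) \<longlonglongrightarrow> (\<integral>\<omega>. 0 \<partial>M)"
  proof (rule integral_dominated_convergence[where w="\<lambda>_. (2 * K)\<^sup>2"])
    show "g n \<in> borel_measurable M" for n unfolding g_def by measurable
    show "AE \<omega> in M. norm (g n \<omega>) \<le> (2 * K)\<^sup>2" for n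
    proof (rule AE_I2)
      fix \<omega> assume \<omega>: "\<omega> \<in> space M"
      have "(Y (grid c n (Suc k)) \<omega> - Y (grid c n k) \<omega>)\<^sup>2 \<le> (2 * K)\<^sup>2" for k
        using bound[OF gn \<omega>, of n k] bound[OF gn \<omega>, of n "Suc k"] by (intro abs_le_square_iff[THEN iffD1]) linarith
      then show "norm (g n \<omega>) \<le> (2 * K)\<^sup>2" using g_single[of n \<omega>] by auto
    qed
    show "AE \<omega> in M. (\<lambda>n. g n \<omega>) \<longlonglongrightarrow> 0"
      using cont
    proof eventually_elim
      case (elim \<omega>)
      have uc: "uniformly_continuous_on {0..c} (\<lambda>t. Y t \<omega>)"
        by (rule compact_uniformly_continuous[OF elim]) simp
      show ?case
      proof (rule LIMSEQ_I)
        fix e :: real assume e: "0 < e"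
        then have "0 < sqrt e" by simp
        from uc[unfolded uniformly_continuous_on_def, rule_format, OF this] obtain d where d: "0 < d"
          "\<And>s t. s \<in> {0..c} \<Longrightarrow> t \<in> {0..c} \<Longrightarrow> dist t s < d \<Longrightarrow> dist (Y t \<omega>) (Y s \<omega>) < sqrt e" by blast
        obtain n0 where n0: "\<And>n. n0 \<le> n \<Longrightarrow> c / real (Suc n) < d"
          using order_tendstoD(2)[OF mesh_tendsto_0[of c] d(1)] by (auto simp: eventually_sequentially)
        have "norm (g n \<omega> - 0) < e" if "n0 \<le> n" for n
        proof -
          have "(Y (grid c n (Suc k)) \<omega> - Y (grid c n k) \<omega>)\<^sup>2 < e" if "k \<le> n" for k
          proof -
            have "\<bar>Y (grid c n (Suc k)) \<omega> - Y (grid c n k) \<omega>\<bar> < sqrt e"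
            proof -
              have "grid c n k \<in> {0..c}" "grid c n (Suc k) \<in> {0..c}"
                using gn grid_le[OF c] that by auto
              moreover have "dist (grid c n (Suc k)) (grid c n k) < d"
                using n0[OF \<open>n0 \<le> n\<close>] c unfolding grid_Suc by (simp add: dist_real_def)
              ultimately show ?thesis using d(2) by (simp add: dist_real_def)
            qed
            then have "\<bar>Y (grid c n (Suc k)) \<omega> - Y (grid c n k) \<omega>\<bar>\<^sup>2 < (sqrt e)\<^sup>2"
              by (intro power_strict_mono) auto
            then show ?thesis using e by simp
          qed
          moreover have "0 \<le> g n \<omega>" unfolding g_def by (intro sum_nonneg) auto
          ultimately show ?thesis using g_single[of n \<omega>] e by auto
        qed
        then show "\<exists>n0. \<forall>n\<ge>n0. norm (g n \<omega> - 0) < e" by blast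
      qed
    qed
  qed auto
  then show "(\<lambda>n. jump_energy c n \<xi>) \<longlonglongrightarrow> 0" by (simp add: eq)
qed

lemma no_jump_indicator_sigma_sets:
  assumes c: "0 \<le> c" and E: "Int_stable E" "E \<subseteq> sets M"
    and basic: "\<And>A. A \<in> E \<Longrightarrow> no_jump c (indicator A)" and space: "no_jump c (\<lambda>_. 1)"
    and D: "D \<in> sigma_sets (space M) E"
  shows "no_jump c (indicator D)"
proof -
  have sM: "sigma_sets (space M) E \<subseteq> sets M" using E(2) by (rule sets.sigma_sets_subset)
  have sp: "E \<subseteq> Pow (space M)" using E(2) sets.sets_into_space by auto
  have zero: "no_jump c (\<lambda>_. 0)" using no_jump_lincomb[OF space space, of 0 0] by simp
  have cong: "no_jump c \<zeta>" if "no_jump c \<xi>" "essentially_bounded \<zeta>" "\<And>\<omega>. \<omega> \<in> space M \<Longrightarrow> \<xi> \<omega> = \<zeta> \<omega>" for \<xi> \<zeta>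
    by (rule no_jump_L2_limit[OF c that(2) that(1)])
      (use that(3) in \<open>simp cong: Bochner_Integration.integral_cong\<close>)
  show ?thesis
    using E(1) sp D
  proof (induction rule: sigma_sets_induct_disjoint)
    case (basic A)
    then show ?case by (rule assms(4))
  next
    case empty
    show ?case using zero by (simp add: indicator_def[abs_def])
  next
    case (compl A)
    have "no_jump c (\<lambda>\<omega>. 1 * 1 + (-1) * indicator A \<omega>)" by (rule no_jump_lincomb[OF space compl(2)])
    then show ?case
      by (rule cong) (use compl(1) sM in \<open>auto intro!: essentially_bounded_indicator split: split_indicator\<close>)
  next
    case (union A)
    have Am [measurable]: "A i \<in> sets M" for i using union(2) sM by auto
    define \<zeta> where "\<zeta> m \<omega> = (\<Sum>i<m. indicator (A i) \<omega> :: real)" for m \<omega>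
    have \<zeta>: "no_jump c (\<zeta> m)" for m
    proof (induction m)
      case 0
      show ?case using zero by (simp add: \<zeta>_def[abs_def])
    next
      case (Suc m)
      show ?case using no_jump_lincomb[OF Suc union(3)[of m], of 1 1] by (simp add: \<zeta>_def[abs_def])
    qed
    have \<zeta>_eq: "\<zeta> m \<omega> = indicator (\<Union>i<m. A i) \<omega>" for m \<omega>
      unfolding \<zeta>_def
      by (rule indicator_UN_disjoint[symmetric, THEN trans[rotated]])
         (use union(1) in \<open>auto simp: disjoint_family_on_def\<close>)
    show ?case
    proof (rule no_jump_L2_limit[OF c _ \<zeta>])
      show "essentially_bounded (indicator (\<Union>i. A i))" by (rule essentially_bounded_indicator) auto
      have "(\<lambda>m. \<integral>\<omega>. (indicator (\<Union>i. A i) \<omega> - \<zeta> m \<omega>)\<^sup>2 \<partial>M) \<longlonglongrightarrow> (\<integral>\<omega>. 0 \<partial>M)"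
      proof (rule integral_dominated_convergence[where w="\<lambda>_. 1"])
        show "(\<lambda>\<omega>. (indicator (\<Union>i. A i) \<omega> - \<zeta> m \<omega>)\<^sup>2) \<in> borel_measurable M" for m
          unfolding \<zeta>_def by measurable
        show "AE \<omega> in M. norm ((indicator (\<Union>i. A i) \<omega> - \<zeta> m \<omega>)\<^sup>2) \<le> 1" for m
          unfolding \<zeta>_eq by (auto split: split_indicator)
        show "AE \<omega> in M. (\<lambda>m. (indicator (\<Union>i. A i) \<omega> - \<zeta> m \<omega>)\<^sup>2) \<longlonglongrightarrow> 0"
        proof (rule AE_I2)
          fix \<omega>
          show "(\<lambda>m. (indicator (\<Union>i. A i) \<omega> - \<zeta> m \<omega>)\<^sup>2) \<longlonglongrightarrow> 0"
          proof (cases "\<omega> \<in> (\<Union>i. A i)")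
            case True
            then obtain i where i: "\<omega> \<in> A i" by auto
            have "eventually (\<lambda>m. (indicator (\<Union>i. A i) \<omega> - \<zeta> m \<omega>)\<^sup>2 = (0::real)) sequentially"
              using eventually_gt_at_top[of i] 
            proof eventually_elim
              case (elim m)
              then have "\<omega> \<in> (\<Union>i<m. A i)" using i by auto
              then show ?case using True unfolding \<zeta>_eq by simp
            qed
            then show ?thesis by (rule tendsto_eventually)
          next
            case False
            then show ?thesis by (simp add: \<zeta>_eq)
          qed
        qed
      qed auto
      then show "(\<lambda>m. \<integral>\<omega>. (indicator (\<Union>i. A i) \<omega> - \<zeta> m \<omega>)\<^sup>2 \<partial>M) \<longlonglongrightarrow> 0" by simp
    qed
  qed
qed

end

section \<open>Increments of Brownian motion and the completed filtration\<close>

locale brownian = prob_space M for M :: "'a measure" +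
  fixes W :: "real \<Rightarrow> 'a \<Rightarrow> real" and \<sigma> :: real
  assumes bm: "brownian_motion M \<sigma> W"
begin

abbreviation "F \<equiv> completed_natural_filtration M W"

lemma W_measurable [measurable]: "0 \<le> t \<Longrightarrow> W t \<in> borel_measurable M"
  using bm by (simp add: brownian_motion_def)

lemma AE_W_0: "AE \<omega> in M. W 0 \<omega> = 0"
  using bm by (simp add: brownian_motion_def)

lemma AE_W_continuous: "AE \<omega> in M. continuous_on {0..} (\<lambda>t. W t \<omega>)"
  using bm by (simp add: brownian_motion_def)

lemma indep_increments:
  "0 \<le> t 0 \<Longrightarrow> mono t \<Longrightarrow> indep_vars (\<lambda>_. borel) (\<lambda>i \<omega>. W (t (Suc i)) \<omega> - W (t i) \<omega>) {..<n}"
  using bm unfolding brownian_motion_def by blast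

sublocale prob_filtration M F
proof
  show "subalgebra M (F t)" for t by (rule subalgebra_completed_natural_filtration) simp
  show "sets (F s) \<subseteq> sets (F t)" if "s \<le> t" for s t
    using filtration.sets_F_mono[OF filtration_completed_natural_filtration that] .
qed

lemma null_sets_F: "null_sets M \<subseteq> sets (F t)"
  unfolding sets_completed_natural_filtration by (auto intro: sigma_sets.Basic)

lemma W_measurable_F: "0 \<le> s \<Longrightarrow> s \<le> t \<Longrightarrow> W s \<in> borel_measurable (F t)"
proof (rule measurableI)
  fix A :: "real set" assume s: "0 \<le> s" "s \<le> t" and A: "A \<in> sets borel"
  have "W s -` A \<inter> space M \<in> sets (natural_filtration M W t)"
    unfolding natural_filtration_def
  proof (rule in_measure_of)
    show "W s -` A \<inter> space M \<in> (\<Union>s\<in>{0..t}. {W s -` A \<inter> space M |A. A \<in> sets borel})"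
      using s A by (intro UN_I[of s]) auto
  qed auto
  then show "W s -` A \<inter> space (F t) \<in> sets (F t)"
    unfolding sets_completed_natural_filtration by (auto intro: sigma_sets.Basic)
qed simp

text \<open>
  Half-lines suffice because the completed filtration is generated by these events together with the null
  sets (\<open>sets_F_generators\<close>); the two families together are stable under intersection.
\<close>

definition cylinder :: "(real \<times> real) list \<Rightarrow> 'a set" where
  "cylinder L = {\<omega> \<in> space M. \<forall>(u, a) \<in> set L. W u \<omega> \<le> a}"

definition cylinders :: "real \<Rightarrow> 'a set set" where
  "cylinders t = {cylinder L |L. \<forall>(u, a) \<in> set L. 0 \<le> u \<and> u \<le> t}"

lemma cylinder_F: "\<forall>(u, a) \<in> set L. 0 \<le> u \<and> u \<le> t \<Longrightarrow> cylinder L \<in> sets (F t)"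
proof (induction L)
  case Nil
  then show ?case using sets.top[of "F t"] by (simp add: cylinder_def space_F)
next
  case (Cons p L)
  obtain u a where p: "p = (u, a)" by (cases p)
  have "{\<omega> \<in> space (F t). W u \<omega> \<le> a} \<in> sets (F t)"
    using W_measurable_F[of u t] Cons(2) p by (simp add: borel_measurable_iff_le)
  moreover have "cylinder (p # L) = {\<omega> \<in> space (F t). W u \<omega> \<le> a} \<inter> cylinder L"
    by (auto simp: cylinder_def p)
  ultimately show ?case using Cons by auto
qed

lemma cylinder_sets: "\<forall>(u, a) \<in> set L. 0 \<le> u \<Longrightarrow> cylinder L \<in> sets M"
proof -
  assume L: "\<forall>(u, a) \<in> set L. 0 \<le> u"
  define t where "t = Max (insert 0 (fst ` set L))"
  have "\<forall>(u, a) \<in> set L. 0 \<le> u \<and> u \<le> t" using L unfolding t_def by (auto intro!: Max_ge)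
       (metis List.finite_set finite_imageI finite_insert fst_conv image_eqI insertI2 Max_ge)
  then show ?thesis using cylinder_F sets_F_subset by blast
qed

lemma cylinders_F: "cylinders t \<subseteq> sets (F t)"
  unfolding cylinders_def using cylinder_F by auto

lemma generators_sets: "cylinders t \<union> null_sets M \<subseteq> sets M"
  using cylinders_F[of t] sets_F_subset[of t] by auto

lemma Int_stable_generators: "Int_stable (cylinders t \<union> null_sets M)"
proof (rule Int_stableI)
  fix a b assume ab: "a \<in> cylinders t \<union> null_sets M" "b \<in> cylinders t \<union> null_sets M"
  then have m: "a \<in> sets M" "b \<in> sets M" using generators_sets by auto
  show "a \<inter> b \<in> cylinders t \<union> null_sets M"
  proof (cases "a \<in> null_sets M \<or> b \<in> null_sets M")
    case True
    then show ?thesis using m by (auto intro: null_set_Int1 null_set_Int2)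
  next
    case False
    then obtain L L' where "a = cylinder L" "b = cylinder L'"
      "\<forall>(u, a) \<in> set L. 0 \<le> u \<and> u \<le> t" "\<forall>(u, a) \<in> set L'. 0 \<le> u \<and> u \<le> t"
      using ab by (auto simp: cylinders_def)
    then have "a \<inter> b = cylinder (L @ L')" "\<forall>(u, a) \<in> set (L @ L'). 0 \<le> u \<and> u \<le> t"
      by (auto simp: cylinder_def)
    then show ?thesis unfolding cylinders_def by blast
  qed
qed

lemma sets_F_generators: "sets (F t) = sigma_sets (space M) (cylinders t \<union> null_sets M)"
proof
  have gen: "cylinders t \<union> null_sets M \<subseteq> sets (F t)" using cylinders_F null_sets_F by auto
  from sets.sigma_sets_subset[OF this]
  show "sigma_sets (space M) (cylinders t \<union> null_sets M) \<subseteq> sets (F t)" by (simp add: space_F)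
  let ?S = "sigma (space M) (cylinders t \<union> null_sets M)"
  have pow: "cylinders t \<union> null_sets M \<subseteq> Pow (space M)" using generators_sets sets.sets_into_space by blast
  have S: "sets ?S = sigma_sets (space M) (cylinders t \<union> null_sets M)" "space ?S = space M"
    using pow by (rule sets_measure_of, rule space_measure_of)
  have W: "W s \<in> borel_measurable ?S" if "s \<in> {0..t}" for s
  proof (rule borel_measurableI_le)
    fix a
    have "{\<omega> \<in> space ?S. W s \<omega> \<le> a} = cylinder [(s, a)]" by (simp add: S cylinder_def)
    also have "\<dots> \<in> cylinders t" unfolding cylinders_def using that by fastforce
    finally show "{\<omega> \<in> space ?S. W s \<omega> \<le> a} \<in> sets ?S" unfolding S by (auto intro: sigma_sets.Basic)
  qed
  have "(\<Union>s\<in>{0..t}. {W s -` A \<inter> space M |A. A \<in> sets borel}) \<subseteq> sets ?S"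
    using measurable_sets[OF W] by (auto simp: S(2))
  from sets.sigma_sets_subset[OF this] have "sets (natural_filtration M W t) \<subseteq> sets ?S"
    unfolding natural_filtration_def S(2)
    by (subst sets_measure_of) auto
  moreover have "null_sets M \<subseteq> sets ?S" unfolding S by (auto intro: sigma_sets.Basic)
  ultimately have "sets (natural_filtration M W t) \<union> null_sets M \<subseteq> sets ?S" by simp
  from sets.sigma_sets_subset[OF this]
  show "sets (F t) \<subseteq> sigma_sets (space M) (cylinders t \<union> null_sets M)"
    by (simp only: sets_completed_natural_filtration S)
qed

text \<open>
  On the sorted list of the times that occur, preceded by \<open>0\<close>, the values of \<open>W\<close> are partial sums of
  increments, almost surely as \<open>W\<close> starts at \<open>0\<close>. The cylinder is then an event about increments that
  precede \<open>t\<close>, and independence of increments applies to the sequence of these times followed by \<open>t\<close> and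
  \<open>u\<close>.
\<close>

lemma prob_cylinder_increment:
  assumes L: "\<forall>(v, a) \<in> set L. 0 \<le> v \<and> v \<le> t" and tu: "0 \<le> t" "t \<le> u" and B: "B \<in> sets borel"
  shows "prob (cylinder L \<inter> ((\<lambda>\<omega>. W u \<omega> - W t \<omega>) -` B \<inter> space M)) =
         prob (cylinder L) * prob ((\<lambda>\<omega>. W u \<omega> - W t \<omega>) -` B \<inter> space M)"
proof -
  define xs where "xs = sorted_list_of_set (insert 0 (fst ` set L))"
  define m where "m = length xs"
  have xs: "sorted xs" "set xs = insert 0 (fst ` set L)"
    unfolding xs_def by (rule sorted_sorted_list_of_set, rule set_sorted_list_of_set) simp
  have xs_bounds: "0 \<le> xs ! i" "xs ! i \<le> t" if "i < m" for i
    using nth_mem[of i xs] that L tu unfolding xs m_def by auto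
  have m: "0 < m" using xs(2) unfolding m_def by (metis insert_not_empty length_greater_0_conv set_empty)
  (* extended by a constant, because independent increments are assumed along infinite sequences *)
  define s where "s i = (if i < m then xs ! i else if i = m then t else u)" for i
  have s_mono: "mono s"
  proof (rule monoI)
    fix i j :: nat assume "i \<le> j"
    then show "s i \<le> s j"
      using xs_bounds(2)[of i] tu sorted_nth_mono[OF xs(1), of i j] by (auto simp: s_def m_def)
  qed
  have s0: "s 0 = 0"
  proof -
    have "xs ! 0 \<le> 0"
    proof -
      obtain j where "j < m" "xs ! j = 0" using xs(2) by (metis in_set_conv_nth insertI1 m_def)
      then show ?thesis using sorted_nth_mono[OF xs(1), of 0 j] by (simp add: m_def)
    qed
    then show ?thesis using m xs_bounds(1)[OF m] by (simp add: s_def)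
  qed
  have s_nonneg: "0 \<le> s i" for i using s0 monoD[OF s_mono, of 0 i] by simp
  define X where "X i \<omega> = W (s (Suc i)) \<omega> - W (s i) \<omega>" for i \<omega>
  have Xm: "X m = (\<lambda>\<omega>. W u \<omega> - W t \<omega>)" by (rule ext) (simp add: X_def s_def)
  have indep: "indep_vars (\<lambda>_. borel) X {..<Suc m}"
    using indep_increments[of s "Suc m"] s0 s_mono by (simp add: X_def[abs_def])
  have split: "indep_var (PiM {..<m} (\<lambda>_. borel)) (\<lambda>\<omega>. restrict (\<lambda>i. X i \<omega>) {..<m})
     (PiM {m} (\<lambda>_. borel)) (\<lambda>\<omega>. restrict (\<lambda>i. X i \<omega>) {m})"
    by (rule indep_var_restrict[OF indep]) auto
  have "\<exists>j<m. xs ! j = fst p" if "p \<in> set L" for p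
    using that xs(2) by (metis image_eqI in_set_conv_nth insertI2 m_def)
  then obtain idx where idx: "\<And>p. p \<in> set L \<Longrightarrow> idx p < m \<and> xs ! idx p = fst p" by metis
  define Xa where "Xa = {x \<in> space (PiM {..<m} (\<lambda>_. borel :: real measure)). \<forall>p\<in>set L. (\<Sum>i<idx p. x i) \<le> snd p}"
  have Xa: "Xa \<in> sets (PiM {..<m} (\<lambda>_. borel))"
    unfolding Xa_def
  proof (rule sets.sets_Collect_finite_All)
    fix p assume p: "p \<in> set L"
    have "(\<lambda>x. \<Sum>i<idx p. x i) \<in> borel_measurable (PiM {..<m} (\<lambda>_. borel :: real measure))"
      using idx[OF p] by (intro borel_measurable_sum measurable_component_singleton) auto
    then show "{x \<in> space (PiM {..<m} (\<lambda>_. borel :: real measure)). (\<Sum>i<idx p. x i) \<le> snd p} \<in> sets (PiM {..<m} (\<lambda>_. borel))"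
      by measurable
  qed simp
  define Xb where "Xb = {x \<in> space (PiM {m} (\<lambda>_. borel :: real measure)). x m \<in> B}"
  have Xb: "Xb \<in> sets (PiM {m} (\<lambda>_. borel))"
    unfolding Xb_def using B measurable_component_singleton[of m "{m}" "\<lambda>_. borel :: real measure"]
    by (auto intro: measurable_sets_Collect)
  let ?A = "\<lambda>\<omega>. restrict (\<lambda>i. X i \<omega>) {..<m}" and ?B = "\<lambda>\<omega>. restrict (\<lambda>i. X i \<omega>) {m}"
  have Beq: "?B -` Xb \<inter> space M = (\<lambda>\<omega>. W u \<omega> - W t \<omega>) -` B \<inter> space M"
    unfolding Xm[symmetric] by (auto simp: Xb_def space_PiM)
  have Aeq: "AE \<omega> in M. \<omega> \<in> ?A -` Xa \<inter> space M \<longleftrightarrow> \<omega> \<in> cylinder L"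
    using AE_W_0 AE_space
  proof eventually_elim
    case (elim \<omega>)
    have "(\<Sum>i<idx p. restrict (\<lambda>i. X i \<omega>) {..<m} i) = W (fst p) \<omega>" if p: "p \<in> set L" for p
    proof -
      have "(\<Sum>i<idx p. restrict (\<lambda>i. X i \<omega>) {..<m} i) = (\<Sum>i<idx p. X i \<omega>)"
        using idx[OF p] by (intro sum.cong) auto
      also have "\<dots> = W (s (idx p)) \<omega> - W (s 0) \<omega>"
        unfolding X_def by (rule sum_lessThan_telescope)
      finally show ?thesis using idx[OF p] elim by (simp add: s0) (simp add: s_def)
    qed
    then show ?case using elim by (auto simp: Xa_def cylinder_def space_PiM split_beta)
  qed
  have Am: "?A -` Xa \<inter> space M \<in> sets M" using indep_var_rv1[OF split] Xa by (rule measurable_sets)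
  have Bm: "?B -` Xb \<inter> space M \<in> sets M" using indep_var_rv2[OF split] Xb by (rule measurable_sets)
  have cm: "cylinder L \<in> sets M" using L by (intro cylinder_sets) auto
  have "prob ((\<lambda>\<omega>. (?A \<omega>, ?B \<omega>)) -` (Xa \<times> Xb) \<inter> space M) = prob (?A -` Xa \<inter> space M) * prob (?B -` Xb \<inter> space M)"
    by (rule indep_varD[OF split Xa Xb])
  moreover have "(\<lambda>\<omega>. (?A \<omega>, ?B \<omega>)) -` (Xa \<times> Xb) \<inter> space M = (?A -` Xa \<inter> space M) \<inter> (?B -` Xb \<inter> space M)" by auto
  moreover have "prob ((?A -` Xa \<inter> space M) \<inter> (?B -` Xb \<inter> space M)) = prob (cylinder L \<inter> (?B -` Xb \<inter> space M))"
    using Am Bm cm Aeq by (intro finite_measure_eq_AE) auto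
  moreover have "prob (?A -` Xa \<inter> space M) = prob (cylinder L)"
    using Am cm Aeq by (intro finite_measure_eq_AE) auto
  ultimately show ?thesis unfolding Beq by simp
qed

lemma indep_increment:
  assumes tu: "0 \<le> t" "t \<le> u"
  shows "indep_set (sets (F t)) (sigma_sets (space M) {(\<lambda>\<omega>. W u \<omega> - W t \<omega>) -` B \<inter> space M |B. B \<in> sets borel})"
proof -
  let ?D = "\<lambda>\<omega>. W u \<omega> - W t \<omega>"
  have u: "0 \<le> u" using tu by simp
  note [measurable] = W_measurable[OF tu(1)] W_measurable[OF u]
  have D: "?D -` B \<inter> space M \<in> sets M" if "B \<in> sets borel" for B
    using that by measurable
  have "indep_set (cylinders t \<union> null_sets M) {?D -` B \<inter> space M |B. B \<in> sets borel}"
    unfolding indep_sets2_eq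
  proof (intro conjI ballI)
    show "cylinders t \<union> null_sets M \<subseteq> events" by (rule generators_sets)
    show "{?D -` B \<inter> space M |B. B \<in> sets borel} \<subseteq> events" using D by auto
    fix a b assume a: "a \<in> cylinders t \<union> null_sets M" and b: "b \<in> {?D -` B \<inter> space M |B. B \<in> sets borel}"
    show "prob (a \<inter> b) = prob a * prob b"
    proof (cases "a \<in> null_sets M")
      case True
      have "a \<inter> b \<in> null_sets M" using True b D by (auto intro!: null_set_Int2)
      then show ?thesis using True by (simp add: measure_def null_setsD1)
    next
      case False
      then show ?thesis using a b prob_cylinder_increment[OF _ tu] by (auto simp: cylinders_def)
    qed
  qed
  moreover have "Int_stable {?D -` B \<inter> space M |B. B \<in> sets borel}"
    by (rule Int_stableI) (force intro: exI[of _ "_ \<inter> _"])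
  ultimately show ?thesis
    unfolding sets_F_generators by (intro indep_set_sigma_sets Int_stable_generators)
qed

end

section \<open>Continuous versions of Brownian martingales\<close>

context brownian
begin

text \<open>
  The transition operator of \<open>W\<close> from \<open>t\<close> to \<open>u\<close>. Writing it with the increment itself rather than with a
  normal density yields its continuity from the continuity of the paths.
\<close>

definition transition :: "real \<Rightarrow> real \<Rightarrow> (real \<Rightarrow> real) \<Rightarrow> real \<Rightarrow> real" where
  "transition t u f x = (\<integral>\<omega>. f (x + (W u \<omega> - W t \<omega>)) \<partial>M)"

lemma transition_self: "transition u u f x = f x"
  by (simp add: transition_def prob_space)

context
  fixes f :: "real \<Rightarrow> real" and K :: real
  assumes f_cont: "continuous_on UNIV f" and f_bound: "\<And>x. \<bar>f x\<bar> \<le> K"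
begin

lemma f_measurable [measurable]: "f \<in> borel_measurable borel"
  using f_cont by (rule borel_measurable_continuous_onI)

lemma transition_bounded: "\<bar>transition t u f x\<bar> \<le> K"
proof (cases "integrable M (\<lambda>\<omega>. f (x + (W u \<omega> - W t \<omega>)))")
  case True
  have "\<bar>transition t u f x\<bar> \<le> (\<integral>\<omega>. \<bar>f (x + (W u \<omega> - W t \<omega>))\<bar> \<partial>M)"
    unfolding transition_def by (rule integral_abs_bound)
  also have "\<dots> \<le> (\<integral>\<omega>. K \<partial>M)"
    by (rule integral_mono) (use True f_bound in auto)
  finally show ?thesis by (simp add: prob_space)
next
  case False
  have "0 \<le> K" using f_bound[of 0] by linarith
  then show ?thesis using False by (simp add: transition_def not_integrable_integral_eq)
qed

lemma transition_tendsto: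
  assumes u: "0 \<le> u" and t: "0 \<le> t" "\<And>n. 0 \<le> s n" and lim: "s \<longlonglongrightarrow> t" "y \<longlonglongrightarrow> x"
  shows "(\<lambda>n. transition (s n) u f (y n)) \<longlonglongrightarrow> transition t u f x"
  unfolding transition_def
proof (rule integral_dominated_convergence[where w="\<lambda>_. K"])
  note [measurable] = W_measurable[OF u] W_measurable[OF t(1)] W_measurable[OF t(2)]
  show "(\<lambda>\<omega>. f (x + (W u \<omega> - W t \<omega>))) \<in> borel_measurable M" by measurable
  show "(\<lambda>\<omega>. f (y n + (W u \<omega> - W (s n) \<omega>))) \<in> borel_measurable M" for n by measurable
  show "AE \<omega> in M. norm (f (y n + (W u \<omega> - W (s n) \<omega>))) \<le> K" for n using f_bound by simp
  show "AE \<omega> in M. (\<lambda>n. f (y n + (W u \<omega> - W (s n) \<omega>))) \<longlonglongrightarrow> f (x + (W u \<omega> - W t \<omega>))"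
    using AE_W_continuous
  proof eventually_elim
    case (elim \<omega>)
    have "(\<lambda>n. W (s n) \<omega>) \<longlonglongrightarrow> W t \<omega>"
      using elim[unfolded continuous_on_sequentially, rule_format, of t s] t lim by (simp add: o_def)
    then have "(\<lambda>n. y n + (W u \<omega> - W (s n) \<omega>)) \<longlonglongrightarrow> x + (W u \<omega> - W t \<omega>)"
      using lim by (intro tendsto_intros)
    then show ?case
      using f_cont[unfolded continuous_on_sequentially, rule_format, of "x + (W u \<omega> - W t \<omega>)"]
      by (simp add: o_def)
  qed
qed simp

lemma transition_continuous: "0 \<le> t \<Longrightarrow> 0 \<le> u \<Longrightarrow> continuous_on UNIV (transition t u f)"
  unfolding continuous_on_sequentially o_def by (auto intro: transition_tendsto)

lemma transition_measurable: "0 \<le> t \<Longrightarrow> 0 \<le> u \<Longrightarrow> transition t u f \<in> borel_measurable borel"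
  by (rule borel_measurable_continuous_onI) (rule transition_continuous)

lemma transition_path_continuous:
  assumes "0 \<le> u" and W: "continuous_on {0..} (\<lambda>t. W t \<omega>)"
  shows "continuous_on {0..} (\<lambda>t. transition t u f (W t \<omega>))"
  unfolding continuous_on_sequentially
proof (intro allI ballI impI)
  fix s :: "nat \<Rightarrow> real" and t assume t: "t \<in> {0..}" and s: "(\<forall>n. s n \<in> {0..}) \<and> s \<longlonglongrightarrow> t"
  have "(\<lambda>n. W (s n) \<omega>) \<longlonglongrightarrow> W t \<omega>"
    using W[unfolded continuous_on_sequentially, rule_format, of t s] t s by (simp add: o_def)
  then show "((\<lambda>t. transition t u f (W t \<omega>)) \<circ> s) \<longlonglongrightarrow> transition t u f (W t \<omega>)"
    unfolding o_def using s t assms(1) by (intro transition_tendsto) auto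
qed

text \<open>
  The Markov property: \<open>W u\<close> is \<open>W t\<close> plus an increment independent of \<open>F t\<close>, so the conditional
  expectation is computed by Fubini's theorem for the product law.
\<close>

lemma cond_exp_transition:
  assumes tu: "0 \<le> t" "t \<le> u"
  shows "AE \<omega> in M. real_cond_exp M (F t) (\<lambda>\<omega>. f (W u \<omega>)) \<omega> = transition t u f (W t \<omega>)"
proof -
  interpret S: sigma_finite_subalgebra M "F t" by (rule sigma_finite_subalg)
  have u: "0 \<le> u" using tu by simp
  note [measurable] = W_measurable[OF u] W_measurable[OF tu(1)] transition_measurable[OF tu(1) u]
  (* padded to a pair: independence of two variables is stated for a common value type *)
  define D where "D = (\<lambda>\<omega>. (W u \<omega> - W t \<omega>, 0 :: real))"
  have Dm [measurable]: "D \<in> measurable M (borel \<Otimes>\<^sub>M borel)" unfolding D_def by measurable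
  have D_indep: "indep_set (sets (F t)) (sigma_sets (space M) {D -` B \<inter> space M |B. B \<in> sets (borel \<Otimes>\<^sub>M borel)})"
  proof -
    let ?D = "\<lambda>\<omega>. W u \<omega> - W t \<omega>"
    have "\<exists>B'\<in>sets borel. D -` B \<inter> space M = ?D -` B' \<inter> space M" if "B \<in> sets (borel \<Otimes>\<^sub>M borel)" for B
    proof (rule bexI[of _ "(\<lambda>d. (d, 0)) -` B"])
      have "(\<lambda>d. (d, 0)) -` B \<inter> space (borel :: real measure) \<in> sets borel"
        by (rule measurable_sets[OF _ that]) measurable
      then show "(\<lambda>d. (d, 0 :: real)) -` B \<in> sets borel" by simp
    qed (auto simp: D_def)
    then have "{D -` B \<inter> space M |B. B \<in> sets (borel \<Otimes>\<^sub>M borel)} \<subseteq> {?D -` B \<inter> space M |B. B \<in> sets borel}"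
      by (force simp only: mem_Collect_eq subset_iff)
    from sigma_sets_mono'[OF this, of "space M"] show ?thesis
      using indep_increment[OF tu] unfolding indep_sets2_eq by (meson subset_iff)
  qed
  show ?thesis
  proof (rule S.real_cond_exp_charact)
    show "integrable M (\<lambda>\<omega>. f (W u \<omega>))"
      by (rule integrable_const_bound[where B=K]) (use f_bound in auto)
    show "integrable M (\<lambda>\<omega>. transition t u f (W t \<omega>))"
      by (rule integrable_const_bound[where B=K]) (use transition_bounded in auto)
    show "(\<lambda>\<omega>. transition t u f (W t \<omega>)) \<in> borel_measurable (F t)"
      using W_measurable_F[OF tu(1) order_refl] by measurable
    fix A assume A: "A \<in> sets (F t)"
    then have [measurable]: "A \<in> sets M" using sets_F_subset by auto
    define Z where "Z = (\<lambda>\<omega>. (indicator A \<omega> :: real, W t \<omega>))"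
    have Zm: "Z \<in> measurable (F t) (borel \<Otimes>\<^sub>M borel)"
      unfolding Z_def using W_measurable_F[OF tu(1) order_refl] A by measurable
    have ZM [measurable]: "Z \<in> measurable M (borel \<Otimes>\<^sub>M borel)"
      by (rule measurable_from_subalg[OF sub_F Zm])
    have "indep_var (borel \<Otimes>\<^sub>M borel) Z (borel \<Otimes>\<^sub>M borel) D"
      unfolding indep_var_eq
    proof (intro conjI)
      have "sigma_sets (space M) {Z -` B \<inter> space M |B. B \<in> sets (borel \<Otimes>\<^sub>M borel)} \<subseteq> sets (F t)"
      proof -
        have "{Z -` B \<inter> space M |B. B \<in> sets (borel \<Otimes>\<^sub>M borel)} \<subseteq> sets (F t)"
          using measurable_sets[OF Zm] by (auto simp: space_F)
        from sets.sigma_sets_subset[OF this] show ?thesis by (simp add: space_F)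
      qed
      then show "indep_set (sigma_sets (space M) {Z -` B \<inter> space M |B. B \<in> sets (borel \<Otimes>\<^sub>M borel)})
          (sigma_sets (space M) {D -` B \<inter> space M |B. B \<in> sets (borel \<Otimes>\<^sub>M borel)})"
        using D_indep unfolding indep_sets2_eq by blast
    qed measurable
    then have dist: "distr M (borel \<Otimes>\<^sub>M borel) Z \<Otimes>\<^sub>M distr M (borel \<Otimes>\<^sub>M borel) D = distr M ((borel \<Otimes>\<^sub>M borel) \<Otimes>\<^sub>M (borel \<Otimes>\<^sub>M borel)) (\<lambda>\<omega>. (Z \<omega>, D \<omega>))"
      by (simp add: indep_var_distribution_eq)
    define h :: "(real \<times> real) \<times> (real \<times> real) \<Rightarrow> real" where "h = (\<lambda>z. fst (fst z) * f (snd (fst z) + fst (snd z)))"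
    have hm [measurable]: "h \<in> borel_measurable ((borel \<Otimes>\<^sub>M borel) \<Otimes>\<^sub>M (borel \<Otimes>\<^sub>M borel))"
      unfolding h_def by measurable
    have K0: "0 \<le> K" using f_bound[of 0] by linarith
    have int_h: "integrable (distr M (borel \<Otimes>\<^sub>M borel) Z \<Otimes>\<^sub>M distr M (borel \<Otimes>\<^sub>M borel) D) h"
      unfolding dist
    proof (subst integrable_distr_eq)
      show "integrable M (\<lambda>\<omega>. h (Z \<omega>, D \<omega>))"
        by (rule integrable_const_bound[where B=K])
          (use f_bound K0 in \<open>auto simp: h_def Z_def split: split_indicator\<close>)
    qed measurable
    interpret DZ: prob_space "distr M (borel \<Otimes>\<^sub>M borel) Z" by (rule prob_space_distr) measurable
    interpret DD: prob_space "distr M (borel \<Otimes>\<^sub>M borel) D" by (rule prob_space_distr) measurable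
    interpret P: pair_sigma_finite "distr M (borel \<Otimes>\<^sub>M borel) Z" "distr M (borel \<Otimes>\<^sub>M borel) D" ..
    have "(LINT \<omega>:A|M. f (W u \<omega>)) = (\<integral>\<omega>. h (Z \<omega>, D \<omega>) \<partial>M)"
      by (simp add: set_lebesgue_integral_def h_def Z_def D_def)
    also have "\<dots> = integral\<^sup>L (distr M ((borel \<Otimes>\<^sub>M borel) \<Otimes>\<^sub>M (borel \<Otimes>\<^sub>M borel)) (\<lambda>\<omega>. (Z \<omega>, D \<omega>))) h"
      by (rule integral_distr[symmetric]) measurable
    also have "\<dots> = (\<integral>z. (\<integral>d. h (z, d) \<partial>distr M (borel \<Otimes>\<^sub>M borel) D) \<partial>distr M (borel \<Otimes>\<^sub>M borel) Z)"
      unfolding dist[symmetric] by (rule P.integral_fst'[OF int_h, symmetric])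
    also have "\<dots> = (\<integral>z. (\<integral>\<omega>. h (z, D \<omega>) \<partial>M) \<partial>distr M (borel \<Otimes>\<^sub>M borel) Z)"
      by (intro Bochner_Integration.integral_cong refl integral_distr) measurable
    also have "\<dots> = (\<integral>\<omega>'. (\<integral>\<omega>. h (Z \<omega>', D \<omega>) \<partial>M) \<partial>M)"
      by (rule integral_distr) measurable
    also have "\<dots> = (LINT \<omega>:A|M. transition t u f (W t \<omega>))"
      by (simp add: set_lebesgue_integral_def h_def Z_def D_def transition_def)
    finally show "(LINT \<omega>:A|M. f (W u \<omega>)) = (LINT \<omega>:A|M. transition t u f (W t \<omega>))" .
  qed
qed

end

definition test_product :: "(real \<times> (real \<Rightarrow> real)) list \<Rightarrow> 'a \<Rightarrow> real" where
  "test_product L \<omega> = prod_list (map (\<lambda>(u, f). f (W u \<omega>)) L)"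

lemma test_product_Cons: "test_product ((u, f) # L) \<omega> = test_product L \<omega> * f (W u \<omega>)"
  by (simp add: test_product_def)

definition bounded_continuous :: "(real \<Rightarrow> real) \<Rightarrow> bool" where
  "bounded_continuous f \<longleftrightarrow> continuous_on UNIV f \<and> (\<exists>K. \<forall>x. \<bar>f x\<bar> \<le> K)"

lemma test_product_F:
  assumes "\<forall>(u, f) \<in> set L. 0 \<le> u \<and> u \<le> t \<and> bounded_continuous f"
  shows "test_product L \<in> borel_measurable (F t)"
  using assms
proof (induction L)
  case Nil
  then show ?case by (simp add: test_product_def[abs_def])
next
  case (Cons p L)
  obtain u f where p: "p = (u, f)" by (cases p)
  have [measurable]: "f \<in> borel_measurable borel"
    using Cons(2) p by (intro borel_measurable_continuous_onI) (auto simp: bounded_continuous_def)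
  have [measurable]: "W u \<in> borel_measurable (F t)" using Cons(2) p by (intro W_measurable_F) auto
  have [measurable]: "test_product L \<in> borel_measurable (F t)" using Cons by simp
  show ?case unfolding p test_product_Cons[abs_def] by measurable
qed

lemma test_product_bounded:
  assumes "\<forall>(u, f) \<in> set L. bounded_continuous f"
  shows "\<exists>K. \<forall>\<omega>. \<bar>test_product L \<omega>\<bar> \<le> K"
  using assms
proof (induction L)
  case Nil
  then show ?case by (auto simp: test_product_def)
next
  case (Cons p L)
  obtain u f where p: "p = (u, f)" by (cases p)
  obtain K K' where K: "\<And>\<omega>. \<bar>test_product L \<omega>\<bar> \<le> K" and K': "\<And>x. \<bar>f x\<bar> \<le> K'"
    using Cons p by (auto simp: bounded_continuous_def)
  have "\<bar>test_product (p # L) \<omega>\<bar> \<le> K * K'" for \<omega>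
    unfolding p test_product_Cons abs_mult using K[of \<omega>] K'[of "W u \<omega>"] by (intro mult_mono) auto
  then show ?case by blast
qed

text \<open>
  Coincidence with \<open>\<xi>\<close> from time \<open>u\<close> on is recorded because pieces of such processes are glued at \<open>u\<close>.
\<close>

definition continuous_version :: "('a \<Rightarrow> real) \<Rightarrow> real \<Rightarrow> (real \<Rightarrow> 'a \<Rightarrow> real) \<Rightarrow> bool" where
  "continuous_version \<xi> u Y \<longleftrightarrow>
     (\<forall>t\<ge>0. Y t \<in> borel_measurable (F t)) \<and> (\<exists>K. \<forall>t\<ge>0. \<forall>\<omega>. \<bar>Y t \<omega>\<bar> \<le> K) \<and>
     (\<forall>t\<ge>u. Y t = \<xi>) \<and>
     (\<forall>t\<ge>0. AE \<omega> in M. real_cond_exp M (F t) \<xi> \<omega> = Y t \<omega>) \<and>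
     (\<forall>\<omega>. continuous_on {0..} (\<lambda>t. W t \<omega>) \<longrightarrow> continuous_on {0..} (\<lambda>t. Y t \<omega>))"

text \<open>
  Times are listed backwards and end at \<open>0\<close>. Between the last two times \<open>u'\<close> and \<open>u\<close> the Markov property
  gives the martingale explicitly. At \<open>u'\<close> it is again a product of the same kind, with one factor
  less: the last factor is replaced by its transition to \<open>u'\<close> and absorbed in the factor at \<open>u'\<close>. So the
  induction hypothesis covers the times before \<open>u'\<close>.
\<close>

lemma test_product_continuous_version:
  assumes "\<forall>(v, h) \<in> set ((u, f) # L). 0 \<le> v \<and> bounded_continuous h"
    and "sorted_wrt (\<lambda>p q. fst q \<le> fst p) ((u, f) # L)" and "fst (last ((u, f) # L)) = 0"
  shows "\<exists>Y. continuous_version (test_product ((u, f) # L)) u Y"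
  using assms
proof (induction L arbitrary: u f)
  case Nil
  then have u: "u = 0" by simp
  let ?\<xi> = "test_product [(u, f)]"
  have m: "?\<xi> \<in> borel_measurable (F t)" if "0 \<le> t" for t
    using Nil u that by (intro test_product_F) auto
  obtain K where K: "\<And>\<omega>. \<bar>?\<xi> \<omega>\<bar> \<le> K" using test_product_bounded[of "[(u, f)]"] Nil by auto
  have "AE \<omega> in M. real_cond_exp M (F t) ?\<xi> \<omega> = ?\<xi> \<omega>" if "0 \<le> t" for t
  proof -
    interpret S: sigma_finite_subalgebra M "F t" by (rule sigma_finite_subalg)
    show ?thesis
      using measurable_from_subalg[OF sub_F m[OF that]] K
      by (intro S.real_cond_exp_F_meas m that integrable_const_bound[where B=K]) auto
  qed
  then show ?case using m K unfolding continuous_version_def by (intro exI[of _ "\<lambda>_. ?\<xi>"]) auto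
next
  case (Cons p L)
  obtain u' f' where p: "p = (u', f')" by (cases p)
  let ?L = "(u', f') # L" and ?\<xi> = "test_product ((u, f) # (u', f') # L)"
  note prems = Cons.prems[unfolded p]
  have u: "0 \<le> u'" "u' \<le> u" "0 \<le> u" using prems by auto
  have fc: "continuous_on UNIV f" using prems(1) by (auto simp: bounded_continuous_def)
  obtain Kf where Kf: "\<And>x. \<bar>f x\<bar> \<le> Kf" using prems(1) by (auto simp: bounded_continuous_def)
  define g where "g t = transition t u f" for t
  (* the new last factor, at time u' *)
  define f'' where "f'' x = f' x * g u' x" for x
  have f'': "bounded_continuous f''"
  proof -
    obtain K' where K': "\<And>x. \<bar>f' x\<bar> \<le> K'" using prems(1) by (auto simp: bounded_continuous_def)
    have "\<bar>f'' x\<bar> \<le> K' * Kf" for x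
      unfolding f''_def abs_mult g_def using K'[of x] transition_bounded[OF fc Kf, of u' u x] by (intro mult_mono) auto
    moreover have "continuous_on UNIV f''"
      unfolding f''_def g_def using prems(1) transition_continuous[OF fc Kf u(1,3)]
      by (intro continuous_on_mult) (auto simp: bounded_continuous_def)
    ultimately show ?thesis by (auto simp: bounded_continuous_def)
  qed
  let ?\<zeta> = "test_product ((u', f'') # L)"
  have "\<exists>Y. continuous_version ?\<zeta> u' Y"
    by (rule Cons.IH) (use prems f'' in \<open>auto split: if_splits\<close>)
  then obtain Y' where "continuous_version ?\<zeta> u' Y'" by (rule exE)
  note cv = this[unfolded continuous_version_def]
  obtain K' where K': "\<And>t \<omega>. 0 \<le> t \<Longrightarrow> \<bar>Y' t \<omega>\<bar> \<le> K'" using cv by blast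
  have Y': "\<And>t. 0 \<le> t \<Longrightarrow> Y' t \<in> borel_measurable (F t)"
    "\<And>t \<omega>. 0 \<le> t \<Longrightarrow> \<bar>Y' t \<omega>\<bar> \<le> K'" "\<And>t. u' \<le> t \<Longrightarrow> Y' t = ?\<zeta>"
    "\<And>t. 0 \<le> t \<Longrightarrow> AE \<omega> in M. real_cond_exp M (F t) ?\<zeta> \<omega> = Y' t \<omega>"
    "\<And>\<omega>. continuous_on {0..} (\<lambda>t. W t \<omega>) \<Longrightarrow> continuous_on {0..} (\<lambda>t. Y' t \<omega>)"
    using cv K' by simp_all
  have \<xi>_eq: "?\<xi> \<omega> = test_product ?L \<omega> * f (W u \<omega>)" for \<omega> by (rule test_product_Cons)
  have \<zeta>_eq: "?\<zeta> \<omega> = test_product ?L \<omega> * g u' (W u' \<omega>)" for \<omega>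
    by (simp add: test_product_Cons f''_def)
  define Y where "Y t \<omega> = (if u \<le> t then ?\<xi> \<omega> else if u' \<le> t then test_product ?L \<omega> * g t (W t \<omega>) else Y' t \<omega>)" for t \<omega>
  have tail_bound: "\<forall>(v, h)\<in>set L. v \<le> u'" using prems(2) by auto
  have m\<xi>: "?\<xi> \<in> borel_measurable (F t)" if "u \<le> t" for t
    using prems that u tail_bound by (intro test_product_F) (auto simp: split_beta intro: order_trans)
  have mL: "test_product ?L \<in> borel_measurable (F t)" if "u' \<le> t" for t
    using prems that u tail_bound by (intro test_product_F) (auto simp: split_beta intro: order_trans)
  have gm: "(\<lambda>\<omega>. g t (W t \<omega>)) \<in> borel_measurable (F t)" if "0 \<le> t" for t
    using W_measurable_F[OF that order_refl] transition_measurable[OF fc Kf that u(3)] unfolding g_def by measurable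
  obtain KL where KL: "\<And>\<omega>. \<bar>test_product ?L \<omega>\<bar> \<le> KL"
    using test_product_bounded[of ?L] prems(1) by auto
  have \<xi>_bound: "\<bar>?\<xi> \<omega>\<bar> \<le> KL * Kf" for \<omega>
    unfolding \<xi>_eq abs_mult using KL[of \<omega>] Kf[of "W u \<omega>"] by (intro mult_mono) auto
  have Lg_bound: "\<bar>test_product ?L \<omega> * g t x\<bar> \<le> KL * Kf" for \<omega> t x
    unfolding abs_mult g_def using KL[of \<omega>] transition_bounded[OF fc Kf] by (intro mult_mono) (auto intro: order_trans[OF _ KL])
  have int_\<xi>: "integrable M ?\<xi>"
    using measurable_from_subalg[OF sub_F m\<xi>[OF order_refl]] \<xi>_bound by (intro integrable_const_bound[where B="KL * Kf"]) auto
  have ce_mid: "AE \<omega> in M. real_cond_exp M (F t) ?\<xi> \<omega> = test_product ?L \<omega> * g t (W t \<omega>)" if t: "u' \<le> t" "t \<le> u" for t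
  proof -
    interpret S: sigma_finite_subalgebra M "F t" by (rule sigma_finite_subalg)
    have t0: "0 \<le> t" using t u by simp
    have [measurable]: "f \<in> borel_measurable borel" by (rule borel_measurable_continuous_onI[OF fc])
    have "AE \<omega> in M. real_cond_exp M (F t) (\<lambda>\<omega>. test_product ?L \<omega> * f (W u \<omega>)) \<omega>
       = test_product ?L \<omega> * real_cond_exp M (F t) (\<lambda>\<omega>. f (W u \<omega>)) \<omega>"
    proof (rule S.real_cond_exp_mult)
      show "test_product ?L \<in> borel_measurable (F t)" by (rule mL[OF t(1)])
      show "(\<lambda>\<omega>. f (W u \<omega>)) \<in> borel_measurable M" using W_measurable[OF u(3)] by measurable
      show "integrable M (\<lambda>\<omega>. test_product ?L \<omega> * f (W u \<omega>))" using int_\<xi> by (simp add: \<xi>_eq[abs_def])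
    qed
    then show ?thesis using cond_exp_transition[OF fc Kf t0 t(2)]
      unfolding \<xi>_eq[abs_def] g_def by eventually_elim simp
  qed
  have "Y t \<in> borel_measurable (F t)" if "0 \<le> t" for t
  proof -
    consider "u \<le> t" | "\<not> u \<le> t" "u' \<le> t" | "\<not> u \<le> t" "\<not> u' \<le> t" by blast
    then show ?thesis
    proof cases
      case 1 then show ?thesis using m\<xi>[OF 1] by (simp add: Y_def[abs_def])
    next
      case 2 then show ?thesis using borel_measurable_times[OF mL[OF 2(2)] gm[OF that]] by (simp add: Y_def[abs_def])
    next
      case 3 then show ?thesis using Y'(1)[OF that] by (simp add: Y_def[abs_def])
    qed
  qed
  moreover have "\<bar>Y t \<omega>\<bar> \<le> max (KL * Kf) K'" if "0 \<le> t" for t \<omega>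
    using \<xi>_bound[of \<omega>] Lg_bound[of \<omega> t "W t \<omega>"] Y'(2)[OF that, of \<omega>] by (auto simp: Y_def)
  moreover have "Y t = ?\<xi>" if "u \<le> t" for t using that by (simp add: Y_def[abs_def])
  moreover have "AE \<omega> in M. real_cond_exp M (F t) ?\<xi> \<omega> = Y t \<omega>" if t: "0 \<le> t" for t
  proof -
    interpret S: sigma_finite_subalgebra M "F t" by (rule sigma_finite_subalg)
    consider "u \<le> t" | "\<not> u \<le> t" "u' \<le> t" | "\<not> u \<le> t" "\<not> u' \<le> t" by blast
    then show ?thesis
    proof cases
      case 1
      then show ?thesis using S.real_cond_exp_F_meas[OF int_\<xi> m\<xi>[OF 1]] by (simp add: Y_def)
    next
      case 2
      then show ?thesis using ce_mid[of t] by (simp add: Y_def)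
    next
      case 3
      interpret S': sigma_finite_subalgebra M "F u'" by (rule sigma_finite_subalg)
      have "AE \<omega> in M. real_cond_exp M (F u') ?\<xi> \<omega> = ?\<zeta> \<omega>"
        using ce_mid[of u'] u by (simp add: \<zeta>_eq)
      then have "AE \<omega> in M. real_cond_exp M (F t) (real_cond_exp M (F u') ?\<xi>) \<omega> = real_cond_exp M (F t) ?\<zeta> \<omega>"
      proof (rule S.real_cond_exp_cong)
        have "test_product ((u', f'') # L) \<in> borel_measurable (F u')"
          using Y'(1)[OF u(1)] Y'(3)[OF order_refl] by simp
        then show "?\<zeta> \<in> borel_measurable M" by (rule measurable_from_subalg[OF sub_F])
      qed simp
      moreover have "AE \<omega> in M. real_cond_exp M (F t) (real_cond_exp M (F u') ?\<xi>) \<omega> = real_cond_exp M (F t) ?\<xi> \<omega>"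
        using sub_F 3 mono_F[of t u'] by (intro S.real_cond_exp_nested_subalg int_\<xi>) (auto simp: subalgebra_def)
      ultimately show ?thesis using Y'(4)[OF t]
        by eventually_elim (use 3 in \<open>simp add: Y_def\<close>)
    qed
  qed
  moreover have "continuous_on {0..} (\<lambda>t. Y t \<omega>)" if W: "continuous_on {0..} (\<lambda>t. W t \<omega>)" for \<omega>
  proof -
    have 1: "continuous_on {0..u'} (\<lambda>t. Y t \<omega>)"
    proof (rule continuous_on_eq)
      show "continuous_on {0..u'} (\<lambda>t. Y' t \<omega>)" using Y'(5)[OF W] by (rule continuous_on_subset) auto
      show "Y' t \<omega> = Y t \<omega>" if "t \<in> {0..u'}" for t
        using that u Y'(3)[of t] \<zeta>_eq[of \<omega>] \<xi>_eq[of \<omega>] by (auto simp: Y_def g_def transition_self)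
    qed
    have 2: "continuous_on {u'..u} (\<lambda>t. Y t \<omega>)"
    proof (rule continuous_on_eq)
      show "continuous_on {u'..u} (\<lambda>t. test_product ?L \<omega> * g t (W t \<omega>))"
        unfolding g_def using transition_path_continuous[OF fc Kf u(3) W] u
        by (intro continuous_on_mult continuous_on_const) (auto elim: continuous_on_subset)
      show "test_product ?L \<omega> * g t (W t \<omega>) = Y t \<omega>" if "t \<in> {u'..u}" for t
        using that \<xi>_eq[of \<omega>] by (auto simp: Y_def g_def transition_self)
    qed
    have 3: "continuous_on {u..} (\<lambda>t. Y t \<omega>)"
      by (rule continuous_on_eq[of _ "\<lambda>_. ?\<xi> \<omega>"]) (auto simp: Y_def)
    have "continuous_on (({0..u'} \<union> {u'..u}) \<union> {u..}) (\<lambda>t. Y t \<omega>)"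
      by (intro continuous_on_closed_Un 1 2 3 closed_Un) auto
    moreover have "({0..u'} \<union> {u'..u}) \<union> {u..} = {0..}" using u by auto
    ultimately show ?thesis by simp
  qed
  ultimately have "continuous_version ?\<xi> u Y" unfolding continuous_version_def by blast
  then show ?case unfolding p by blast
qed

end

section \<open>Brownian martingales do not jump at the random time\<close>

text \<open>
  A continuous approximation of the indicator of the half-line up to \<open>a\<close>.
\<close>

definition soft_step :: "nat \<Rightarrow> real \<Rightarrow> real \<Rightarrow> real" where
  "soft_step m a x = max 0 (min 1 (1 - real m * (x - a)))"

lemma soft_step_bounds: "0 \<le> soft_step m a x" "soft_step m a x \<le> 1"
  by (auto simp: soft_step_def)

lemma soft_step_tendsto: "(\<lambda>m. soft_step m a x) \<longlonglongrightarrow> (if x \<le> a then 1 else 0)"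
proof (cases "x \<le> a")
  case True
  then have "soft_step m a x = 1" for m
    by (simp add: soft_step_def mult_nonneg_nonpos min_absorb1)
  then show ?thesis using True by simp
next
  case False
  then obtain N where N: "1 / (x - a) \<le> real N" using real_arch_simple by blast
  have "soft_step m a x = 0" if "N \<le> m" for m
  proof -
    have "1 / (x - a) \<le> real m" using N that by linarith
    then have "1 \<le> real m * (x - a)" using False by (simp add: field_simps)
    then show ?thesis by (simp add: soft_step_def)
  qed
  then have "eventually (\<lambda>m. soft_step m a x = 0) sequentially" by (auto simp: eventually_sequentially)
  then show ?thesis using False by (simp add: tendsto_eventually)
qed

locale brownian_time = brownian M W \<sigma> for M :: "'a measure" and W \<sigma> +
  fixes \<tau> :: "'a \<Rightarrow> ennreal"
  assumes random_time_tau: "random_time M \<tau>"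
begin

sublocale prob_filtration_time M F \<tau>
  by unfold_locales (rule random_time_tau)

lemma no_jump_test_product:
  assumes c: "0 \<le> c" and L: "L \<noteq> []" "\<forall>(v, h) \<in> set L. 0 \<le> v \<and> bounded_continuous h"
    "sorted_wrt (\<lambda>p q. fst q \<le> fst p) L" "fst (last L) = 0"
  shows "no_jump c (test_product L)"
proof -
  obtain u f L' where L': "L = (u, f) # L'" using L(1) by (metis neq_Nil_conv surj_pair)
  from test_product_continuous_version[of u f L', folded L', OF L(2,3,4)]
  obtain Y where "continuous_version (test_product L) u Y" by blast
  note cv = this[unfolded continuous_version_def]
  obtain K where K: "\<And>t \<omega>. 0 \<le> t \<Longrightarrow> \<bar>Y t \<omega>\<bar> \<le> K" using cv by blast
  have m: "Y t \<in> borel_measurable M" if "0 \<le> t" for t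
    using cv that measurable_from_subalg[OF sub_F] by blast
  have eb: "essentially_bounded (test_product L)"
  proof -
    have "0 \<le> u" "test_product L = Y u" using L(2) L' cv by auto
    then show ?thesis using K m by (intro essentially_boundedI[where K=K]) auto
  qed
  show ?thesis
  proof (rule no_jump_continuous_version[OF c eb, where Y=Y and K=K])
    show "AE \<omega> in M. continuous_on {0..c} (\<lambda>t. Y t \<omega>)"
      using AE_W_continuous by eventually_elim (use cv in \<open>auto intro: continuous_on_subset[of "{0..}"]\<close>)
  qed (use cv K m in auto)
qed

lemma no_jump_cylinder:
  assumes c: "0 \<le> c" and L: "\<forall>(u, a) \<in> set L. 0 \<le> u"
  shows "no_jump c (indicator (cylinder L))"
proof -
  define L' where "L' = rev (sort_key fst L)"
  have set_L': "set L' = set L" by (simp add: L'_def)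
  define T where "T m = map (\<lambda>(u, a). (u, soft_step m a)) L' @ [(0, \<lambda>_. 1)]" for m
  have T_eq: "test_product (T m) \<omega> = prod_list (map (\<lambda>(u, a). soft_step m a (W u \<omega>)) L')" for m \<omega>
    unfolding test_product_def T_def by (simp add: o_def case_prod_unfold)
  have bc: "bounded_continuous (soft_step m a)" for m a
    unfolding bounded_continuous_def
    using soft_step_bounds[of m a] by (auto simp: soft_step_def[abs_def] intro!: continuous_intros exI[of _ 1])
  have T_jump: "no_jump c (test_product (T m))" for m
  proof (rule no_jump_test_product[OF c])
    show "\<forall>(v, h)\<in>set (T m). 0 \<le> v \<and> bounded_continuous h"
      using L bc by (auto simp: T_def set_L' bounded_continuous_def[of "\<lambda>_. 1"])
    have "sorted_wrt (\<lambda>p q. fst p \<le> fst q) (sort_key fst L)"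
      using sorted_sort_key[of fst L] by (simp add: sorted_wrt_map)
    then have "sorted_wrt (\<lambda>p q. fst q \<le> fst p) L'" by (simp add: L'_def sorted_wrt_rev)
    then show "sorted_wrt (\<lambda>p q. fst q \<le> fst p) (T m)"
      using L by (auto simp: T_def sorted_wrt_append sorted_wrt_map set_L' split_beta)
  qed (simp_all add: T_def)
  have bounds: "0 \<le> prod_list (map (\<lambda>(u, a). soft_step m a (W u \<omega>)) xs) \<and>
     prod_list (map (\<lambda>(u, a). soft_step m a (W u \<omega>)) xs) \<le> 1" for m \<omega> xs
    by (induction xs) (auto simp: soft_step_bounds intro!: mult_le_one)
  have lim: "(\<lambda>m. prod_list (map (\<lambda>(u, a). soft_step m a (W u \<omega>)) xs)) \<longlonglongrightarrow>
     (if \<forall>(u, a) \<in> set xs. W u \<omega> \<le> a then 1 else 0)" for \<omega> xs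
  proof (induction xs)
    case (Cons p xs)
    obtain u a where p: "p = (u, a)" by (cases p)
    have "(if W u \<omega> \<le> a then 1 else 0) * (if \<forall>(u, a) \<in> set xs. W u \<omega> \<le> a then 1 else 0)
      = (if \<forall>(u, a) \<in> set (p # xs). W u \<omega> \<le> a then 1 else (0 :: real))" by (simp add: p)
    with tendsto_mult[OF soft_step_tendsto[of a "W u \<omega>"] Cons]
    show ?case by (simp only: p list.map prod_list.Cons prod.case)
  qed simp
  have cm [measurable]: "cylinder L \<in> sets M" by (rule cylinder_sets[OF L])
  show ?thesis
  proof (rule no_jump_L2_limit[OF c essentially_bounded_indicator[OF cm] T_jump])
    have Tm [measurable]: "test_product (T m) \<in> borel_measurable M" for m
      using T_jump by (simp add: no_jump_def essentially_bounded_def)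
    have "(\<lambda>m. \<integral>\<omega>. (indicator (cylinder L) \<omega> - test_product (T m) \<omega>)\<^sup>2 \<partial>M) \<longlonglongrightarrow> (\<integral>\<omega>. 0 \<partial>M)"
    proof (rule integral_dominated_convergence[where w="\<lambda>_. 1"])
      show "AE \<omega> in M. norm ((indicator (cylinder L) \<omega> - test_product (T m) \<omega>)\<^sup>2) \<le> 1" for m
      proof (rule AE_I2)
        fix \<omega>
        have "\<bar>indicator (cylinder L) \<omega> - test_product (T m) \<omega>\<bar> \<le> 1"
          using bounds[of m \<omega> L'] unfolding T_eq by (auto split: split_indicator)
        then show "norm ((indicator (cylinder L) \<omega> - test_product (T m) \<omega>)\<^sup>2) \<le> 1"
          by (simp add: abs_square_le_1)
      qed
      show "AE \<omega> in M. (\<lambda>m. (indicator (cylinder L) \<omega> - test_product (T m) \<omega>)\<^sup>2) \<longlonglongrightarrow> 0"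
      proof (rule AE_I2)
        fix \<omega> assume \<omega>: "\<omega> \<in> space M"
        have "(\<lambda>m. test_product (T m) \<omega>) \<longlonglongrightarrow> indicator (cylinder L) \<omega>"
        proof -
          have "indicator (cylinder L) \<omega> = (if \<forall>(u, a) \<in> set L'. W u \<omega> \<le> a then 1 else (0 :: real))"
            using \<omega> by (simp add: cylinder_def set_L' indicator_def)
          then show ?thesis using lim[of \<omega> L'] by (simp only: T_eq)
        qed
        then have "(\<lambda>m. (indicator (cylinder L) \<omega> - test_product (T m) \<omega>)\<^sup>2) \<longlonglongrightarrow> (indicator (cylinder L) \<omega> - indicator (cylinder L) \<omega> :: real)\<^sup>2"
          by (intro tendsto_intros)
        then show "(\<lambda>m. (indicator (cylinder L) \<omega> - test_product (T m) \<omega>)\<^sup>2) \<longlonglongrightarrow> 0" by simp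
      qed
    qed measurable
    then show "(\<lambda>m. \<integral>\<omega>. (indicator (cylinder L) \<omega> - test_product (T m) \<omega>)\<^sup>2 \<partial>M) \<longlonglongrightarrow> 0" by simp
  qed
qed

lemma no_jump_indicator:
  assumes c: "0 \<le> c" and D: "D \<in> sets (F c)"
  shows "no_jump c (indicator D)"
proof (rule no_jump_indicator_sigma_sets[OF c Int_stable_generators generators_sets])
  have top: "cylinder [] = space M" by (simp add: cylinder_def)
  show one: "no_jump c (\<lambda>_. 1)"
    using no_jump_test_product[OF c, of "[(0, \<lambda>_. 1)]"]
    by (auto simp: test_product_def[abs_def] bounded_continuous_def)
  show "D \<in> sigma_sets (space M) (cylinders c \<union> null_sets M)" using D by (simp add: sets_F_generators)
  fix A assume "A \<in> cylinders c \<union> null_sets M"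
  then show "no_jump c (indicator A)"
  proof
    assume "A \<in> cylinders c"
    then show ?thesis using no_jump_cylinder[OF c] by (auto simp: cylinders_def)
  next
    assume A: "A \<in> null_sets M"
    then have Am [measurable]: "A \<in> sets M" by auto
    show ?thesis
    proof (rule no_jump_L2_limit[OF c essentially_bounded_indicator[OF Am]])
      show "no_jump c (\<lambda>_. 0)" using no_jump_lincomb[OF one one, of 0 0] by simp
      have "(\<integral>\<omega>. (indicator A \<omega> - 0)\<^sup>2 \<partial>M) = (\<integral>\<omega>. 0 \<partial>M :: real)"
        using AE_not_in[OF A] by (intro integral_cong_AE) auto
      then show "(\<lambda>m. \<integral>\<omega>. (indicator A \<omega> - 0 :: real)\<^sup>2 \<partial>M) \<longlonglongrightarrow> 0" by simp
    qed
  qed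
qed

end

lemma floor_as_count:
  fixes x :: real
  assumes "0 \<le> x" "x \<le> real m"
  shows "(\<Sum>j<m. indicator {real (Suc j)..} x :: real) = real_of_int \<lfloor>x\<rfloor>"
proof -
  have "{j. j < m \<and> real (Suc j) \<le> x} = {..<nat \<lfloor>x\<rfloor>}"
  proof (intro set_eqI iffI)
    fix j assume "j \<in> {..<nat \<lfloor>x\<rfloor>}"
    then have "int (Suc j) \<le> \<lfloor>x\<rfloor>" by auto
    then have *: "real (Suc j) \<le> x" by (simp add: le_floor_iff)
    then have "j < m" using assms by linarith
    with * show "j \<in> {j. j < m \<and> real (Suc j) \<le> x}" by simp
  next
    fix j assume "j \<in> {j. j < m \<and> real (Suc j) \<le> x}"
    then have "int (Suc j) \<le> \<lfloor>x\<rfloor>" by (simp add: le_floor_iff)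
    then show "j \<in> {..<nat \<lfloor>x\<rfloor>}" by auto
  qed
  moreover have "(\<Sum>j<m. indicator {real (Suc j)..} x :: real) = (\<Sum>j\<in>{j. j < m \<and> real (Suc j) \<le> x}. 1)"
    by (rule sum.mono_neutral_cong_right) (auto split: split_indicator)
  ultimately show ?thesis using assms by simp
qed

context prob_filtration_time
begin

text \<open>
  The approximations round \<open>f\<close> down to multiples of \<open>c / m\<close>; rounding down counts the multiples that \<open>f\<close>
  exceeds, so they are finite sums of indicators.
\<close>

lemma no_jump_bounded_measurable:
  assumes c: "0 < c" and ind: "\<And>D. D \<in> sets (F c) \<Longrightarrow> no_jump c (indicator D)"
    and f: "f \<in> borel_measurable (F c)" "\<And>\<omega>. 0 \<le> f \<omega> \<and> f \<omega> \<le> c"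
  shows "no_jump c f"
proof -
  have c0: "0 \<le> c" using c by simp
  have fM: "f \<in> borel_measurable M" by (rule measurable_from_subalg[OF sub_F f(1)])
  define D where "D m j = {\<omega> \<in> space M. real (Suc j) \<le> f \<omega> * real (Suc m) / c}" for m j
  have D: "D m j \<in> sets (F c)" for m j
    unfolding D_def space_F[of c, symmetric] using f(1) by measurable
  define \<zeta> where "\<zeta> m \<omega> = (\<Sum>j<Suc m. c / real (Suc m) * indicator (D m j) \<omega>)" for m \<omega>
  have zero: "no_jump c (\<lambda>_. 0)" using no_jump_lincomb[OF ind ind, OF D D, of 0 0 0 0 0 0] by simp
  have \<zeta>: "no_jump c (\<zeta> m)" for m
  proof -
    have "no_jump c (\<lambda>\<omega>. \<Sum>j<k. c / real (Suc m) * indicator (D m j) \<omega>)" for k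
    proof (induction k)
      case (Suc k)
      show ?case using no_jump_lincomb[OF Suc ind[OF D[of m k]], of 1 "c / real (Suc m)"] by simp
    qed (simp add: zero)
    then show ?thesis unfolding \<zeta>_def[abs_def] .
  qed
  have close: "\<bar>f \<omega> - \<zeta> m \<omega>\<bar> \<le> c / real (Suc m)" if \<omega>: "\<omega> \<in> space M" for m \<omega>
  proof -
    define x where "x = f \<omega> * real (Suc m) / c"
    have "f \<omega> * real (Suc m) \<le> real (Suc m) * c" using f(2)[of \<omega>] by (simp add: mult.commute mult_right_mono)
    then have x: "0 \<le> x" "x \<le> real (Suc m)"
      using f(2)[of \<omega>] c unfolding x_def by (simp_all only: pos_divide_le_eq) simp
    have "\<zeta> m \<omega> = c / real (Suc m) * (\<Sum>j<Suc m. indicator {real (Suc j)..} x)"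
      unfolding \<zeta>_def sum_distrib_left
      by (rule sum.cong) (use \<omega> in \<open>auto simp: D_def x_def split: split_indicator\<close>)
    also have "\<dots> = c / real (Suc m) * real_of_int \<lfloor>x\<rfloor>" using x by (simp only: floor_as_count)
    finally have "f \<omega> - \<zeta> m \<omega> = c / real (Suc m) * (x - real_of_int \<lfloor>x\<rfloor>)"
      using c by (simp add: x_def right_diff_distrib)
    moreover have "0 \<le> x - real_of_int \<lfloor>x\<rfloor>" "x - real_of_int \<lfloor>x\<rfloor> \<le> 1" by linarith+
    moreover have "0 \<le> c / real (Suc m)" using c by simp
    ultimately show ?thesis by (simp only: abs_mult abs_of_nonneg mult_left_le)
  qed
  have feb: "essentially_bounded f" using f(2) fM by (intro essentially_boundedI[where K=c]) auto
  have \<zeta>eb: "essentially_bounded (\<zeta> m)" for m using \<zeta> by (simp add: no_jump_def)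
  show ?thesis
  proof (rule no_jump_L2_limit[OF c0 feb \<zeta>])
    show "(\<lambda>m. \<integral>\<omega>. (f \<omega> - \<zeta> m \<omega>)\<^sup>2 \<partial>M) \<longlonglongrightarrow> 0"
    proof (rule tendsto_sandwich)
      show "eventually (\<lambda>m. 0 \<le> (\<integral>\<omega>. (f \<omega> - \<zeta> m \<omega>)\<^sup>2 \<partial>M)) sequentially" by simp
      show "eventually (\<lambda>m. (\<integral>\<omega>. (f \<omega> - \<zeta> m \<omega>)\<^sup>2 \<partial>M) \<le> (c / real (Suc m))\<^sup>2) sequentially"
      proof (rule always_eventually, rule allI)
        fix m
        have "(\<integral>\<omega>. (f \<omega> - \<zeta> m \<omega>)\<^sup>2 \<partial>M) \<le> (\<integral>\<omega>. (c / real (Suc m))\<^sup>2 \<partial>M)"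
        proof (rule integral_mono)
          show "integrable M (\<lambda>\<omega>. (f \<omega> - \<zeta> m \<omega>)\<^sup>2)"
            by (intro essentially_bounded_integrable essentially_bounded_power2 essentially_bounded_diff feb \<zeta>eb)
          show "(f \<omega> - \<zeta> m \<omega>)\<^sup>2 \<le> (c / real (Suc m))\<^sup>2" if "\<omega> \<in> space M" for \<omega>
            using close[OF that, of m] c by (intro abs_le_square_iff[THEN iffD1]) (simp add: abs_of_pos)
        qed simp
        then show "(\<integral>\<omega>. (f \<omega> - \<zeta> m \<omega>)\<^sup>2 \<partial>M) \<le> (c / real (Suc m))\<^sup>2" by (simp add: prob_space)
      qed
      have "(\<lambda>m. (c / real (Suc m))\<^sup>2) \<longlonglongrightarrow> 0\<^sup>2" by (intro tendsto_power mesh_tendsto_0)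
      then show "(\<lambda>m. (c / real (Suc m))\<^sup>2) \<longlonglongrightarrow> 0" by simp
    qed simp
  qed
qed

end

section \<open>A continuous compensator implies avoidance\<close>

lemma capped_time:
  assumes "0 \<le> c"
  shows "ennreal (enn2real (min (\<eta> \<omega>) (ennreal c))) = min (\<eta> \<omega>) (ennreal c)"
    and "0 \<le> enn2real (min (\<eta> \<omega>) (ennreal c))"
    and "enn2real (min (\<eta> \<omega>) (ennreal c)) \<le> c"
proof -
  have "min (\<eta> \<omega>) (ennreal c) < top" by (simp add: min_less_iff_disj)
  then show *: "ennreal (enn2real (min (\<eta> \<omega>) (ennreal c))) = min (\<eta> \<omega>) (ennreal c)" by simp
  have "ennreal (enn2real (min (\<eta> \<omega>) (ennreal c))) \<le> ennreal c" unfolding * by simp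
  then show "enn2real (min (\<eta> \<omega>) (ennreal c)) \<le> c" using assms by simp
qed simp

lemma capped_time_le_iff:
  assumes "0 \<le> a" "a < c"
  shows "enn2real (min (\<eta> \<omega>) (ennreal c)) \<le> a \<longleftrightarrow> \<eta> \<omega> \<le> ennreal a"
proof -
  have "enn2real (min (\<eta> \<omega>) (ennreal c)) \<le> a \<longleftrightarrow> ennreal (enn2real (min (\<eta> \<omega>) (ennreal c))) \<le> ennreal a"
    using assms by simp
  also have "\<dots> \<longleftrightarrow> \<eta> \<omega> \<le> ennreal a"
    using assms by (subst capped_time(1)) (auto simp: min_le_iff_disj)
  finally show ?thesis .
qed

lemma (in prob_filtration) capped_stopping_time_measurable:
  assumes \<eta>: "extended_stopping_time F \<eta>" and c: "0 \<le> c"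
  shows "(\<lambda>\<omega>. enn2real (min (\<eta> \<omega>) (ennreal c))) \<in> borel_measurable (F c)"
proof (rule borel_measurableI_le)
  fix a
  let ?\<zeta> = "\<lambda>\<omega>. enn2real (min (\<eta> \<omega>) (ennreal c))"
  consider "a < 0" | "0 \<le> a" "a < c" | "c \<le> a" by linarith
  then show "{\<omega> \<in> space (F c). ?\<zeta> \<omega> \<le> a} \<in> sets (F c)"
  proof cases
    case 1
    have "\<not> ?\<zeta> \<omega> \<le> a" for \<omega> using 1 capped_time(2)[OF c, of \<eta> \<omega>] by linarith
    then have "{\<omega> \<in> space (F c). ?\<zeta> \<omega> \<le> a} = {}" by auto
    then show ?thesis by (simp only: sets.empty_sets)
  next
    case 2
    have "{\<omega> \<in> space M. \<eta> \<omega> \<le> ennreal a} \<in> sets (F a)"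
      using \<eta> 2 by (auto simp: extended_stopping_time_def pred_def space_F)
    then show ?thesis using mono_F[of a c] 2 by (auto simp: capped_time_le_iff space_F)
  next
    case 3
    have "?\<zeta> \<omega> \<le> a" for \<omega> using 3 capped_time(3)[OF c, of \<eta> \<omega>] by linarith
    then have "{\<omega> \<in> space (F c). ?\<zeta> \<omega> \<le> a} = space (F c)" by auto
    then show ?thesis by (simp only: sets.top)
  qed
qed

context prob_filtration_time
begin

text \<open>
  Here \<open>X k\<close> is the martingale closed by \<open>\<zeta>\<close> at the \<open>k\<close>-th grid point and \<open>S k\<close> the event that it announces
  \<open>\<eta>\<close> as imminent, that is \<open>X k\<close> is within \<open>\<delta>\<close> of the present time while \<open>\<eta>\<close> lies ahead.
  If \<open>\<tau> = \<eta>\<close> lies in the grid interval \<open>k\<close>, then either the martingale moves by at least \<open>\<delta> / 2\<close> over this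
  interval, which the energy controls, or \<open>S k\<close> occurs. In the second case \<open>\<tau>\<close> falls between the first
  announcement and the grid point after \<open>\<eta>\<close>. The mean number of such falls is the mean increase \<open>J\<close> of
  \<open>\<Lambda>\<close> over that period, whose length is at most \<open>R\<close>.
\<close>

lemma hit_probability_bound:
  assumes \<Lambda>: "predictable_compensator M G \<tau> \<Lambda>"
    and \<eta>: "extended_stopping_time F \<eta>" and c: "0 < c" and \<delta>: "0 < \<delta>" "c / real (Suc n) \<le> \<delta> / 2"
    and \<zeta>_def: "\<zeta> = (\<lambda>\<omega>. enn2real (min (\<eta> \<omega>) (ennreal c)))"
  shows "\<exists>J R. J \<in> borel_measurable M \<and> integrable M R \<and> (\<integral>\<omega>. \<bar>R \<omega>\<bar> \<partial>M) \<le> 2 * \<delta> \<and>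
    (AE \<omega> in M. \<exists>s t. 0 \<le> s \<and> s \<le> t \<and> t \<le> c \<and> t - s \<le> R \<omega> \<and> J \<omega> = \<Lambda> t \<omega> - \<Lambda> s \<omega>) \<and>
    measure M {\<omega> \<in> space M. \<tau> \<omega> = \<eta> \<omega> \<and> \<eta> \<omega> \<le> ennreal c} \<le> 4 / \<delta>\<^sup>2 * jump_energy c n \<zeta> + (\<integral>\<omega>. J \<omega> \<partial>M)"
proof -
  have c0: "0 \<le> c" using c by simp
  define h where "h = c / real (Suc n)"
  have h: "0 < h" "h \<le> \<delta> / 2" using c \<delta> by (auto simp: h_def)
  have gS: "grid c n (Suc k) = grid c n k + h" for k by (simp add: grid_Suc h_def)
  have gn: "0 \<le> grid c n k" for k by (rule grid_nonneg[OF c0])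
  have gc: "grid c n k \<le> c" if "k \<le> Suc n" for k by (rule grid_le[OF c0 that])
  have comp: "compensates M G \<tau> \<Lambda>" by (rule compensates_predictable_compensator(1)[OF \<Lambda>])
  interpret L: compensated_time M G \<tau> \<Lambda>
    by unfold_locales (use sub_G mono_G random_time comp in auto)
  have \<eta>_le: "{\<omega> \<in> space M. \<eta> \<omega> \<le> ennreal t} \<in> sets (F t)" if "0 \<le> t" for t
    using \<eta> that by (auto simp: extended_stopping_time_def pred_def space_F)
  have \<eta>_le_mono: "{\<omega> \<in> space M. \<eta> \<omega> \<le> ennreal s} \<in> sets (F t)" if "0 \<le> s" "s \<le> t" for s t
    using \<eta>_le[OF that(1)] mono_F[OF that(2)] by auto
  note \<zeta> = capped_time[OF c0, of \<eta>, folded \<zeta>_def[THEN fun_cong]]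
  have \<zeta>_le: "\<zeta> \<omega> \<le> a \<longleftrightarrow> \<eta> \<omega> \<le> ennreal a" if "0 \<le> a" "a < c" for a \<omega>
    using capped_time_le_iff[OF that] by (simp add: \<zeta>_def)
  have \<zeta>_meas: "\<zeta> \<in> borel_measurable (F c)"
    unfolding \<zeta>_def by (rule capped_stopping_time_measurable[OF \<eta> c0])
  have \<zeta>M [measurable]: "\<zeta> \<in> borel_measurable M" by (rule measurable_from_subalg[OF sub_F \<zeta>_meas])
  have \<zeta>eb: "essentially_bounded \<zeta>" by (rule essentially_boundedI[where K=c]) (use \<zeta> in auto)
  have \<zeta>i: "integrable M \<zeta>" by (rule essentially_bounded_integrable[OF \<zeta>eb])
  define X where "X k = real_cond_exp M (F (grid c n k)) \<zeta>" for k
  have XF: "X k \<in> borel_measurable (F (grid c n k))" for k by (simp add: X_def)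
  have X_known: "AE \<omega> in M. \<eta> \<omega> \<le> ennreal (grid c n k) \<longrightarrow> X k \<omega> = \<zeta> \<omega>" if k: "k \<le> Suc n" for k
  proof -
    let ?t = "grid c n k"
    interpret S: sigma_finite_subalgebra M "F ?t" by (rule sigma_finite_subalg)
    define A where "A = {\<omega> \<in> space M. \<eta> \<omega> \<le> ennreal ?t}"
    have A: "A \<in> sets (F ?t)" unfolding A_def by (rule \<eta>_le[OF gn])
    have AM [measurable]: "A \<in> sets M" using A sets_F_subset by auto
    have i: "integrable M (\<lambda>\<omega>. indicator A \<omega> * \<zeta> \<omega>)"
      by (intro essentially_bounded_integrable essentially_bounded_mult essentially_bounded_indicator \<zeta>eb AM)
    have "(\<lambda>\<omega>. indicator A \<omega> * \<zeta> \<omega>) \<in> borel_measurable (F ?t)"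
    proof (rule borel_measurableI_le)
      fix a
      consider "a < 0" | "0 \<le> a" "a < ?t" | "?t \<le> a" by linarith
      then show "{\<omega> \<in> space (F ?t). indicator A \<omega> * \<zeta> \<omega> \<le> a} \<in> sets (F ?t)"
      proof cases
        case 1
        have "0 \<le> indicator A \<omega> * \<zeta> \<omega>" for \<omega> using \<zeta>(2) by simp
        then have "{\<omega> \<in> space (F ?t). indicator A \<omega> * \<zeta> \<omega> \<le> a} = {}" using 1 by (auto simp: not_le intro: less_le_trans)
        then show ?thesis by (simp only: sets.empty_sets)
      next
        case 2
        then have "{\<omega> \<in> space (F ?t). indicator A \<omega> * \<zeta> \<omega> \<le> a} = (space (F ?t) - A) \<union> {\<omega> \<in> space M. \<eta> \<omega> \<le> ennreal a}"
          using gc[OF k] ennreal_leI[of a ?t] by (auto simp: \<zeta>_le A_def space_F split: split_indicator)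
        then show ?thesis using A \<eta>_le_mono[of a ?t] 2 by auto
      next
        case 3
        have "indicator A \<omega> * \<zeta> \<omega> \<le> a" for \<omega>
        proof (cases "\<omega> \<in> A")
          case True
          then have "ennreal (\<zeta> \<omega>) \<le> ennreal ?t" by (auto simp: A_def \<zeta>(1) min_le_iff_disj)
          then show ?thesis using gn[of k] 3 True by simp
        next
          case False
          then show ?thesis using gn[of k] 3 by simp
        qed
        then have "{\<omega> \<in> space (F ?t). indicator A \<omega> * \<zeta> \<omega> \<le> a} = space (F ?t)" by auto
        then show ?thesis by (simp only: sets.top)
      qed
    qed
    from S.real_cond_exp_F_meas[OF i this]
      S.real_cond_exp_mult[OF _ \<zeta>M i, OF borel_measurable_indicator[OF A]] AE_space
    show ?thesis by eventually_elim (auto simp: A_def X_def)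
  qed
  define S where "S k = {\<omega> \<in> space M. X k \<omega> \<le> grid c n k + \<delta> \<and> ennreal (grid c n k) < \<eta> \<omega>}" for k
  define V where "V k = {\<omega> \<in> space M. ennreal (grid c n k) < \<eta> \<omega>}" for k
  have VF: "V k \<in> sets (F (grid c n k))" for k
  proof -
    have "V k = space (F (grid c n k)) - {\<omega> \<in> space M. \<eta> \<omega> \<le> ennreal (grid c n k)}"
      by (auto simp: V_def space_F)
    then show ?thesis using \<eta>_le[OF gn] by auto
  qed
  have SF: "S j \<in> sets (F (grid c n k))" if "j \<le> k" for j k
  proof -
    have "S j = {\<omega> \<in> space (F (grid c n j)). X j \<omega> \<le> grid c n j + \<delta>} \<inter> V j" by (auto simp: S_def V_def space_F)
    also have "\<dots> \<in> sets (F (grid c n j))" using XF[of j] VF[of j] by measurable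
    finally show ?thesis using mono_F[OF grid_mono[OF c0 that]] by blast
  qed
  define First where "First k = S k - (\<Union>j<k. S j)" for k
  have FF: "First k \<in> sets (F (grid c n k))" for k
    unfolding First_def using SF by (intro sets.Diff sets.finite_UN) auto
  (* an announcement has been made and the stopping time is still ahead *)
  define U where "U k = V k \<inter> (\<Union>j\<le>k. S j)" for k
  have UF: "U k \<in> sets (F (grid c n k))" for k
    unfolding U_def using SF VF by (intro sets.Int sets.finite_UN) auto
  have M_sets [measurable]: "First k \<in> sets M" "U k \<in> sets M" "S k \<in> sets M" for k
    using FF UF SF[of k k] sets_F_subset by auto
  define J where "J \<omega> = (\<Sum>k\<le>n. indicator (U k) \<omega> * (\<Lambda> (grid c n (Suc k)) \<omega> - \<Lambda> (grid c n k) \<omega>))" for \<omega>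
  define R where "R \<omega> = (\<Sum>k\<le>n. indicator (First k) \<omega> * (\<zeta> \<omega> - grid c n k + h))" for \<omega>
  have \<Lambda>i: "integrable M (\<Lambda> (grid c n k))" for k by (rule L.integrable_A[OF gn])
  have Ui: "integrable M (\<lambda>\<omega>. indicator (U k) \<omega> * (\<Lambda> (grid c n (Suc k)) \<omega> - \<Lambda> (grid c n k) \<omega>))" for k
    unfolding mult.commute[of "indicator (U k) _"]
    by (intro integrable_real_mult_indicator Bochner_Integration.integrable_diff \<Lambda>i) measurable
  have J_meas: "J \<in> borel_measurable M"
    unfolding J_def by (intro borel_measurable_sum borel_measurable_integrable Ui)
  have First_nonneg: "0 \<le> indicator (First k) \<omega> * (\<zeta> \<omega> - grid c n k + h)" if "k \<le> n" for k \<omega>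
  proof (cases "\<omega> \<in> First k")
    case True
    then have "ennreal (grid c n k) \<le> ennreal (\<zeta> \<omega>)"
      using ennreal_leI[OF gc[of k]] that by (auto simp: First_def S_def \<zeta>(1))
    then have "grid c n k \<le> \<zeta> \<omega>" using \<zeta>(2) by simp
    then show ?thesis using h by simp
  qed simp
  have Ri: "integrable M (\<lambda>\<omega>. indicator (First k) \<omega> * (\<zeta> \<omega> - grid c n k + h))" for k
    by (intro essentially_bounded_integrable essentially_bounded_mult essentially_bounded_indicator
      essentially_bounded_add essentially_bounded_diff essentially_bounded_const \<zeta>eb) measurable
  have R_int: "integrable M R" unfolding R_def by (intro Bochner_Integration.integrable_sum Ri)
  have R_bound: "(\<integral>\<omega>. \<bar>R \<omega>\<bar> \<partial>M) \<le> 2 * \<delta>"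
  proof -
    have "(\<integral>\<omega>. \<bar>R \<omega>\<bar> \<partial>M) = (\<integral>\<omega>. R \<omega> \<partial>M)"
      by (rule Bochner_Integration.integral_cong[OF refl], rule abs_of_nonneg)
        (unfold R_def, intro sum_nonneg First_nonneg, simp)
    also have "\<dots> = (\<Sum>k\<le>n. \<integral>\<omega>. indicator (First k) \<omega> * (\<zeta> \<omega> - grid c n k + h) \<partial>M)"
      unfolding R_def by (rule Bochner_Integration.integral_sum) (rule Ri)
    also have "\<dots> \<le> (\<Sum>k\<le>n. (\<delta> + h) * measure M (First k))"
    proof (rule sum_mono)
      fix k
      interpret S: sigma_finite_subalgebra M "F (grid c n k)" by (rule sigma_finite_subalg)
      have Xi: "integrable M (X k)" unfolding X_def by (rule S.real_cond_exp_int(1)[OF \<zeta>i])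
      have m: "integrable M (\<lambda>\<omega>. indicator (First k) \<omega> * g \<omega>)" if "integrable M g" for g :: "'a \<Rightarrow> real"
        unfolding mult.commute[of "indicator (First k) _"]
        by (rule integrable_real_mult_indicator[OF _ that]) measurable
      have ci: "integrable M (\<lambda>_. a :: real)" for a by simp
      have "(\<integral>\<omega>. indicator (First k) \<omega> * \<zeta> \<omega> \<partial>M) = (\<integral>\<omega>. indicator (First k) \<omega> * X k \<omega> \<partial>M)"
        using S.real_cond_exp_intA[OF \<zeta>i FF] by (simp add: set_lebesgue_integral_def X_def)
      moreover have "(\<integral>\<omega>. indicator (First k) \<omega> * (\<zeta> \<omega> - grid c n k + h) \<partial>M)
         = (\<integral>\<omega>. indicator (First k) \<omega> * \<zeta> \<omega> \<partial>M) + (\<integral>\<omega>. indicator (First k) \<omega> * (h - grid c n k) \<partial>M)"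
        using m[OF \<zeta>i] m[OF ci] by (subst Bochner_Integration.integral_add[symmetric]) (auto simp: algebra_simps)
      moreover have "(\<integral>\<omega>. indicator (First k) \<omega> * X k \<omega> \<partial>M) + (\<integral>\<omega>. indicator (First k) \<omega> * (h - grid c n k) \<partial>M)
         = (\<integral>\<omega>. indicator (First k) \<omega> * (X k \<omega> - grid c n k + h) \<partial>M)"
        using m[OF Xi] m[OF ci] by (subst Bochner_Integration.integral_add[symmetric]) (auto simp: algebra_simps)
      moreover have "(\<integral>\<omega>. indicator (First k) \<omega> * (X k \<omega> - grid c n k + h) \<partial>M) \<le> (\<integral>\<omega>. indicator (First k) \<omega> * (\<delta> + h) \<partial>M)"
      proof (rule integral_mono)
        show "integrable M (\<lambda>\<omega>. indicator (First k) \<omega> * (X k \<omega> - grid c n k + h))"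
          by (intro m Bochner_Integration.integrable_add Bochner_Integration.integrable_diff Xi ci)
      qed (use m[OF ci] in \<open>auto simp: First_def S_def split: split_indicator\<close>)
      ultimately show "(\<integral>\<omega>. indicator (First k) \<omega> * (\<zeta> \<omega> - grid c n k + h) \<partial>M) \<le> (\<delta> + h) * measure M (First k)"
        by (simp add: mult.commute)
    qed
    also have "\<dots> = (\<delta> + h) * (\<Sum>k\<le>n. measure M (First k))" by (simp add: sum_distrib_left)
    also have "(\<Sum>k\<le>n. measure M (First k)) = measure M (\<Union>k\<le>n. First k)"
    proof (rule finite_measure_finite_Union[symmetric])
      have False if "\<omega> \<in> First i" "\<omega> \<in> First j" "i < j" for \<omega> i j using that by (auto simp: First_def)
      then show "disjoint_family_on First {..n}"
        unfolding disjoint_family_on_def by (metis disjoint_iff linorder_neqE_nat)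
    qed auto
    also have "(\<delta> + h) * measure M (\<Union>k\<le>n. First k) \<le> (\<delta> + h) * 1"
      using \<delta> h by (intro mult_left_mono prob_le_1) auto
    also have "\<dots> \<le> 2 * \<delta>" using h \<delta> by simp
    finally show ?thesis .
  qed
  have path: "AE \<omega> in M. \<exists>s t. 0 \<le> s \<and> s \<le> t \<and> t \<le> c \<and> t - s \<le> R \<omega> \<and> J \<omega> = \<Lambda> t \<omega> - \<Lambda> s \<omega>"
  proof (rule AE_I2)
    fix \<omega> assume \<omega>: "\<omega> \<in> space M"
    show "\<exists>s t. 0 \<le> s \<and> s \<le> t \<and> t \<le> c \<and> t - s \<le> R \<omega> \<and> J \<omega> = \<Lambda> t \<omega> - \<Lambda> s \<omega>"
    proof (cases "\<exists>k\<le>n. \<omega> \<in> S k")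
      case False
      then have "J \<omega> = 0" "R \<omega> = 0"
        unfolding J_def R_def by (auto intro!: sum.neutral simp: U_def First_def split: split_indicator)
      then show ?thesis using c by (intro exI[of _ 0]) auto
    next
      case True
      define \<kappa> where "\<kappa> = (LEAST k. \<omega> \<in> S k)"
      have \<kappa>: "\<omega> \<in> S \<kappa>" unfolding \<kappa>_def using True by (metis LeastI)
      have \<kappa>_least: "\<kappa> \<le> k" if "\<omega> \<in> S k" for k unfolding \<kappa>_def using that by (rule Least_le)
      have \<kappa>n: "\<kappa> \<le> n" using True \<kappa>_least by (meson order_trans)
      (* the first grid point at or after the stopping time, or the end of the grid *)
      define q where "q = (LEAST k. k = Suc n \<or> \<omega> \<notin> V k)"
      have q: "q = Suc n \<or> \<omega> \<notin> V q" unfolding q_def by (rule LeastI[of _ "Suc n"]) simp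
      have q_le: "q \<le> Suc n" unfolding q_def by (rule Least_le) simp
      have V_below: "\<omega> \<in> V k" if "k < q" for k
        using not_less_Least[of k "\<lambda>k. k = Suc n \<or> \<omega> \<notin> V k"] that unfolding q_def by auto
      have V_above: "\<omega> \<notin> V k" if "q \<le> k" "k \<le> n" for k
        using q that ennreal_leI[OF grid_mono[OF c0 that(1), of n]] \<omega>
        by (auto simp: V_def not_less intro: order_trans)
      have \<kappa>V: "\<omega> \<in> V \<kappa>" using \<kappa> by (auto simp: S_def V_def)
      have \<kappa>q: "\<kappa> < q" using V_above[of \<kappa>] \<kappa>V \<kappa>n by (meson not_le)
      have U_iff: "\<omega> \<in> U k \<longleftrightarrow> \<kappa> \<le> k \<and> k < q" if "k \<le> n" for k
      proof
        assume "\<omega> \<in> U k"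
        then obtain j where "\<omega> \<in> V k" "j \<le> k" "\<omega> \<in> S j" by (auto simp: U_def)
        then show "\<kappa> \<le> k \<and> k < q" using \<kappa>_least[of j] V_above[of k] that by (meson le_trans not_le)
      qed (use \<kappa> V_below in \<open>auto simp: U_def\<close>)
      have "J \<omega> = (\<Sum>k\<in>{\<kappa>..<q}. \<Lambda> (grid c n (Suc k)) \<omega> - \<Lambda> (grid c n k) \<omega>)"
        unfolding J_def
      proof (rule sum.mono_neutral_cong_right)
        show "{\<kappa>..<q} \<subseteq> {..n}" using q_le by auto
        show "\<forall>k\<in>{..n} - {\<kappa>..<q}. indicator (U k) \<omega> * (\<Lambda> (grid c n (Suc k)) \<omega> - \<Lambda> (grid c n k) \<omega>) = 0"
          using U_iff by auto
        show "indicator (U k) \<omega> * (\<Lambda> (grid c n (Suc k)) \<omega> - \<Lambda> (grid c n k) \<omega>) = \<Lambda> (grid c n (Suc k)) \<omega> - \<Lambda> (grid c n k) \<omega>"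
          if "k \<in> {\<kappa>..<q}" for k using U_iff[of k] q_le that by auto
      qed simp
      also have "\<dots> = \<Lambda> (grid c n q) \<omega> - \<Lambda> (grid c n \<kappa>) \<omega>"
        using \<kappa>q by (intro sum_Suc_diff') simp
      finally have J_eq: "J \<omega> = \<Lambda> (grid c n q) \<omega> - \<Lambda> (grid c n \<kappa>) \<omega>" .
      have First_\<kappa>: "\<omega> \<in> First \<kappa>" unfolding First_def using \<kappa> \<kappa>_least by (auto simp: not_less[symmetric])
      have "indicator (First \<kappa>) \<omega> * (\<zeta> \<omega> - grid c n \<kappa> + h) \<le> R \<omega>"
        unfolding R_def using \<kappa>n First_nonneg by (intro member_le_sum) auto
      then have R_ge: "\<zeta> \<omega> - grid c n \<kappa> + h \<le> R \<omega>" using First_\<kappa> by simp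
      obtain p where p: "q = Suc p" using \<kappa>q by (cases q) auto
      have "ennreal (grid c n p) \<le> ennreal (\<zeta> \<omega>)"
        using V_below[of p] p q_le ennreal_leI[OF gc[of p]] by (auto simp: V_def \<zeta>(1))
      then have "grid c n p \<le> \<zeta> \<omega>" using \<zeta>(2) by simp
      then have "grid c n q - grid c n \<kappa> \<le> R \<omega>" using R_ge by (simp add: p gS)
      then show ?thesis
        using J_eq gn gc[OF q_le] grid_mono[OF c0 less_imp_le[OF \<kappa>q]] by blast
    qed
  qed
  have hit: "measure M {\<omega> \<in> space M. \<tau> \<omega> = \<eta> \<omega> \<and> \<eta> \<omega> \<le> ennreal c} \<le> 4 / \<delta>\<^sup>2 * jump_energy c n \<zeta> + (\<integral>\<omega>. J \<omega> \<partial>M)"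
  proof -
    define E where "E = {\<omega> \<in> space M. \<tau> \<omega> = \<eta> \<omega> \<and> \<eta> \<omega> \<le> ennreal c}"
    have "E = {\<omega> \<in> space M. \<tau> \<omega> \<le> ennreal c \<and> \<tau> \<omega> = ennreal (\<zeta> \<omega>)} \<inter> {\<omega> \<in> space M. \<eta> \<omega> \<le> ennreal c}"
      unfolding E_def \<zeta>(1) by (auto simp: min_def)
    moreover have "{\<omega> \<in> space M. \<eta> \<omega> \<le> ennreal c} \<in> sets M" using \<eta>_le[OF c0] sets_F_subset by auto
    ultimately have E [measurable]: "E \<in> sets M" by simp
    define b where "b k \<omega> = 4 / \<delta>\<^sup>2 * (indicator (slot c n k) \<omega> * (jump c n k \<zeta> \<omega>)\<^sup>2) + indicator (U k \<inter> slot c n k) \<omega>" for k \<omega>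
    define B where "B \<omega> = (\<Sum>k\<le>n. b k \<omega>)" for \<omega>
    note ji = integrable_jump_energy[OF \<zeta>eb, of c n]
    have ui: "integrable M (indicator (U k \<inter> slot c n k) :: 'a \<Rightarrow> real)" for k
      by (intro essentially_bounded_integrable essentially_bounded_indicator) measurable
    have bi: "integrable M (b k)" for k unfolding b_def[abs_def] using ji ui by auto
    have Bi: "integrable M B" unfolding B_def by (intro Bochner_Integration.integrable_sum bi)
    have b_nonneg: "0 \<le> b k \<omega>" for k \<omega> by (simp add: b_def)
    have known: "AE \<omega> in M. \<forall>k\<in>{..Suc n}. \<eta> \<omega> \<le> ennreal (grid c n k) \<longrightarrow> X k \<omega> = \<zeta> \<omega>"
      by (rule AE_ball_countable'[OF X_known]) auto
    have "AE \<omega> in M. indicator E \<omega> \<le> B \<omega>"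
      using known AE_space
    proof eventually_elim
      case (elim \<omega>)
      show ?case
      proof (cases "\<omega> \<in> E")
        case False
        then show ?thesis unfolding B_def by (auto intro!: sum_nonneg b_nonneg)
      next
        case True
        then have eq: "\<tau> \<omega> = \<eta> \<omega>" "\<eta> \<omega> \<le> ennreal c" by (auto simp: E_def)
        have pos: "0 < \<tau> \<omega>" using random_time elim(2) by (auto simp: random_time_def)
        define q where "q = (LEAST k. \<eta> \<omega> \<le> ennreal (grid c n k))"
        have q: "\<eta> \<omega> \<le> ennreal (grid c n q)" unfolding q_def by (rule LeastI[of _ "Suc n"]) (use eq in simp)
        have q_le: "q \<le> Suc n" unfolding q_def by (rule Least_le) (use eq in simp)
        have "q \<noteq> 0"
        proof
          assume "q = 0"
          then have "\<eta> \<omega> \<le> 0" using q by simp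
          then show False using pos eq by simp
        qed
        then obtain k where k: "q = Suc k" by (cases q) auto
        have below: "ennreal (grid c n k) < \<eta> \<omega>"
          using not_less_Least[of k "\<lambda>k. \<eta> \<omega> \<le> ennreal (grid c n k)"] k unfolding q_def by auto
        have slot: "\<omega> \<in> slot c n k" unfolding slot_def using elim(2) eq below q k by auto
        have kn: "k \<le> n" using q_le k by simp
        have Xq: "X (Suc k) \<omega> = \<zeta> \<omega>" using elim(1) q q_le k by auto
        have "ennreal (\<zeta> \<omega>) \<le> ennreal (grid c n (Suc k))" using q k by (simp add: \<zeta>(1) min_le_iff_disj)
        then have \<zeta>q: "\<zeta> \<omega> \<le> grid c n k + h" using gn[of "Suc k"] by (simp add: gS)
        have "1 \<le> b k \<omega>"
        proof (cases "\<omega> \<in> S k")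
          case True
          then have "\<omega> \<in> U k" by (auto simp: U_def S_def V_def)
          then show ?thesis using slot by (simp add: b_def)
        next
          case False
          then have "grid c n k + \<delta> < X k \<omega>" using below elim(2) by (auto simp: S_def)
          then have "jump c n k \<zeta> \<omega> \<le> - (\<delta> / 2)"
            using \<zeta>q h(2) Xq by (simp add: jump_def X_def[symmetric])
          then have "\<bar>\<delta> / 2\<bar> \<le> \<bar>jump c n k \<zeta> \<omega>\<bar>" using \<delta> by simp
          then have "(\<delta> / 2)\<^sup>2 \<le> (jump c n k \<zeta> \<omega>)\<^sup>2" by (simp only: abs_le_square_iff)
          then have "1 \<le> 4 / \<delta>\<^sup>2 * (jump c n k \<zeta> \<omega>)\<^sup>2" using \<delta> by (simp add: field_simps power2_eq_square)
          then show ?thesis using slot by (simp add: b_def add_increasing2)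
        qed
        also have "\<dots> \<le> B \<omega>" unfolding B_def using kn b_nonneg by (intro member_le_sum) auto
        finally show ?thesis using True by simp
      qed
    qed
    then have "(\<integral>\<omega>. indicator E \<omega> \<partial>M) \<le> (\<integral>\<omega>. B \<omega> \<partial>M)"
      using essentially_bounded_integrable[OF essentially_bounded_indicator[OF E]] Bi by (intro integral_mono_AE)
    also have "(\<integral>\<omega>. B \<omega> \<partial>M) = (\<Sum>k\<le>n. \<integral>\<omega>. b k \<omega> \<partial>M)"
      unfolding B_def by (rule Bochner_Integration.integral_sum) (rule bi)
    also have "\<dots> = (\<Sum>k\<le>n. 4 / \<delta>\<^sup>2 * (\<integral>\<omega>. indicator (slot c n k) \<omega> * (jump c n k \<zeta> \<omega>)\<^sup>2 \<partial>M) + measure M (U k \<inter> slot c n k))"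
    proof (rule sum.cong[OF refl])
      fix k
      have "(\<integral>\<omega>. indicator (U k \<inter> slot c n k) \<omega> \<partial>M) = measure M (U k \<inter> slot c n k)"
        using sets.sets_into_space[OF slot_sets[of c n k]] by (simp add: Int_absorb2 Int_assoc)
      then show "(\<integral>\<omega>. b k \<omega> \<partial>M) =
          4 / \<delta>\<^sup>2 * (\<integral>\<omega>. indicator (slot c n k) \<omega> * (jump c n k \<zeta> \<omega>)\<^sup>2 \<partial>M) + measure M (U k \<inter> slot c n k)"
        unfolding b_def using ji ui by (subst Bochner_Integration.integral_add) auto
    qed
    also have "\<dots> = 4 / \<delta>\<^sup>2 * jump_energy c n \<zeta> + (\<Sum>k\<le>n. measure M (U k \<inter> slot c n k))"
      by (simp add: jump_energy_def sum.distrib sum_distrib_left)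
    also have "(\<Sum>k\<le>n. measure M (U k \<inter> slot c n k)) = (\<integral>\<omega>. J \<omega> \<partial>M)"
    proof -
      have "measure M (U k \<inter> slot c n k) = (\<integral>\<omega>. indicator (U k) \<omega> * (\<Lambda> (grid c n (Suc k)) \<omega> - \<Lambda> (grid c n k) \<omega>) \<partial>M)" for k
      proof -
        have "U k \<in> sets (G (grid c n k))" using UF F_subset_G by blast
        from L.integral_increment[OF gn grid_mono[OF c0] this, of "Suc k"]
        have "(\<integral>\<omega>. indicator (U k) \<omega> * (\<Lambda> (grid c n (Suc k)) \<omega> - \<Lambda> (grid c n k) \<omega>) \<partial>M)
          = measure M {\<omega> \<in> space M. \<omega> \<in> U k \<and> ennreal (grid c n k) < \<tau> \<omega> \<and> \<tau> \<omega> \<le> ennreal (grid c n (Suc k))}" by simp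
        also have "{\<omega> \<in> space M. \<omega> \<in> U k \<and> ennreal (grid c n k) < \<tau> \<omega> \<and> \<tau> \<omega> \<le> ennreal (grid c n (Suc k))} = U k \<inter> slot c n k"
          by (auto simp: slot_def)
        finally show ?thesis by simp
      qed
      then show ?thesis unfolding J_def by (subst Bochner_Integration.integral_sum) (auto intro: Ui)
    qed
    finally show ?thesis unfolding E_def[symmetric] using sets.sets_into_space[OF E] by (simp add: Int_absorb2)
  qed
  from J_meas R_int R_bound path hit show ?thesis by blast
qed

end

text \<open>
  Take \<open>\<delta> = 1 / m\<close> and a grid so fine that the energy term is below \<open>\<delta>\<close>. The lengths \<open>R\<close> tend to \<open>0\<close> in
  mean, hence almost surely along a subsequence; uniform continuity of \<open>\<Lambda>\<close> on the interval up to \<open>c\<close>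
  then sends the increments \<open>J\<close> to \<open>0\<close>, dominated by \<open>\<Lambda> c - \<Lambda> 0\<close>.
\<close>

lemma (in prob_filtration_time) compensator_continuous_imp_avoids:
  assumes \<Lambda>: "predictable_compensator M G \<tau> \<Lambda>"
    and cont: "AE \<omega> in M. continuous_on {0..} (\<lambda>t. \<Lambda> t \<omega>)"
    and no_jump: "\<And>c D. 0 < c \<Longrightarrow> D \<in> sets (F c) \<Longrightarrow> no_jump c (indicator D)"
  shows "avoids_stopping_times M F \<tau>"
  unfolding avoids_stopping_times_def
proof (intro allI impI)
  fix \<eta> assume \<eta>: "extended_stopping_time F \<eta>"
  have \<eta>_sets: "{\<omega> \<in> space M. \<eta> \<omega> \<le> ennreal c} \<in> sets M" if "0 \<le> c" for c
    using \<eta> that sets_F_subset[of c] by (auto simp: extended_stopping_time_def pred_def space_F)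
  have hit_sets: "{\<omega> \<in> space M. \<tau> \<omega> = \<eta> \<omega> \<and> \<eta> \<omega> \<le> ennreal c} \<in> sets M" if c: "0 < c" for c
  proof -
    let ?\<zeta> = "\<lambda>\<omega>. enn2real (min (\<eta> \<omega>) (ennreal c))"
    have [measurable]: "?\<zeta> \<in> borel_measurable M"
      using c by (intro measurable_from_subalg[OF sub_F capped_stopping_time_measurable[OF \<eta>]]) auto
    have "{\<omega> \<in> space M. \<tau> \<omega> = \<eta> \<omega> \<and> \<eta> \<omega> \<le> ennreal c}
        = {\<omega> \<in> space M. \<tau> \<omega> \<le> ennreal c \<and> \<tau> \<omega> = ennreal (?\<zeta> \<omega>)} \<inter> {\<omega> \<in> space M. \<eta> \<omega> \<le> ennreal c}"
      using c by (subst capped_time(1)) (auto simp: min_def)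
    then show ?thesis using \<eta>_sets[of c] c by simp
  qed
  have null: "measure M {\<omega> \<in> space M. \<tau> \<omega> = \<eta> \<omega> \<and> \<eta> \<omega> \<le> ennreal c} = 0" if c: "0 < c" for c
  proof -
    define \<zeta> where "\<zeta> = (\<lambda>\<omega>. enn2real (min (\<eta> \<omega>) (ennreal c)))"
    define p where "p = measure M {\<omega> \<in> space M. \<tau> \<omega> = \<eta> \<omega> \<and> \<eta> \<omega> \<le> ennreal c}"
    define \<delta> where "\<delta> m = inverse (real (Suc m))" for m
    have \<delta>: "0 < \<delta> m" for m by (simp add: \<delta>_def)
    have \<delta>0: "\<delta> \<longlonglongrightarrow> 0" unfolding \<delta>_def by (rule LIMSEQ_inverse_real_of_nat)
    have c0: "0 \<le> c" using c by simp
    have "no_jump c \<zeta>"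
      unfolding \<zeta>_def
      by (rule no_jump_bounded_measurable[OF c no_jump[OF c] capped_stopping_time_measurable[OF \<eta> c0]])
        (auto simp: capped_time[OF c0])
    then have energy: "(\<lambda>n. jump_energy c n \<zeta>) \<longlonglongrightarrow> 0" by (simp add: no_jump_def)
    have "\<exists>n. c / real (Suc n) \<le> \<delta> m / 2 \<and> 4 / (\<delta> m)\<^sup>2 * jump_energy c n \<zeta> \<le> \<delta> m" for m
    proof -
      have "(\<lambda>n. 4 / (\<delta> m)\<^sup>2 * jump_energy c n \<zeta>) \<longlonglongrightarrow> 4 / (\<delta> m)\<^sup>2 * 0"
        by (intro tendsto_intros energy)
      then have "eventually (\<lambda>n. 4 / (\<delta> m)\<^sup>2 * jump_energy c n \<zeta> < \<delta> m) sequentially"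
        using \<delta>[of m] by (intro order_tendstoD(2)) auto
      moreover have "eventually (\<lambda>n. c / real (Suc n) < \<delta> m / 2) sequentially"
        using \<delta>[of m] by (intro order_tendstoD(2)[OF mesh_tendsto_0]) auto
      ultimately have "eventually (\<lambda>n. c / real (Suc n) \<le> \<delta> m / 2 \<and> 4 / (\<delta> m)\<^sup>2 * jump_energy c n \<zeta> \<le> \<delta> m) sequentially"
        by eventually_elim auto
      then show ?thesis by (auto simp: eventually_sequentially)
    qed
    then obtain n where n: "\<And>m. c / real (Suc (n m)) \<le> \<delta> m / 2"
      "\<And>m. 4 / (\<delta> m)\<^sup>2 * jump_energy c (n m) \<zeta> \<le> \<delta> m" by metis
    define good where "good m J R \<longleftrightarrow> J \<in> borel_measurable M \<and> integrable M R \<and> (\<integral>\<omega>. \<bar>R \<omega>\<bar> \<partial>M) \<le> 2 * \<delta> m \<and>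
      (AE \<omega> in M. \<exists>s t. 0 \<le> s \<and> s \<le> t \<and> t \<le> c \<and> t - s \<le> R \<omega> \<and> J \<omega> = \<Lambda> t \<omega> - \<Lambda> s \<omega>) \<and>
      p \<le> 4 / (\<delta> m)\<^sup>2 * jump_energy c (n m) \<zeta> + (\<integral>\<omega>. J \<omega> \<partial>M)" for m J R
    have "\<forall>m. \<exists>J R. good m J R"
      unfolding good_def p_def using hit_probability_bound[OF \<Lambda> \<eta> c \<delta> n(1) \<zeta>_def] by blast
    then obtain J R where "\<And>m. good m (J m) (R m)" by metis
    then have J: "\<And>m. J m \<in> borel_measurable M" and Ri: "\<And>m. integrable M (R m)"
      and R: "\<And>m. (\<integral>\<omega>. \<bar>R m \<omega>\<bar> \<partial>M) \<le> 2 * \<delta> m"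
      and path: "\<And>m. AE \<omega> in M. \<exists>s t. 0 \<le> s \<and> s \<le> t \<and> t \<le> c \<and> t - s \<le> R m \<omega> \<and> J m \<omega> = \<Lambda> t \<omega> - \<Lambda> s \<omega>"
      and hit: "\<And>m. p \<le> 4 / (\<delta> m)\<^sup>2 * jump_energy c (n m) \<zeta> + (\<integral>\<omega>. J m \<omega> \<partial>M)" by (simp_all add: good_def)
    have "(\<lambda>m. \<integral>\<omega>. norm (R m \<omega>) \<partial>M) \<longlonglongrightarrow> 0"
    proof (rule tendsto_sandwich[where f="\<lambda>_. 0" and h="\<lambda>m. 2 * \<delta> m"])
      show "(\<lambda>m. 2 * \<delta> m) \<longlonglongrightarrow> 0" using tendsto_mult_right_zero[OF \<delta>0, of 2] by simp
      show "eventually (\<lambda>m. (\<integral>\<omega>. norm (R m \<omega>) \<partial>M) \<le> 2 * \<delta> m) sequentially" using R by simp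
    qed simp_all
    from tendsto_L1_AE_subseq[OF Ri this] obtain r where r: "strict_mono r"
      and R0: "AE \<omega> in M. (\<lambda>m. R (r m) \<omega>) \<longlonglongrightarrow> 0" by blast
    have comp: "compensates M G \<tau> \<Lambda>" by (rule compensates_predictable_compensator(1)[OF \<Lambda>])
    have \<Lambda>i: "integrable M (\<Lambda> 0)" "integrable M (\<Lambda> c)" using comp c by (auto simp: compensates_def)
    have inc: "AE \<omega> in M. mono_on {0..} (\<lambda>t. \<Lambda> t \<omega>)"
      using \<Lambda> unfolding predictable_compensator_def increasing_process_def by auto
    have paths: "AE \<omega> in M. \<forall>m. \<exists>s t. 0 \<le> s \<and> s \<le> t \<and> t \<le> c \<and> t - s \<le> R m \<omega> \<and> J m \<omega> = \<Lambda> t \<omega> - \<Lambda> s \<omega>"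
      using path by (simp add: AE_all_countable)
    have "(\<lambda>m. \<integral>\<omega>. J (r m) \<omega> \<partial>M) \<longlonglongrightarrow> (\<integral>\<omega>. 0 \<partial>M)"
    proof (rule integral_dominated_convergence[where w="\<lambda>\<omega>. \<Lambda> c \<omega> - \<Lambda> 0 \<omega>"])
      show "integrable M (\<lambda>\<omega>. \<Lambda> c \<omega> - \<Lambda> 0 \<omega>)" using \<Lambda>i by simp
      show "AE \<omega> in M. norm (J (r m) \<omega>) \<le> \<Lambda> c \<omega> - \<Lambda> 0 \<omega>" for m
        using path[of "r m"] inc
      proof eventually_elim
        case (elim \<omega>)
        then obtain s t where st: "0 \<le> s" "s \<le> t" "t \<le> c" "J (r m) \<omega> = \<Lambda> t \<omega> - \<Lambda> s \<omega>" by blast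
        then show ?case
          using mono_onD[OF elim(2), of 0 s] mono_onD[OF elim(2), of s t] mono_onD[OF elim(2), of t c] by simp
      qed
      show "AE \<omega> in M. (\<lambda>m. J (r m) \<omega>) \<longlonglongrightarrow> 0"
        using R0 paths cont
      proof eventually_elim
        case (elim \<omega>)
        have "continuous_on {0..c} (\<lambda>t. \<Lambda> t \<omega>)" using elim(3) by (rule continuous_on_subset) auto
        then have uc: "uniformly_continuous_on {0..c} (\<lambda>t. \<Lambda> t \<omega>)"
          by (rule compact_uniformly_continuous) simp
        show ?case
        proof (rule LIMSEQ_I)
          fix e :: real assume "0 < e"
          from uc[unfolded uniformly_continuous_on_def, rule_format, OF this] obtain d where d: "0 < d"
            "\<And>s t. s \<in> {0..c} \<Longrightarrow> t \<in> {0..c} \<Longrightarrow> dist t s < d \<Longrightarrow> dist (\<Lambda> t \<omega>) (\<Lambda> s \<omega>) < e" by blast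
          obtain m0 where m0: "\<And>m. m0 \<le> m \<Longrightarrow> R (r m) \<omega> < d"
            using order_tendstoD(2)[OF elim(1) d(1)] by (auto simp: eventually_sequentially)
          have "norm (J (r m) \<omega> - 0) < e" if m: "m0 \<le> m" for m
          proof -
            obtain s t where st: "0 \<le> s" "s \<le> t" "t \<le> c" "t - s \<le> R (r m) \<omega>" "J (r m) \<omega> = \<Lambda> t \<omega> - \<Lambda> s \<omega>"
              using elim(2) by blast
            then have "dist t s < d" using m0[OF m] by (simp add: dist_real_def)
            then show ?thesis using d(2)[of s t] st by (simp add: dist_real_def)
          qed
          then show "\<exists>m0. \<forall>m\<ge>m0. norm (J (r m) \<omega> - 0) < e" by blast
        qed
      qed
    qed (use J in auto)
    then have "(\<lambda>m. \<delta> (r m) + (\<integral>\<omega>. J (r m) \<omega> \<partial>M)) \<longlonglongrightarrow> 0 + 0"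
      using LIMSEQ_subseq_LIMSEQ[OF \<delta>0 r] by (intro tendsto_add) (simp_all add: o_def)
    moreover have "p \<le> \<delta> (r m) + (\<integral>\<omega>. J (r m) \<omega> \<partial>M)" for m using hit[of "r m"] n(2)[of "r m"] by linarith
    ultimately have "p \<le> 0 + 0" by (intro LIMSEQ_le_const) auto
    then have "p \<le> 0" by simp
    then have "p = 0" unfolding p_def by (intro antisym measure_nonneg)
    then show ?thesis unfolding p_def .
  qed
  have "{\<omega> \<in> space M. \<tau> \<omega> = \<eta> \<omega> \<and> \<eta> \<omega> < \<infinity>} = (\<Union>k. {\<omega> \<in> space M. \<tau> \<omega> = \<eta> \<omega> \<and> \<eta> \<omega> \<le> ennreal (real (Suc k))})"
  proof -
    have "(x < \<infinity>) \<longleftrightarrow> (\<exists>k. x \<le> ennreal (real (Suc k)))" for x :: ennreal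
    proof
      assume "x < \<infinity>"
      then have "x = ennreal (enn2real x)" by (simp add: less_top)
      moreover obtain k where "enn2real x \<le> real k" using real_arch_simple by blast
      then have "ennreal (enn2real x) \<le> ennreal (real (Suc k))" by (intro ennreal_leI) simp
      ultimately have "x \<le> ennreal (real (Suc k))" by (simp only:)
      then show "\<exists>k. x \<le> ennreal (real (Suc k))" ..
    next
      assume "\<exists>k. x \<le> ennreal (real (Suc k))"
      then obtain k where "x \<le> ennreal (real (Suc k))" by (rule exE)
      also have "\<dots> < \<infinity>" by simp
      finally show "x < \<infinity>" .
    qed
    then show ?thesis by blast
  qed
  moreover have "(\<Union>k. {\<omega> \<in> space M. \<tau> \<omega> = \<eta> \<omega> \<and> \<eta> \<omega> \<le> ennreal (real (Suc k))}) \<in> null_sets M"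
  proof (rule null_sets_UN)
    fix k
    have k: "0 < real (Suc k)" by simp
    show "{\<omega> \<in> space M. \<tau> \<omega> = \<eta> \<omega> \<and> \<eta> \<omega> \<le> ennreal (real (Suc k))} \<in> null_sets M"
      using null[OF k] hit_sets[OF k] by (intro null_setsI) (simp_all only: emeasure_eq_measure ennreal_0)
  qed
  ultimately show "measure M {\<omega> \<in> space M. \<tau> \<omega> = \<eta> \<omega> \<and> \<eta> \<omega> < \<infinity>} = 0"
    by (simp add: measure_def null_setsD1)
qed

theorem proposition5p5:
  fixes M :: "'a measure"
    and \<sigma> :: real
    and W \<Lambda> :: "real \<Rightarrow> 'a \<Rightarrow> real"
    and \<tau> :: "'a \<Rightarrow> ennreal"
  assumes "prob_space M" and "complete_measure M"
    and "brownian_motion M \<sigma> W"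
    and "random_time M \<tau>"
    and "immersed M (completed_natural_filtration M W)
           (progressive_enlargement M (completed_natural_filtration M W) \<tau>)"
    and "predictable_compensator M
           (progressive_enlargement M (completed_natural_filtration M W) \<tau>) \<tau> \<Lambda>"
  shows "(AE \<omega> in M. continuous_on {0..} (\<lambda>t. \<Lambda> t \<omega>)) \<longleftrightarrow>
         avoids_stopping_times M (completed_natural_filtration M W) \<tau>"
proof -
  interpret prob_space M by fact
  interpret B: brownian_time M W \<sigma> \<tau>
    by unfold_locales (fact assms)+
  interpret I: immersed_time M "completed_natural_filtration M W" \<tau>
    by (intro immersed_time.intro immersed_time_axioms.intro B.prob_filtration_time_axioms
        assms(2,5) B.null_sets_F)
  show ?thesis
  proof
    assume "AE \<omega> in M. continuous_on {0..} (\<lambda>t. \<Lambda> t \<omega>)"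
    with assms(6) show "avoids_stopping_times M (completed_natural_filtration M W) \<tau>"
      by (rule B.compensator_continuous_imp_avoids) (rule B.no_jump_indicator, simp_all)
  next
    assume "avoids_stopping_times M (completed_natural_filtration M W) \<tau>"
    then show "AE \<omega> in M. continuous_on {0..} (\<lambda>t. \<Lambda> t \<omega>)"
      using assms(6) by (rule I.avoids_imp_compensator_continuous)
  qed
qed

end
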